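(* For any recursively inseparable pair $\langle A,B\rangle$, there is an r.e. theory $U_{\langle A,B\rangle}$ such that $\mathsf{G1}$ holds for $U_{\langle A,B\rangle}$ and $U_{\langle A,B\rangle}\lhd\mathbf R$ (namely the theory $U_{\langle A,B\rangle}$ described below).
   Context: A recursively inseparable pair is a pair $\langle A,B\rangle$ of disjoint r.e. subsets of $\mathbb N$ with no recursive $X\subseteq\mathbb N$ such that $A\subseteq X$ and $X\cap B=\emptyset$. $U_{\langle A,B\rangle}$ is the theory in language $\{\mathbf 0,\mathbf S,\mathbf P\}$ ($\mathbf P$ unary relation, $\overline n=\mathbf S^n\mathbf 0$) with axioms $\overline m\neq\overline n$ ($m\neq n$), $\mathbf P(\overline n)$ ($n\in A$), $\neg\mathbf P(\overline n)$ ($n\in B$). $\mathbf R$ is Robinson's theory in language $\{\mathbf 0,\mathbf S,+,\cdot,\le\}$ ($\le$ primitive) with schemes $\overline m+\overline n=\overline{m+n}$; $\overline m\cdot\overline n=\overline{m\cdot n}$; $\overline m\neq\overline n$ for $m\neq n$; $\forall x(x\le\overline n\to x=\overline 0\vee\dots\vee x=\overline n)$; $\forall x(x\le\overline n\vee\overline n\le x)$. "$\mathsf{G1}$ holds for $T$": for every recursively axiomatizable consistent theory $S$, if $T$ is interpretable in $S$ then $S$ is incomplete. $S\lhd T$: $S$ is interpretable in $T$ but $T$ is not interpretable in $S$ (relative interpretations). *)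

theory Defs
  imports Main "HOL-Library.Nat_Bijection"
begin

datatype recf = Zr | Sc | Id nat | Cn recf "recf list" | Pr recf recf | Mn recf

inductive eval :: "recf \<Rightarrow> nat list \<Rightarrow> nat \<Rightarrow> bool" where
  ev_Zr: "eval Zr xs 0"
| ev_Sc: "eval Sc (x # xs) (Suc x)"
| ev_Id: "i < length xs \<Longrightarrow> eval (Id i) xs (xs ! i)"
| ev_Cn: "list_all2 (\<lambda>g y. eval g xs y) gs ys \<Longrightarrow> eval f ys z \<Longrightarrow> eval (Cn f gs) xs z"
| ev_Pr0: "eval f xs y \<Longrightarrow> eval (Pr f g) (0 # xs) y"
| ev_PrS: "eval (Pr f g) (n # xs) y \<Longrightarrow> eval g (y # n # xs) z \<Longrightarrow> eval (Pr f g) (Suc n # xs) z"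
| ev_Mn: "eval f (n # xs) 0 \<Longrightarrow> (\<forall>m<n. \<exists>v. eval f (m # xs) v \<and> v \<noteq> 0) \<Longrightarrow> eval (Mn f) xs n"

definition recursive_set :: "nat set \<Rightarrow> bool" where
  "recursive_set X \<longleftrightarrow> (\<exists>f. \<forall>n. eval f [n] (if n \<in> X then 1 else 0))"

definition re_set :: "nat set \<Rightarrow> bool" where
  "re_set X \<longleftrightarrow> (\<exists>f. \<forall>n. n \<in> X \<longleftrightarrow> (\<exists>v. eval f [n] v))"

definition rec_inseparable :: "nat set \<Rightarrow> nat set \<Rightarrow> bool" where
  "rec_inseparable A B \<longleftrightarrow> re_set A \<and> re_set B \<and> A \<inter> B = {} \<and>
     \<not> (\<exists>X. recursive_set X \<and> A \<subseteq> X \<and> X \<inter> B = {})"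

text \<open>Symbols are natural numbers; a symbol is identified by its name together with
  its arity (the number of arguments it is applied to).\<close>
datatype trm = Var nat | Fn nat "trm list"

datatype fm = Bot | Eq trm trm | Rel nat "trm list" | Imp fm fm | All nat fm

definition Neg :: "fm \<Rightarrow> fm" where "Neg \<phi> = Imp \<phi> Bot"
definition Top :: fm where "Top = Imp Bot Bot"
definition Or :: "fm \<Rightarrow> fm \<Rightarrow> fm" where "Or \<phi> \<psi> = Imp (Neg \<phi>) \<psi>"
definition And :: "fm \<Rightarrow> fm \<Rightarrow> fm" where "And \<phi> \<psi> = Neg (Imp \<phi> (Neg \<psi>))"
definition Ex :: "nat \<Rightarrow> fm \<Rightarrow> fm" where "Ex x \<phi> = Neg (All x (Neg \<phi>))"

definition exs :: "nat list \<Rightarrow> fm \<Rightarrow> fm" where "exs xs \<phi> = foldr Ex xs \<phi>"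
definition alls :: "nat list \<Rightarrow> fm \<Rightarrow> fm" where "alls xs \<phi> = foldr All xs \<phi>"
definition conjs :: "fm list \<Rightarrow> fm" where "conjs \<phi>s = foldr And \<phi>s Top"
definition disjs :: "fm list \<Rightarrow> fm" where "disjs \<phi>s = foldr Or \<phi>s Bot"

fun tvars :: "trm \<Rightarrow> nat set" where
  "tvars (Var x) = {x}"
| "tvars (Fn f ts) = (\<Union>t\<in>set ts. tvars t)"

fun fv :: "fm \<Rightarrow> nat set" where
  "fv Bot = {}"
| "fv (Eq s t) = tvars s \<union> tvars t"
| "fv (Rel r ts) = (\<Union>t\<in>set ts. tvars t)"
| "fv (Imp \<phi> \<psi>) = fv \<phi> \<union> fv \<psi>"
| "fv (All x \<phi>) = fv \<phi> - {x}"

fun vars :: "fm \<Rightarrow> nat set" where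
  "vars Bot = {}"
| "vars (Eq s t) = tvars s \<union> tvars t"
| "vars (Rel r ts) = (\<Union>t\<in>set ts. tvars t)"
| "vars (Imp \<phi> \<psi>) = vars \<phi> \<union> vars \<psi>"
| "vars (All x \<phi>) = insert x (vars \<phi>)"

definition fresh :: "nat set \<Rightarrow> nat" where
  "fresh X = Suc (Max (insert 0 X))"

fun tsubst :: "(nat \<Rightarrow> trm) \<Rightarrow> trm \<Rightarrow> trm" where
  "tsubst \<sigma> (Var x) = \<sigma> x"
| "tsubst \<sigma> (Fn f ts) = Fn f (map (tsubst \<sigma>) ts)"

fun ssubst :: "(nat \<Rightarrow> trm) \<Rightarrow> fm \<Rightarrow> fm" where
  "ssubst \<sigma> Bot = Bot"
| "ssubst \<sigma> (Eq s t) = Eq (tsubst \<sigma> s) (tsubst \<sigma> t)"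
| "ssubst \<sigma> (Rel r ts) = Rel r (map (tsubst \<sigma>) ts)"
| "ssubst \<sigma> (Imp \<phi> \<psi>) = Imp (ssubst \<sigma> \<phi>) (ssubst \<sigma> \<psi>)"
| "ssubst \<sigma> (All x \<phi>) =
     (let z = fresh (insert x (vars \<phi> \<union> (\<Union>y\<in>fv \<phi>. tvars (\<sigma> y))))
      in All z (ssubst (\<sigma>(x := Var z)) \<phi>))"

definition inst :: "fm \<Rightarrow> nat list \<Rightarrow> fm" where
  "inst \<phi> vs = ssubst (\<lambda>i. if i < length vs then Var (vs ! i) else Var i) \<phi>"

record lang =
  fsyms :: "(nat \<times> nat) set"   \<comment> \<open>(name, arity) of function/constant symbols\<close>
  rsyms :: "(nat \<times> nat) set"   \<comment> \<open>(name, arity) of relation symbols\<close>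

fun trm_in :: "lang \<Rightarrow> trm \<Rightarrow> bool" where
  "trm_in L (Var x) = True"
| "trm_in L (Fn f ts) = ((f, length ts) \<in> fsyms L \<and> (\<forall>t\<in>set ts. trm_in L t))"

fun fm_in :: "lang \<Rightarrow> fm \<Rightarrow> bool" where
  "fm_in L Bot = True"
| "fm_in L (Eq s t) = (trm_in L s \<and> trm_in L t)"
| "fm_in L (Rel r ts) = ((r, length ts) \<in> rsyms L \<and> (\<forall>t\<in>set ts. trm_in L t))"
| "fm_in L (Imp \<phi> \<psi>) = (fm_in L \<phi> \<and> fm_in L \<psi>)"
| "fm_in L (All x \<phi>) = fm_in L \<phi>"

definition sentences :: "lang \<Rightarrow> fm set" where
  "sentences L = {\<phi>. fm_in L \<phi> \<and> fv \<phi> = {}}"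

inductive prv :: "fm set \<Rightarrow> fm \<Rightarrow> bool" where
  prv_ax: "\<phi> \<in> T \<Longrightarrow> prv T \<phi>"
| prv_K: "prv T (Imp \<phi> (Imp \<psi> \<phi>))"
| prv_S: "prv T (Imp (Imp \<phi> (Imp \<psi> \<chi>)) (Imp (Imp \<phi> \<psi>) (Imp \<phi> \<chi>)))"
| prv_DN: "prv T (Imp (Neg (Neg \<phi>)) \<phi>)"
| prv_inst: "prv T (Imp (All x \<phi>) (ssubst (Var(x := t)) \<phi>))"
| prv_vac: "x \<notin> fv \<phi> \<Longrightarrow> prv T (Imp \<phi> (All x \<phi>))"
| prv_dist: "prv T (Imp (All x (Imp \<phi> \<psi>)) (Imp (All x \<phi>) (All x \<psi>)))"
| prv_refl: "prv T (Eq t t)"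
| prv_leib: "prv T (Imp (Eq s t) (Imp (ssubst (Var(x := s)) \<phi>) (ssubst (Var(x := t)) \<phi>)))"
| prv_MP: "prv T (Imp \<phi> \<psi>) \<Longrightarrow> prv T \<phi> \<Longrightarrow> prv T \<psi>"
| prv_Gen: "prv T \<phi> \<Longrightarrow> prv T (All x \<phi>)"

type_synonym thy = "lang \<times> fm set"

definition wf_thy :: "thy \<Rightarrow> bool" where
  "wf_thy T \<longleftrightarrow> snd T \<subseteq> sentences (fst T)"

definition consistent :: "thy \<Rightarrow> bool" where
  "consistent T \<longleftrightarrow> \<not> prv (snd T) Bot"

definition complete :: "thy \<Rightarrow> bool" where
  "complete T \<longleftrightarrow> (\<forall>\<phi>\<in>sentences (fst T). prv (snd T) \<phi> \<or> prv (snd T) (Neg \<phi>))"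

fun enc_list :: "nat list \<Rightarrow> nat" where
  "enc_list [] = 0"
| "enc_list (x # xs) = Suc (prod_encode (x, enc_list xs))"

fun enc_trm :: "trm \<Rightarrow> nat" where
  "enc_trm (Var x) = prod_encode (0, x)"
| "enc_trm (Fn f ts) = prod_encode (1, prod_encode (f, enc_list (map enc_trm ts)))"

fun enc_fm :: "fm \<Rightarrow> nat" where
  "enc_fm Bot = prod_encode (0, 0)"
| "enc_fm (Eq s t) = prod_encode (1, prod_encode (enc_trm s, enc_trm t))"
| "enc_fm (Rel r ts) = prod_encode (2, prod_encode (r, enc_list (map enc_trm ts)))"
| "enc_fm (Imp \<phi> \<psi>) = prod_encode (3, prod_encode (enc_fm \<phi>, enc_fm \<psi>))"
| "enc_fm (All x \<phi>) = prod_encode (4, prod_encode (x, enc_fm \<phi>))"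

definition re_thy :: "thy \<Rightarrow> bool" where
  "re_thy T \<longleftrightarrow> re_set (enc_fm ` snd T)"

definition rec_axiomatizable :: "thy \<Rightarrow> bool" where
  "rec_axiomatizable T \<longleftrightarrow> (\<exists>Ax. Ax \<subseteq> sentences (fst T) \<and> recursive_set (enc_fm ` Ax) \<and>
      (\<forall>\<phi>. prv Ax \<phi> \<longleftrightarrow> prv (snd T) \<phi>))"

text \<open>An interpretation: a domain formula (free variable 0), for each relation symbol (r,n)
  a formula with free variables among 0..n-1, and for each function symbol (f,n) a formula
  with free variables among 0..n (the graph, output variable n). Equality is translated
  as equality.\<close>
type_synonym interp = "fm \<times> (nat \<times> nat \<Rightarrow> fm) \<times> (nat \<times> nat \<Rightarrow> fm)"

definition idom :: "interp \<Rightarrow> fm" where "idom I = fst I"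
definition irel :: "interp \<Rightarrow> nat \<times> nat \<Rightarrow> fm" where "irel I = fst (snd I)"
definition ifun :: "interp \<Rightarrow> nat \<times> nat \<Rightarrow> fm" where "ifun I = snd (snd I)"

text \<open>tr_trm I t y: "the value of t is y"; tr_args I ts b: the values of ts are
  b, b+1, ... (and lie in the domain)\<close>
fun tr_trm :: "interp \<Rightarrow> trm \<Rightarrow> nat \<Rightarrow> fm"
and tr_args :: "interp \<Rightarrow> trm list \<Rightarrow> nat \<Rightarrow> fm" where
  "tr_trm I (Var x) y = Eq (Var y) (Var x)"
| "tr_trm I (Fn f ts) y =
    (let n = length ts; b = fresh (insert y (\<Union>t\<in>set ts. tvars t))
     in exs [b..<b+n] (And (tr_args I ts b) (inst (ifun I (f, n)) ([b..<b+n] @ [y]))))"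
| "tr_args I [] b = Top"
| "tr_args I (t # ts) b = And (And (inst (idom I) [b]) (tr_trm I t b)) (tr_args I ts (Suc b))"

fun tr :: "interp \<Rightarrow> fm \<Rightarrow> fm" where
  "tr I Bot = Bot"
| "tr I (Eq s t) = (let b = fresh (tvars s \<union> tvars t)
     in exs [b, Suc b] (And (tr_args I [s, t] b) (Eq (Var b) (Var (Suc b)))))"
| "tr I (Rel r ts) = (let n = length ts; b = fresh (\<Union>t\<in>set ts. tvars t)
     in exs [b..<b+n] (And (tr_args I ts b) (inst (irel I (r, n)) [b..<b+n])))"
| "tr I (Imp \<phi> \<psi>) = Imp (tr I \<phi>) (tr I \<psi>)"
| "tr I (All x \<phi>) = All x (Imp (inst (idom I) [x]) (tr I \<phi>))"

definition fun_ok :: "interp \<Rightarrow> nat \<times> nat \<Rightarrow> fm" where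
  "fun_ok I fn = (let n = snd fn; F = ifun I fn in
     alls [0..<n] (Imp (conjs (map (\<lambda>i. inst (idom I) [i]) [0..<n]))
       (Ex n (And (inst (idom I) [n]) (And (inst F [0..<Suc n])
          (All (Suc n) (Imp (And (inst (idom I) [Suc n]) (inst F ([0..<n] @ [Suc n])))
                             (Eq (Var (Suc n)) (Var n)))))))))"

definition is_interpretation :: "interp \<Rightarrow> thy \<Rightarrow> thy \<Rightarrow> bool" where
  "is_interpretation I T S \<longleftrightarrow>
     fm_in (fst S) (idom I) \<and> fv (idom I) \<subseteq> {0} \<and>
     (\<forall>(r, n)\<in>rsyms (fst T). fm_in (fst S) (irel I (r, n)) \<and> fv (irel I (r, n)) \<subseteq> {..<n}) \<and>
     (\<forall>(f, n)\<in>fsyms (fst T). fm_in (fst S) (ifun I (f, n)) \<and> fv (ifun I (f, n)) \<subseteq> {..n}) \<and>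
     prv (snd S) (Ex 0 (idom I)) \<and>
     (\<forall>fn\<in>fsyms (fst T). prv (snd S) (fun_ok I fn)) \<and>
     (\<forall>\<phi>\<in>snd T. prv (snd S) (tr I \<phi>))"

definition interpretable :: "thy \<Rightarrow> thy \<Rightarrow> bool" where
  "interpretable T S \<longleftrightarrow> (\<exists>I. is_interpretation I T S)"

definition strictly_below :: "thy \<Rightarrow> thy \<Rightarrow> bool" where
  "strictly_below S T \<longleftrightarrow> interpretable S T \<and> \<not> interpretable T S"

definition G1_holds :: "thy \<Rightarrow> bool" where
  "G1_holds T \<longleftrightarrow> (\<forall>S. wf_thy S \<and> rec_axiomatizable S \<and> consistent S \<and> interpretable T S
                      \<longrightarrow> \<not> complete S)"

text \<open>symbols: function 0 = constant 0, function 1 = unary S (successor),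
  function 2 = binary +, function 3 = binary \<cdot>; relation 0 unary P, relation 1 binary \<le>\<close>
fun num :: "nat \<Rightarrow> trm" where
  "num 0 = Fn 0 []"
| "num (Suc n) = Fn 1 [num n]"

definition L_U :: lang where
  "L_U = \<lparr>fsyms = {(0, 0), (1, 1)}, rsyms = {(0, 1)}\<rparr>"

definition U_thy :: "nat set \<Rightarrow> nat set \<Rightarrow> thy" where
  "U_thy A B = (L_U,
     {Neg (Eq (num m) (num n)) | m n. m \<noteq> n} \<union>
     {Rel 0 [num n] | n. n \<in> A} \<union>
     {Neg (Rel 0 [num n]) | n. n \<in> B})"

definition L_R :: lang where
  "L_R = \<lparr>fsyms = {(0, 0), (1, 1), (2, 2), (3, 2)}, rsyms = {(1, 2)}\<rparr>"

definition plus :: "trm \<Rightarrow> trm \<Rightarrow> trm" where "plus s t = Fn 2 [s, t]"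
definition times :: "trm \<Rightarrow> trm \<Rightarrow> trm" where "times s t = Fn 3 [s, t]"
definition leq :: "trm \<Rightarrow> trm \<Rightarrow> fm" where "leq s t = Rel 1 [s, t]"

definition R_thy :: thy where
  "R_thy = (L_R,
     {Eq (plus (num m) (num n)) (num (m + n)) | m n. True} \<union>
     {Eq (times (num m) (num n)) (num (m * n)) | m n. True} \<union>
     {Neg (Eq (num m) (num n)) | m n. m \<noteq> n} \<union>
     {All 0 (Imp (leq (Var 0) (num n)) (disjs (map (\<lambda>i. Eq (Var 0) (num i)) [0..<Suc n]))) | n. True} \<union>
     {All 0 (Or (leq (Var 0) (num n)) (leq (num n) (Var 0))) | n. True})"

end

theory Submission
  imports Defs "HOL-Library.Countable" "HOL-Number_Theory.Cong"
begin

text \<open>If a complete consistent recursively axiomatizable \<open>S\<close> interpreted \<open>U\<close>, then the set of \<open>n\<close>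
  for which \<open>S\<close> proves the translation of \<open>P(n)\<close> would be recursive and would separate \<open>A\<close> from \<open>B\<close>.
  \<open>R\<close> interprets \<open>U\<close> because a Rosser-style comparison of witnesses gives a formula that \<open>R\<close>
  proves at each numeral in \<open>A\<close> and refutes at each numeral in \<open>B\<close>. Conversely, \<open>U\<close> has a model, a
  disjoint union of coloured lines, in which truth depends only on bounded neighbourhoods. By the
  pigeonhole principle no formula orders an infinite set of its elements, whereas the order of \<open>R\<close>
  does so on the numerals.

  Statements about provability are reduced to statements about models by the completeness theorem,
  and recursive enumerability is established through definability by existentially quantified bounded
  formulas, which are closed under inductive definitions.\<close>

section \<open>Semantics, soundness and completeness\<close>

text \<open>The obstacle in the recursion-theoretic half is that \<open>ssubst\<close> renames each
  bound variable it passes, with a name computed from the whole matrix. Rather than follow this on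
  codes, the coded calculus accepts as instantiation and Leibniz axioms everything that agrees with
  a genuine instance up to the names of bound variables. This yields more axioms but no new
  theorems, because alpha-equivalent formulas provably imply one another. For the same reason the
  separating set is read off not from the translation of P(n) itself but from a formula true in the
  same models, whose code arises by iterating one fixed function. Completeness of \<open>S\<close>
  turns the complement of that set into the set of refuted instances, and Post's theorem makes it
  recursive. \<open>R\<close> says nothing about elements beyond the numerals except that what lies
  below a numeral is a numeral and that numerals are comparable with everything; these two facts are
  what Rosser's comparison uses. In the other half the language of \<open>U\<close> relates two
  elements only through successors and equality, so each quantifier merely doubles the radius that a
  formula can see.\<close>

lemma fresh_notin: "finite X \<Longrightarrow> fresh X \<notin> X"
proof
  assume "finite X" "fresh X \<in> X"
  then have "fresh X \<le> Max (insert 0 X)" by (intro Max_ge) auto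
  then show False by (simp add: fresh_def)
qed

lemma fresh_gt: "finite X \<Longrightarrow> x \<in> X \<Longrightarrow> x < fresh X"
  by (simp add: fresh_def less_Suc_eq_le)

lemma finite_tvars [simp]: "finite (tvars t)"
  by (induction t) auto

lemma finite_vars [simp]: "finite (vars \<phi>)"
  by (induction \<phi>) auto

lemma fv_subset_vars: "fv \<phi> \<subseteq> vars \<phi>"
  by (induction \<phi>) auto

lemma finite_fv [simp]: "finite (fv \<phi>)"
  using finite_subset[OF fv_subset_vars] by simp

fun val :: "(nat \<Rightarrow> 'a list \<Rightarrow> 'a) \<Rightarrow> (nat \<Rightarrow> 'a) \<Rightarrow> trm \<Rightarrow> 'a" where
  "val F e (Var x) = e x"
| "val F e (Fn f ts) = F f (map (val F e) ts)"

text \<open>Quantifiers range over a set \<open>D\<close> and not over the whole type, so that the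
  domain cut out by an interpretation is again a structure over the same type.\<close>

fun sat :: "'a set \<Rightarrow> (nat \<Rightarrow> 'a list \<Rightarrow> 'a) \<Rightarrow> (nat \<Rightarrow> 'a list \<Rightarrow> bool) \<Rightarrow> (nat \<Rightarrow> 'a) \<Rightarrow> fm \<Rightarrow> bool"
where
  "sat D F R e Bot = False"
| "sat D F R e (Eq s t) = (val F e s = val F e t)"
| "sat D F R e (Rel r ts) = R r (map (val F e) ts)"
| "sat D F R e (Imp \<phi> \<psi>) = (sat D F R e \<phi> \<longrightarrow> sat D F R e \<psi>)"
| "sat D F R e (All x \<phi>) = (\<forall>d\<in>D. sat D F R (e(x := d)) \<phi>)"

lemma sat_connectives [simp]:
  "sat D F R e (Neg \<phi>) = (\<not> sat D F R e \<phi>)"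
  "sat D F R e Top"
  "sat D F R e (And \<phi> \<psi>) = (sat D F R e \<phi> \<and> sat D F R e \<psi>)"
  "sat D F R e (Or \<phi> \<psi>) = (sat D F R e \<phi> \<or> sat D F R e \<psi>)"
  "sat D F R e (Ex x \<phi>) = (\<exists>d\<in>D. sat D F R (e(x := d)) \<phi>)"
  by (auto simp: Neg_def Top_def And_def Or_def Ex_def)

lemma fv_connectives [simp]:
  "fv (Neg \<phi>) = fv \<phi>" "fv Top = {}" "fv (And \<phi> \<psi>) = fv \<phi> \<union> fv \<psi>"
  "fv (Or \<phi> \<psi>) = fv \<phi> \<union> fv \<psi>" "fv (Ex x \<phi>) = fv \<phi> - {x}"
  by (auto simp: Neg_def Top_def And_def Or_def Ex_def)

lemma fm_in_connectives [simp]: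
  "fm_in L (Neg \<phi>) = fm_in L \<phi>" "fm_in L Top" "fm_in L (And \<phi> \<psi>) = (fm_in L \<phi> \<and> fm_in L \<psi>)"
  "fm_in L (Or \<phi> \<psi>) = (fm_in L \<phi> \<and> fm_in L \<psi>)" "fm_in L (Ex x \<phi>) = fm_in L \<phi>"
  by (auto simp: Neg_def Top_def And_def Or_def Ex_def)

lemma val_cong: "(\<And>x. x \<in> tvars t \<Longrightarrow> e x = e' x) \<Longrightarrow> val F e t = val F e' t"
proof (induction t)
  case (Fn f ts)
  then have "map (val F e) ts = map (val F e') ts" by (intro map_cong) auto
  then show ?case by (simp only: val.simps)
qed simp

lemma sat_cong: "(\<And>x. x \<in> fv \<phi> \<Longrightarrow> e x = e' x) \<Longrightarrow> sat D F R e \<phi> = sat D F R e' \<phi>"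
proof (induction \<phi> arbitrary: e e')
  case (Eq s t)
  then show ?case using val_cong[of s e e'] val_cong[of t e e'] by auto
next
  case (Rel r ts)
  then have "map (val F e) ts = map (val F e') ts" by (auto intro!: val_cong)
  then show ?case by (simp only: sat.simps)
next
  case (Imp \<phi> \<psi>)
  show ?case using Imp.IH[of e e'] Imp.prems by auto
next
  case (All x \<phi>)
  have "sat D F R (e(x := d)) \<phi> = sat D F R (e'(x := d)) \<phi>" for d
    using All.prems by (intro All.IH) auto
  then show ?case by simp
qed simp

lemma val_tsubst: "val F e (tsubst \<sigma> t) = val F (\<lambda>x. val F e (\<sigma> x)) t"
  by (induction t) (auto intro!: arg_cong[where f = "F _"])

lemma val_upd_notin: "z \<notin> tvars t \<Longrightarrow> val F (e(z := d)) t = val F e t"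
  by (rule val_cong) auto

lemma tsubst_cong: "(\<And>x. x \<in> tvars t \<Longrightarrow> \<sigma> x = \<tau> x) \<Longrightarrow> tsubst \<sigma> t = tsubst \<tau> t"
  by (induction t) auto

lemma tsubst_tsubst: "tsubst \<sigma> (tsubst \<tau> t) = tsubst (\<lambda>x. tsubst \<sigma> (\<tau> x)) t"
  by (induction t) auto

lemma tsubst_Var [simp]: "tsubst Var t = t"
  by (induction t) (auto simp: map_idI)

lemma fresh_subst_notin:
  assumes "y \<in> fv \<phi>" "y \<noteq> x"
  shows "fresh (insert x (vars \<phi> \<union> (\<Union>y\<in>fv \<phi>. tvars (\<sigma> y)))) \<notin> tvars (\<sigma> y)"
proof -
  have "fresh (insert x (vars \<phi> \<union> (\<Union>y\<in>fv \<phi>. tvars (\<sigma> y))))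
      \<notin> insert x (vars \<phi> \<union> (\<Union>y\<in>fv \<phi>. tvars (\<sigma> y)))"
    by (rule fresh_notin) simp
  with assms show ?thesis by auto
qed

lemma sat_ssubst: "sat D F R e (ssubst \<sigma> \<phi>) = sat D F R (\<lambda>x. val F e (\<sigma> x)) \<phi>"
proof (induction \<phi> arbitrary: e \<sigma>)
  case (All x \<phi>)
  define z where "z = fresh (insert x (vars \<phi> \<union> (\<Union>y\<in>fv \<phi>. tvars (\<sigma> y))))"
  have "sat D F R (\<lambda>y. val F (e(z := d)) ((\<sigma>(x := Var z)) y)) \<phi>
      = sat D F R ((\<lambda>y. val F e (\<sigma> y))(x := d)) \<phi>" for d
    by (rule sat_cong) (auto intro!: val_upd_notin simp: z_def fresh_subst_notin)
  then show ?case by (simp add: Let_def z_def[symmetric] All.IH del: fun_upd_apply)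
qed (simp_all add: val_tsubst comp_def)

text \<open>Axioms are required at every assignment into \<open>D\<close>; this is what makes the
  unrestricted generalization rule sound.\<close>

definition model :: "'a set \<Rightarrow> (nat \<Rightarrow> 'a list \<Rightarrow> 'a) \<Rightarrow> (nat \<Rightarrow> 'a list \<Rightarrow> bool) \<Rightarrow> fm set \<Rightarrow> bool" where
  "model D F R T \<longleftrightarrow> D \<noteq> {} \<and> (\<forall>f xs. set xs \<subseteq> D \<longrightarrow> F f xs \<in> D) \<and>
     (\<forall>\<tau>\<in>T. \<forall>e. range e \<subseteq> D \<longrightarrow> sat D F R e \<tau>)"

lemma val_in_dom:
  "\<lbrakk>\<And>f xs. set xs \<subseteq> D \<Longrightarrow> F f xs \<in> D; range e \<subseteq> D\<rbrakk> \<Longrightarrow> val F e t \<in> D"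
  by (induction t) (auto simp: image_subset_iff)

lemma sat_subst1: "sat D F R e (ssubst (Var(x := t)) \<phi>) = sat D F R (e(x := val F e t)) \<phi>"
proof -
  have "(\<lambda>y. val F e ((Var(x := t)) y)) = e(x := val F e t)" by auto
  then show ?thesis by (simp add: sat_ssubst)
qed

theorem soundness:
  assumes "prv T \<phi>" and M: "model D F R T" and "range e \<subseteq> D"
  shows "sat D F R e \<phi>"
  using assms(1,3) M
proof (induction arbitrary: e rule: prv.induct)
  case (prv_inst T x \<phi> t)
  then have "val F e t \<in> D" by (intro val_in_dom) (auto simp: model_def)
  then show ?case by (simp add: sat_subst1)
next
  case (prv_vac x \<phi> T)
  have "sat D F R (e(x := d)) \<phi> = sat D F R e \<phi>" for d
    by (rule sat_cong) (use prv_vac in auto)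
  then show ?case by simp
next
  case (prv_Gen T \<phi> x)
  then show ?case by (auto intro!: prv_Gen.IH)
qed (auto simp: model_def sat_subst1)

section \<open>Deduction from local hypotheses\<close>

lemma prv_id: "prv T (Imp \<phi> \<phi>)"
  by (meson prv_K prv_S prv_MP)

lemma prv_imp_trans: "prv T (Imp \<phi> \<psi>) \<Longrightarrow> prv T (Imp \<psi> \<chi>) \<Longrightarrow> prv T (Imp \<phi> \<chi>)"
  by (meson prv_K prv_S prv_MP)

text \<open>Generalization is not available over the local hypotheses \<open>\<Gamma>\<close>, so that these may contain free
  variables, which will serve as Henkin witnesses.\<close>

inductive loc :: "fm set \<Rightarrow> fm set \<Rightarrow> fm \<Rightarrow> bool" for T \<Gamma> where
  loc_hyp: "\<phi> \<in> \<Gamma> \<Longrightarrow> loc T \<Gamma> \<phi>"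
| loc_thm: "prv T \<phi> \<Longrightarrow> loc T \<Gamma> \<phi>"
| loc_MP: "loc T \<Gamma> (Imp \<phi> \<psi>) \<Longrightarrow> loc T \<Gamma> \<phi> \<Longrightarrow> loc T \<Gamma> \<psi>"

lemma loc_empty: "loc T {} \<phi> \<Longrightarrow> prv T \<phi>"
  by (induction rule: loc.induct) (auto intro: prv_MP)

lemma loc_mono: "loc T \<Gamma> \<phi> \<Longrightarrow> \<Gamma> \<subseteq> \<Delta> \<Longrightarrow> loc T \<Delta> \<phi>"
  by (induction rule: loc.induct) (auto intro: loc.intros)

lemma loc_ded: "loc T (insert \<alpha> \<Gamma>) \<phi> \<Longrightarrow> loc T \<Gamma> (Imp \<alpha> \<phi>)"
proof (induction rule: loc.induct)
  case (loc_hyp \<phi>)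
  then show ?case
    by (metis insertE loc.loc_hyp loc_MP loc_thm prv_K prv_id)
next
  case (loc_thm \<phi>)
  then show ?case by (meson loc.loc_thm prv_K prv_MP)
next
  case (loc_MP \<phi> \<psi>)
  then show ?case by (meson loc.loc_thm loc.loc_MP prv_S)
qed

lemma loc_undischarge: "loc T \<Gamma> (Imp \<alpha> \<phi>) \<Longrightarrow> loc T (insert \<alpha> \<Gamma>) \<phi>"
  by (meson insertI1 loc_hyp loc_MP loc_mono subset_insertI)

lemma loc_contr: "loc T (insert (Neg \<phi>) \<Gamma>) Bot \<Longrightarrow> loc T \<Gamma> \<phi>"
  by (metis Neg_def loc_MP loc_ded loc_thm prv_DN)

lemma loc_exfalso: "loc T \<Gamma> Bot \<Longrightarrow> loc T \<Gamma> \<phi>"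
  by (meson loc_contr loc_mono subset_insertI)

text \<open>\<open>prv_dist\<close> pushes the quantifier through every modus ponens, so it only has
  to be introduced at the leaves: vacuously at hypotheses and by \<open>prv_Gen\<close> at
  theorems.\<close>

lemma loc_Gen: "loc T \<Gamma> \<phi> \<Longrightarrow> (\<And>\<gamma>. \<gamma> \<in> \<Gamma> \<Longrightarrow> z \<notin> fv \<gamma>) \<Longrightarrow> loc T \<Gamma> (All z \<phi>)"
proof (induction rule: loc.induct)
  case (loc_hyp \<phi>)
  then show ?case by (meson loc.loc_hyp loc_MP loc_thm prv_vac)
next
  case (loc_thm \<phi>)
  then show ?case by (meson loc.loc_thm prv_Gen)
next
  case (loc_MP \<phi> \<psi>)
  then show ?case by (meson loc.loc_MP loc.loc_thm prv_dist)
qed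

section \<open>Normal forms and alpha-equivalence\<close>

text \<open>In the normal form, a free variable \<open>x\<close> becomes \<open>2 x\<close> and a variable bound at depth \<open>d\<close>
  becomes \<open>2 d + 1\<close> (the binders keep the dummy name 0), so that two formulas are
  alpha-equivalent iff their normal forms under \<open>dbl\<close> coincide.\<close>

fun nf :: "nat \<Rightarrow> (nat \<Rightarrow> trm) \<Rightarrow> fm \<Rightarrow> fm" where
  "nf d \<sigma> Bot = Bot"
| "nf d \<sigma> (Eq s t) = Eq (tsubst \<sigma> s) (tsubst \<sigma> t)"
| "nf d \<sigma> (Rel r ts) = Rel r (map (tsubst \<sigma>) ts)"
| "nf d \<sigma> (Imp \<phi> \<psi>) = Imp (nf d \<sigma> \<phi>) (nf d \<sigma> \<psi>)"
| "nf d \<sigma> (All x \<phi>) = All 0 (nf (Suc d) (\<sigma>(x := Var (2 * d + 1))) \<phi>)"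

definition dbl :: "nat \<Rightarrow> trm" where "dbl x = Var (2 * x)"

lemma tsubst_eq_iff: "tsubst \<sigma> t = tsubst \<tau> t \<longleftrightarrow> (\<forall>x\<in>tvars t. \<sigma> x = \<tau> x)"
  by (induction t) auto

text \<open>Normal forms thus detect free variables, which later gives a test of freeness on codes.
  Below a binder both substitutions are updated alike, so only free occurrences can differ.\<close>

lemma nf_eq_iff: "nf d \<sigma> \<phi> = nf d \<tau> \<phi> \<longleftrightarrow> (\<forall>x\<in>fv \<phi>. \<sigma> x = \<tau> x)"
proof (induction \<phi> arbitrary: d \<sigma> \<tau>)
  case (All x \<phi>)
  then show ?case by auto
qed (auto simp: tsubst_eq_iff)

lemma nf_ssubst: "nf d \<sigma> (ssubst \<tau> \<phi>) = nf d (\<lambda>x. tsubst \<sigma> (\<tau> x)) \<phi>"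
proof (induction \<phi> arbitrary: d \<sigma> \<tau>)
  case (All x \<phi>)
  define z where "z = fresh (insert x (vars \<phi> \<union> (\<Union>y\<in>fv \<phi>. tvars (\<tau> y))))"
  \<comment> \<open>The update at the fresh \<open>z\<close> is invisible in the terms substituted
    for the other free variables, so the name chosen by \<open>ssubst\<close> leaves no
    trace.\<close>
  have "nf d' (\<lambda>y. tsubst (\<sigma>(z := u)) ((\<tau>(x := Var z)) y)) \<phi>
      = nf d' ((\<lambda>y. tsubst \<sigma> (\<tau> y))(x := u)) \<phi>" for d' u
    unfolding nf_eq_iff
    by (auto intro!: tsubst_cong simp: z_def) (metis fresh_subst_notin)
  then show ?case by (simp add: Let_def z_def[symmetric] All.IH del: fun_upd_apply)
qed (simp_all add: tsubst_tsubst comp_def)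

lemma nf_ssubst1: "nf 0 dbl (ssubst (Var(x := t)) \<phi>) = nf 0 (dbl(x := tsubst dbl t)) \<phi>"
proof -
  have "(\<lambda>y. tsubst dbl ((Var(x := t)) y)) = dbl(x := tsubst dbl t)" by auto
  then show ?thesis by (simp add: nf_ssubst)
qed

text \<open>Normal forms are compared as trees and never evaluated, so a replacement that ignores
  the binders is the right way to renumber their depth markers.\<close>

fun leaf_subst :: "(nat \<Rightarrow> trm) \<Rightarrow> fm \<Rightarrow> fm" where
  "leaf_subst \<rho> Bot = Bot"
| "leaf_subst \<rho> (Eq s t) = Eq (tsubst \<rho> s) (tsubst \<rho> t)"
| "leaf_subst \<rho> (Rel r ts) = Rel r (map (tsubst \<rho>) ts)"
| "leaf_subst \<rho> (Imp \<phi> \<psi>) = Imp (leaf_subst \<rho> \<phi>) (leaf_subst \<rho> \<psi>)"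
| "leaf_subst \<rho> (All x \<phi>) = All x (leaf_subst \<rho> \<phi>)"

lemma leaf_subst_nf:
  "(\<And>k. \<rho> (2 * (k + m) + 1) = Var (2 * k + 1)) \<Longrightarrow>
    leaf_subst \<rho> (nf (d + m) \<sigma> \<phi>) = nf d (\<lambda>x. tsubst \<rho> (\<sigma> x)) \<phi>"
proof (induction \<phi> arbitrary: d \<sigma>)
  case (All x \<phi>)
  have "leaf_subst \<rho> (nf (d + m) \<sigma> (All x \<phi>))
      = All 0 (nf (Suc d) (\<lambda>y. tsubst \<rho> ((\<sigma>(x := Var (2 * (d + m) + 1))) y)) \<phi>)"
    using All.IH[of "Suc d"] All.prems by (simp del: fun_upd_apply)
  also have "(\<lambda>y. tsubst \<rho> ((\<sigma>(x := Var (2 * (d + m) + 1))) y))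
      = (\<lambda>y. tsubst \<rho> (\<sigma> y))(x := Var (2 * d + 1))"
    using All.prems by (auto simp: fun_eq_iff)
  finally show ?case by (simp only: nf.simps)
qed (simp_all add: tsubst_tsubst comp_def)

lemma nf_All_body:
  assumes "nf 0 dbl (All x \<phi>) = nf 0 dbl (All y \<psi>)"
  shows "nf 0 dbl (ssubst (Var(x := Var y)) \<phi>) = nf 0 dbl \<psi>" and "y \<notin> fv (All x \<phi>)"
proof -
  \<comment> \<open>Removing the outer quantifier: its marker 1 becomes the free variable
    \<open>y\<close>, and every deeper marker moves up by one level.\<close>
  define \<rho> where "\<rho> k = (if k = 1 then Var (2 * y) else if even k then Var k else Var (k - 2))" for k :: nat
  have \<rho>: "\<rho> (2 * (k + 1) + 1) = Var (2 * k + 1)" for k by (simp add: \<rho>_def)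
  have *: "nf 1 (dbl(x := Var 1)) \<phi> = nf 1 (dbl(y := Var 1)) \<psi>"
    using assms by simp
  have "nf 0 (\<lambda>z. tsubst \<rho> ((dbl(x := Var 1)) z)) \<phi> = nf 0 (\<lambda>z. tsubst \<rho> ((dbl(y := Var 1)) z)) \<psi>"
    using arg_cong[OF *, of "leaf_subst \<rho>"] leaf_subst_nf[of \<rho> 1 0, OF \<rho>] by simp
  moreover have "(\<lambda>z. tsubst \<rho> ((dbl(x := Var 1)) z)) = dbl(x := tsubst dbl (Var y))"
    by (auto simp: dbl_def \<rho>_def)
  moreover have "(\<lambda>z. tsubst \<rho> ((dbl(y := Var 1)) z)) = dbl"
    by (auto simp: dbl_def \<rho>_def)
  ultimately show "nf 0 dbl (ssubst (Var(x := Var y)) \<phi>) = nf 0 dbl \<psi>"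
    by (simp add: nf_ssubst1)
  \<comment> \<open>Recoding the free variable \<open>y\<close> as the odd variable 1 does not
    affect the normal form of \<open>All y \<psi>\<close>, hence not that of
    \<open>All x \<phi>\<close> either. As \<open>dbl\<close> yields only even variables,
    \<open>y\<close> cannot be free there.\<close>
  define \<rho>' where "\<rho>' k = (if k = 2 * y then Var 1 else Var k)" for k :: nat
  have \<rho>': "\<rho>' (2 * (k + 0) + 1) = Var (2 * k + 1)" for k
    unfolding \<rho>'_def by (auto; presburger)
  have sub: "(\<lambda>z. tsubst \<rho>' (dbl z)) = dbl(y := Var 1)"
    by (auto simp: dbl_def \<rho>'_def)
  have "nf 0 (dbl(y := Var 1)) (All x \<phi>) = nf 0 (dbl(y := Var 1)) (All y \<psi>)"
    using arg_cong[OF assms, of "leaf_subst \<rho>'"] leaf_subst_nf[of \<rho>' 0 0 dbl, OF \<rho>'] sub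
    by (simp del: nf.simps)
  also have "\<dots> = nf 0 dbl (All y \<psi>)" by simp
  finally have "nf 0 (dbl(y := Var 1)) (All x \<phi>) = nf 0 dbl (All x \<phi>)" using assms by simp
  then show "y \<notin> fv (All x \<phi>)"
    unfolding nf_eq_iff dbl_def by (metis fun_upd_same trm.inject(1) dvd_triv_left odd_one)
qed

lemma size_ssubst [simp]: "size (ssubst \<sigma> \<phi>) = size \<phi>"
proof (induction \<phi> arbitrary: \<sigma>)
qed (simp_all add: Let_def)

lemma size_nf [simp]: "size (nf d \<sigma> \<phi>) = size \<phi>"
  by (induction \<phi> arbitrary: d \<sigma>) simp_all

text \<open>This is what permits the coded calculus to recognise axioms only up to the names of
  bound variables.\<close>

lemma alpha_prv:
  "nf 0 dbl \<phi> = nf 0 dbl \<psi> \<Longrightarrow> prv T (Imp \<phi> \<psi>)"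
proof (induction "size \<phi>" arbitrary: \<phi> \<psi> rule: less_induct)
  case less
  have inj: "tsubst dbl s = tsubst dbl t \<Longrightarrow> s = t" for s t
  proof -
    assume "tsubst dbl s = tsubst dbl t"
    then have "tsubst (\<lambda>k. Var (k div 2)) (tsubst dbl s) = tsubst (\<lambda>k. Var (k div 2)) (tsubst dbl t)" by simp
    then show ?thesis by (simp add: tsubst_tsubst dbl_def)
  qed
  have injl: "map (tsubst dbl) ss = map (tsubst dbl) ts \<Longrightarrow> ss = ts" for ss ts
    using inj by (metis injI list.inj_map_strong)
  show ?case
  proof (cases \<phi>)
    case Bot
    with less.prems show ?thesis by (cases \<psi>) (auto intro: prv_id)
  next
    case (Eq s t)
    with less.prems show ?thesis by (cases \<psi>) (auto intro: prv_id dest!: inj)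
  next
    case (Rel r ts)
    with less.prems show ?thesis by (cases \<psi>) (auto intro: prv_id dest!: injl)
  next
    case (Imp \<phi>1 \<phi>2)
    with less.prems obtain \<psi>1 \<psi>2 where \<psi>: "\<psi> = Imp \<psi>1 \<psi>2"
      "nf 0 dbl \<phi>1 = nf 0 dbl \<psi>1" "nf 0 dbl \<phi>2 = nf 0 dbl \<psi>2"
      by (cases \<psi>) auto
    \<comment> \<open>Implication reverses its premise, so the induction hypothesis is applied to
      \<open>\<psi>1\<close>, which is no subformula of \<open>\<phi>\<close>; hence the induction
      on size.\<close>
    have sz: "size \<psi>1 = size \<phi>1" using \<psi>(2) size_nf by metis
    have "prv T (Imp \<psi>1 \<phi>1)" "prv T (Imp \<phi>2 \<psi>2)"
      using less.hyps \<psi> Imp sz by auto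
    then have "loc T {\<psi>1, Imp \<phi>1 \<phi>2} \<psi>2"
      by (meson insertI1 insertI2 loc.intros)
    then show ?thesis using Imp \<psi>(1) loc_ded loc_empty by metis
  next
    case (All x \<phi>')
    with less.prems obtain y \<psi>' where \<psi>: "\<psi> = All y \<psi>'" by (cases \<psi>) auto
    have "prv T (Imp (ssubst (Var(x := Var y)) \<phi>') \<psi>')"
      using nf_All_body(1) less.prems All \<psi> by (intro less.hyps) auto
    then have "prv T (Imp (All x \<phi>') \<psi>')" using prv_inst prv_imp_trans by blast
    then have "prv T (Imp (All y (All x \<phi>')) (All y \<psi>'))" by (meson prv_Gen prv_dist prv_MP)
    moreover have "prv T (Imp (All x \<phi>') (All y (All x \<phi>')))"
      using nf_All_body(2) less.prems All \<psi> by (intro prv_vac) auto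
    ultimately show ?thesis using All \<psi> prv_imp_trans by blast
  qed
qed

text \<open>The Henkin argument generalizes over the witness variable \<open>z\<close>; this turns
  the result back into a quantification over the original variable.\<close>

lemma prv_rename_All:
  assumes "z \<notin> vars \<phi>"
  shows "prv T (Imp (All z (ssubst (Var(x := Var z)) \<phi>)) (All x \<phi>))"
proof (rule alpha_prv)
  have "nf 1 (dbl(z := Var 1)) (ssubst (Var(x := Var z)) \<phi>) = nf 1 (dbl(x := Var 1)) \<phi>"
    unfolding nf_ssubst nf_eq_iff using assms fv_subset_vars by auto
  then show "nf 0 dbl (All z (ssubst (Var(x := Var z)) \<phi>)) = nf 0 dbl (All x \<phi>)"
    by (simp del: fun_upd_apply)
qed

section \<open>Henkin's construction of a term model\<close>

instance trm :: countable by countable_datatype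
instance fm :: countable by countable_datatype

definition con :: "fm set \<Rightarrow> fm set \<Rightarrow> bool" where
  "con T \<Gamma> \<longleftrightarrow> \<not> loc T \<Gamma> Bot"

text \<open>The witness is a variable fresh for \<open>\<Gamma>\<close>: if the matrix fails
  anywhere, it fails there. The language is not extended.\<close>

fun henkin :: "fm set \<Rightarrow> fm \<Rightarrow> fm" where
  "henkin \<Gamma> (All x \<phi>) = Imp (ssubst (Var(x := Var (fresh (insert x (vars \<phi> \<union> \<Union>(vars ` \<Gamma>)))))) \<phi>) (All x \<phi>)"
| "henkin \<Gamma> \<phi> = Top"

lemma con_henkin:
  assumes "con T \<Gamma>" "finite \<Gamma>"
  shows "con T (insert (henkin \<Gamma> \<phi>) \<Gamma>)"
proof (cases "\<exists>x \<psi>. \<phi> = All x \<psi>")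
  case False
  then have "henkin \<Gamma> \<phi> = Top" by (cases \<phi>) auto
  moreover have "prv T Top" unfolding Top_def by (rule prv_id)
  ultimately show ?thesis using assms(1) unfolding con_def
    by (metis loc_MP loc_ded loc_thm)
next
  case True
  then obtain x \<psi> where \<phi>: "\<phi> = All x \<psi>" by blast
  define z where "z = fresh (insert x (vars \<psi> \<union> \<Union>(vars ` \<Gamma>)))"
  have z: "z \<notin> insert x (vars \<psi> \<union> \<Union>(vars ` \<Gamma>))"
    unfolding z_def by (rule fresh_notin) (use assms(2) in auto)
  let ?I = "ssubst (Var(x := Var z)) \<psi>"
  show ?thesis unfolding con_def
  proof
    assume "loc T (insert (henkin \<Gamma> \<phi>) \<Gamma>) Bot"
    then have n: "loc T \<Gamma> (Imp (Imp ?I (All x \<psi>)) Bot)"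
      using loc_ded by (auto simp: \<phi> z_def)
    \<comment> \<open>\<open>n\<close> refutes an implication, so its conclusion is refutable and
      its premise is derivable. The premise, being about a variable fresh for
      \<open>\<Gamma>\<close>, generalizes to the conclusion.\<close>
    have "loc T (insert (All x \<psi>) \<Gamma>) (Imp ?I (All x \<psi>))"
      by (meson insertI1 loc_MP loc_hyp loc_thm prv_K)
    then have nA: "loc T \<Gamma> (Imp (All x \<psi>) Bot)"
      using n by (meson loc_MP loc_ded loc_mono subset_insertI)
    have "loc T (insert ?I (insert (Neg ?I) \<Gamma>)) Bot"
      unfolding Neg_def by (meson insertI1 insertI2 loc_MP loc_hyp)
    then have "loc T (insert (Neg ?I) \<Gamma>) (Imp ?I (All x \<psi>))"
      using loc_exfalso loc_ded by blast
    then have "loc T (insert (Neg ?I) \<Gamma>) Bot"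
      using n by (meson loc_MP loc_mono subset_insertI)
    then have "loc T \<Gamma> ?I" by (rule loc_contr)
    then have "loc T \<Gamma> (All z ?I)"
      by (rule loc_Gen) (use z fv_subset_vars in auto)
    then have "loc T \<Gamma> (All x \<psi>)"
      using prv_rename_All[of z \<psi>] z by (meson UnI1 insertI2 loc_MP loc_thm)
    with nA have "loc T \<Gamma> Bot" by (rule loc_MP)
    with assms(1) show False by (simp add: con_def)
  qed
qed

text \<open>Only \<open>\<phi>\<close> and the formulas added so far are local hypotheses, while
  \<open>T\<close> enters through \<open>prv\<close>. Every stage is therefore finite, and a fresh
  variable for the next Henkin axiom exists.\<close>

primrec chain :: "fm set \<Rightarrow> fm \<Rightarrow> nat \<Rightarrow> fm set" where
  "chain T \<phi> 0 = {\<phi>}"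
| "chain T \<phi> (Suc n) = (let \<Gamma> = insert (henkin (chain T \<phi> n) (from_nat n)) (chain T \<phi> n)
     in if con T (insert (from_nat n) \<Gamma>) then insert (from_nat n) \<Gamma> else \<Gamma>)"

lemma finite_chain: "finite (chain T \<phi> n)"
  by (induction n) (auto simp: Let_def)

lemma con_chain: "con T {\<phi>} \<Longrightarrow> con T (chain T \<phi> n)"
  by (induction n) (auto simp: Let_def con_henkin finite_chain)

lemma chain_mono: "m \<le> n \<Longrightarrow> chain T \<phi> m \<subseteq> chain T \<phi> n"
  by (rule lift_Suc_mono_le[of "chain T \<phi>"]) (auto simp: Let_def)

lemma loc_Union_chain: "loc T (\<Union>n. chain T \<phi> n) \<psi> \<Longrightarrow> \<exists>n. loc T (chain T \<phi> n) \<psi>"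
proof (induction rule: loc.induct)
  case (loc_MP \<psi> \<chi>)
  then obtain m n where "loc T (chain T \<phi> m) (Imp \<psi> \<chi>)" "loc T (chain T \<phi> n) \<psi>" by blast
  then have "loc T (chain T \<phi> (max m n)) (Imp \<psi> \<chi>)" "loc T (chain T \<phi> (max m n)) \<psi>"
    by (meson loc_mono chain_mono max.cobounded1 max.cobounded2)+
  then show ?case by (meson loc.loc_MP)
qed (auto intro: loc.intros)

lemma maximal_henkin_set:
  assumes "con T {\<phi>}"
  obtains H where "\<phi> \<in> H" "\<not> loc T H Bot" "\<And>\<psi>. \<psi> \<in> H \<or> Neg \<psi> \<in> H" "\<And>\<psi>. loc T H \<psi> \<Longrightarrow> \<psi> \<in> H"
    "\<And>x \<psi>. \<exists>z. Imp (ssubst (Var(x := Var z)) \<psi>) (All x \<psi>) \<in> H"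
proof -
  let ?H = "\<Union>n. chain T \<phi> n"
  have con: "\<not> loc T ?H Bot"
    using loc_Union_chain con_chain[OF assms] unfolding con_def by blast
  have max: "loc T (insert \<psi> ?H) Bot" if "\<psi> \<notin> ?H" for \<psi>
  proof -
    have "\<psi> \<notin> chain T \<phi> (Suc (to_nat \<psi>))" using that by blast
    then have "loc T (insert \<psi> (insert (henkin (chain T \<phi> (to_nat \<psi>)) \<psi>) (chain T \<phi> (to_nat \<psi>)))) Bot"
      by (auto simp: Let_def con_def split: if_splits)
    moreover have "henkin (chain T \<phi> (to_nat \<psi>)) \<psi> \<in> chain T \<phi> (Suc (to_nat \<psi>))"
      by (simp add: Let_def)
    ultimately show ?thesis by (elim loc_mono) blast
  qed
  have closed: "\<psi> \<in> ?H" if "loc T ?H \<psi>" for \<psi>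
    using max[of \<psi>] that con by (meson loc_MP loc_ded)
  have "\<psi> \<in> ?H \<or> Neg \<psi> \<in> ?H" for \<psi>
    using max[of \<psi>] closed[of "Neg \<psi>"] unfolding Neg_def by (meson loc_ded)
  moreover have "\<exists>z. Imp (ssubst (Var(x := Var z)) \<psi>) (All x \<psi>) \<in> ?H" for x \<psi>
  proof -
    have "henkin (chain T \<phi> (to_nat (All x \<psi>))) (All x \<psi>) \<in> chain T \<phi> (Suc (to_nat (All x \<psi>)))"
      by (simp add: Let_def)
    then show ?thesis by (auto simp del: chain.simps)
  qed
  moreover have "\<phi> \<in> ?H" by (rule UN_I[of 0]) auto
  ultimately show thesis by (intro that[OF _ con _ closed])
qed

lemma tsubst_upd_notin: "x \<notin> tvars u \<Longrightarrow> tsubst (Var(x := s)) u = u"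
  using tsubst_eq_iff[of "Var(x := s)" u Var] by auto

lemma map_tsubst_upd_notin: "x \<notin> (\<Union>u\<in>set us. tvars u) \<Longrightarrow> map (tsubst (Var(x := s))) us = us"
  by (auto intro!: map_idI tsubst_upd_notin)

text \<open>The countermodel consists of terms, so validity over the single type \<open>trm\<close>
  suffices; later claims of provability are all checked on such models.\<close>

theorem completeness:
  fixes T :: "fm set"
  assumes closed: "\<And>\<tau>. \<tau> \<in> T \<Longrightarrow> fv \<tau> = {}"
    and valid: "\<And>(D :: trm set) F R e. model D F R T \<Longrightarrow> range e \<subseteq> D \<Longrightarrow> sat D F R e \<phi>"
  shows "prv T \<phi>"
proof (rule ccontr)
  assume "\<not> prv T \<phi>"
  then have "con T {Neg \<phi>}" unfolding con_def using loc_contr loc_empty by blast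
  then obtain H where H: "Neg \<phi> \<in> H" "\<not> loc T H Bot" "\<And>\<psi>. \<psi> \<in> H \<or> Neg \<psi> \<in> H"
      "\<And>\<psi>. loc T H \<psi> \<Longrightarrow> \<psi> \<in> H"
      "\<And>x \<psi>. \<exists>z. Imp (ssubst (Var(x := Var z)) \<psi>) (All x \<psi>) \<in> H"
    by (rule maximal_henkin_set[OF _ that])
  have of_prv: "\<psi> \<in> H" if "prv T \<psi>" for \<psi> using that H(4) loc_thm by blast
  have mp: "\<chi> \<in> H" if "Imp \<psi> \<chi> \<in> H" "\<psi> \<in> H" for \<psi> \<chi>
    using that H(4) by (meson loc_hyp loc_MP)
  have imp: "Imp \<psi> \<chi> \<in> H \<longleftrightarrow> (\<psi> \<in> H \<longrightarrow> \<chi> \<in> H)" for \<psi> \<chi>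
  proof
    assume *: "\<psi> \<in> H \<longrightarrow> \<chi> \<in> H"
    show "Imp \<psi> \<chi> \<in> H"
    proof (cases "\<psi> \<in> H")
      case True
      with * show ?thesis using mp of_prv prv_K by blast
    next
      case False
      then have "Imp \<psi> Bot \<in> H" using H(3) Neg_def by metis
      then have "loc T (insert \<psi> H) \<chi>" by (rule loc_exfalso[OF loc_undischarge[OF loc_hyp]])
      then show ?thesis using loc_ded H(4) by blast
    qed
  qed (use mp in blast)
  have bot: "Bot \<notin> H" using H(2) loc_hyp by blast
  have leib: "ssubst (Var(x := t)) \<psi> \<in> H" if "Eq s t \<in> H" "ssubst (Var(x := s)) \<psi> \<in> H" for s t x \<psi>
    using mp[OF mp[OF of_prv[OF prv_leib] that(1)] that(2)] .
  have refl: "Eq t t \<in> H" for t using of_prv prv_refl by blast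
  have sym: "Eq t s \<in> H" if "Eq s t \<in> H" for s t
  proof -
    define x where "x = fresh (tvars s)"
    have "x \<notin> tvars s" unfolding x_def by (rule fresh_notin) simp
    with leib[OF that, of x "Eq (Var x) s"] refl show ?thesis by (simp add: tsubst_upd_notin)
  qed
  have trans: "Eq s u \<in> H" if "Eq s t \<in> H" "Eq t u \<in> H" for s t u
  proof -
    define x where "x = fresh (tvars s)"
    have "x \<notin> tvars s" unfolding x_def by (rule fresh_notin) simp
    with leib[OF that(2), of x "Eq s (Var x)"] that(1) show ?thesis by (simp add: tsubst_upd_notin)
  qed
  \<comment> \<open>One argument is exchanged at a time by Leibniz's law; the prefix
    \<open>us\<close> collects those already exchanged.\<close>
  have fncong: "list_all2 (\<lambda>s t. Eq s t \<in> H) ss ts \<Longrightarrow> Eq (Fn f (us @ ss)) (Fn f (us @ ts)) \<in> H" for f us ss ts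
  proof (induction ss ts arbitrary: us rule: list_all2_induct)
    case Nil
    show ?case by (simp add: refl)
  next
    case (Cons s ss t ts)
    define x where "x = fresh (\<Union>u\<in>set (us @ s # ss). tvars u)"
    have "x \<notin> (\<Union>u\<in>set (us @ s # ss). tvars u)" unfolding x_def by (rule fresh_notin) simp
    then have "Eq (Fn f (us @ s # ss)) (Fn f (us @ t # ss)) \<in> H"
      using leib[OF Cons.hyps(1), of x "Eq (Fn f (us @ s # ss)) (Fn f (us @ Var x # ss))"] refl
      by (simp add: tsubst_upd_notin map_tsubst_upd_notin)
    moreover have "Eq (Fn f (us @ t # ss)) (Fn f (us @ t # ts)) \<in> H"
      using Cons.IH[of "us @ [t]"] by simp
    ultimately show ?case by (rule trans)
  qed
  have relcong: "list_all2 (\<lambda>s t. Eq s t \<in> H) ss ts \<Longrightarrow> Rel r (us @ ss) \<in> H \<Longrightarrow> Rel r (us @ ts) \<in> H" for r us ss ts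
  proof (induction ss ts arbitrary: us rule: list_all2_induct)
    case (Cons s ss t ts)
    define x where "x = fresh (\<Union>u\<in>set (us @ s # ss). tvars u)"
    have "x \<notin> (\<Union>u\<in>set (us @ s # ss). tvars u)" unfolding x_def by (rule fresh_notin) simp
    then have "Rel r (us @ t # ss) \<in> H"
      using leib[OF Cons.hyps(1), of x "Rel r (us @ Var x # ss)"] Cons.prems
      by (simp add: tsubst_upd_notin map_tsubst_upd_notin)
    then show ?case using Cons.IH[of "us @ [t]"] by simp
  qed simp
  \<comment> \<open>Chosen representatives replace a quotient, so that the domain remains a set of
    terms.\<close>
  define rep where "rep t = (SOME s. Eq t s \<in> H)" for t
  have rep: "Eq t (rep t) \<in> H" for t unfolding rep_def using refl by (rule someI)
  have rep_eq: "rep s = rep t \<longleftrightarrow> Eq s t \<in> H" for s t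
  proof
    assume "rep s = rep t"
    then show "Eq s t \<in> H" using rep sym trans by metis
  next
    assume "Eq s t \<in> H"
    then have "(\<lambda>u. Eq s u \<in> H) = (\<lambda>u. Eq t u \<in> H)" using sym trans by blast
    then show "rep s = rep t" unfolding rep_def by simp
  qed
  have reps: "list_all2 (\<lambda>s t. Eq s t \<in> H) ts (map rep ts)" for ts
    by (simp add: list_all2_conv_all_nth rep)
  have reps': "list_all2 (\<lambda>s t. Eq s t \<in> H) (map rep ts) ts" for ts
    by (simp add: list_all2_conv_all_nth rep sym)
  define D where "D = range rep"
  define F where "F f xs = rep (Fn f xs)" for f xs
  define R where "R r xs \<longleftrightarrow> Rel r xs \<in> H" for r xs
  define e where "e x = rep (Var x)" for x
  have e: "range e \<subseteq> D" by (auto simp: e_def D_def)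
  have val: "val F e t = rep t" for t
  proof (induction t)
    case (Fn f ts)
    have "rep (Fn f (map rep ts)) = rep (Fn f ts)"
      unfolding rep_eq using fncong[OF reps', of f "[]"] by simp
    moreover have "map (val F e) ts = map rep ts" using Fn by simp
    ultimately show ?case using F_def[of f "map rep ts"] by (simp only: val.simps)
  qed (simp add: e_def)
  have truth: "sat D F R e \<psi> \<longleftrightarrow> \<psi> \<in> H" for \<psi>
  proof (induction "size \<psi>" arbitrary: \<psi> rule: less_induct)
    case less
    show ?case
    proof (cases \<psi>)
      case Bot
      then show ?thesis using bot by simp
    next
      case (Eq s t)
      then show ?thesis by (simp add: val rep_eq)
    next
      case (Rel r ts)
      have "map (val F e) ts = map rep ts" by (simp add: val)
      then have "sat D F R e \<psi> \<longleftrightarrow> Rel r (map rep ts) \<in> H" unfolding Rel sat.simps R_def by (simp only:)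
      then show ?thesis using Rel relcong[OF reps, of r "[]"] relcong[OF reps', of r "[]"] by auto
    next
      case (Imp \<psi>1 \<psi>2)
      then show ?thesis using less.hyps imp by simp
    next
      case (All x \<chi>)
      \<comment> \<open>Every element of \<open>D\<close> is the value of a term, so quantification
        over \<open>D\<close> becomes quantification over substitution instances.\<close>
      have "sat D F R e \<psi> \<longleftrightarrow> (\<forall>t. sat D F R (e(x := val F e t)) \<chi>)"
        by (simp add: All D_def val)
      also have "\<dots> \<longleftrightarrow> (\<forall>t. ssubst (Var(x := t)) \<chi> \<in> H)"
        using less.hyps All by (simp add: sat_subst1[symmetric])
      also have "\<dots> \<longleftrightarrow> \<psi> \<in> H"
        unfolding All using H(5)[of x \<chi>] mp of_prv[OF prv_inst] by metis
      finally show ?thesis .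
    qed
  qed
  have "model D F R T" unfolding model_def
  proof (intro conjI allI ballI impI)
    show "D \<noteq> {}" by (simp add: D_def)
    show "F f xs \<in> D" for f xs by (simp add: F_def D_def)
    fix \<tau> e' assume \<tau>: "\<tau> \<in> T"
    then have "sat D F R e \<tau>" using truth of_prv prv_ax by blast
    then show "sat D F R e' \<tau>" using sat_cong[of \<tau> e e'] closed[OF \<tau>] by auto
  qed
  then have "sat D F R e \<phi>" using valid e by blast
  then have "\<phi> \<in> H" by (simp add: truth)
  then have "loc T H Bot" using H(1) unfolding Neg_def by (meson loc_hyp loc_MP)
  with H(2) show False ..
qed

section \<open>Interpretations\<close>

definition asg :: "'a list \<Rightarrow> nat \<Rightarrow> 'a" where
  "asg xs i = (if i < length xs then xs ! i else undefined)"

definition upds :: "(nat \<Rightarrow> 'a) \<Rightarrow> nat \<Rightarrow> 'a list \<Rightarrow> nat \<Rightarrow> 'a" where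
  "upds e b ds i = (if b \<le> i \<and> i < b + length ds then ds ! (i - b) else e i)"

lemma upds_Cons: "upds e b (d # ds) = upds (e(b := d)) (Suc b) ds"
  by (auto simp: upds_def fun_eq_iff nth_Cons split: nat.splits)
    (metis Suc_diff_Suc Suc_le_eq le_antisym not_less_eq_eq old.nat.inject)+

lemma upds_Nil [simp]: "upds e b [] = e"
  by (auto simp: upds_def fun_eq_iff)

lemma upds_block: "i < length ds \<Longrightarrow> upds e b ds (b + i) = ds ! i"
  by (simp add: upds_def)

lemma upds_below: "x < b \<Longrightarrow> upds e b ds x = e x"
  by (simp add: upds_def)

lemma map_upds_block: "map (upds e b ds) [b..<b + length ds] = ds"
  by (rule nth_equalityI) (auto simp: upds_def)

lemma range_upds: "range e \<subseteq> D \<Longrightarrow> set ds \<subseteq> D \<Longrightarrow> range (upds e b ds) \<subseteq> D"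
  by (auto simp: upds_def)

lemma sat_exs_block:
  "sat D F R e (exs [b..<b + n] \<phi>) \<longleftrightarrow>
    (\<exists>ds. length ds = n \<and> set ds \<subseteq> D \<and> sat D F R (upds e b ds) \<phi>)"
proof (induction n arbitrary: b e)
  case (Suc n)
  have "[b..<b + Suc n] = b # [Suc b..<Suc b + n]" by (simp add: upt_rec)
  then have "sat D F R e (exs [b..<b + Suc n] \<phi>)
      \<longleftrightarrow> (\<exists>d\<in>D. sat D F R (e(b := d)) (exs [Suc b..<Suc b + n] \<phi>))"
    by (simp add: exs_def)
  also have "\<dots> \<longleftrightarrow> (\<exists>d\<in>D. \<exists>ds. length ds = n \<and> set ds \<subseteq> D \<and> sat D F R (upds e b (d # ds)) \<phi>)"
    by (simp only: Suc.IH upds_Cons)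
  also have "\<dots> \<longleftrightarrow> (\<exists>ds. length ds = Suc n \<and> set ds \<subseteq> D \<and> sat D F R (upds e b ds) \<phi>)"
    unfolding length_Suc_conv by (auto; metis insert_subset list.simps(15))
  finally show ?case .
qed (simp add: exs_def)

lemma sat_alls_block:
  "sat D F R e (alls [b..<b + n] \<phi>) \<longleftrightarrow>
    (\<forall>ds. length ds = n \<longrightarrow> set ds \<subseteq> D \<longrightarrow> sat D F R (upds e b ds) \<phi>)"
proof (induction n arbitrary: b e)
  case (Suc n)
  have "[b..<b + Suc n] = b # [Suc b..<Suc b + n]" by (simp add: upt_rec)
  then have "sat D F R e (alls [b..<b + Suc n] \<phi>)
      \<longleftrightarrow> (\<forall>d\<in>D. sat D F R (e(b := d)) (alls [Suc b..<Suc b + n] \<phi>))"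
    by (simp add: alls_def)
  also have "\<dots> \<longleftrightarrow> (\<forall>d\<in>D. \<forall>ds. length ds = n \<longrightarrow> set ds \<subseteq> D \<longrightarrow> sat D F R (upds e b (d # ds)) \<phi>)"
    by (simp only: Suc.IH upds_Cons)
  also have "\<dots> \<longleftrightarrow> (\<forall>ds. length ds = Suc n \<longrightarrow> set ds \<subseteq> D \<longrightarrow> sat D F R (upds e b ds) \<phi>)"
    unfolding length_Suc_conv by (auto; metis insert_subset list.simps(15))
  finally show ?case .
qed (simp add: alls_def)

lemma sat_conjs: "sat D F R e (conjs \<phi>s) \<longleftrightarrow> (\<forall>\<phi>\<in>set \<phi>s. sat D F R e \<phi>)"
  by (induction \<phi>s) (auto simp: conjs_def)

lemma sat_disjs: "sat D F R e (disjs \<phi>s) \<longleftrightarrow> (\<exists>\<phi>\<in>set \<phi>s. sat D F R e \<phi>)"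
  by (induction \<phi>s) (auto simp: disjs_def)

lemma sat_inst:
  "fv \<phi> \<subseteq> {..<length vs} \<Longrightarrow> sat D F R e (inst \<phi> vs) = sat D F R (asg (map e vs)) \<phi>"
  unfolding inst_def sat_ssubst by (rule sat_cong) (auto simp: asg_def)

definition int_dom where
  "int_dom D F R I = {d \<in> D. sat D F R (asg [d]) (idom I)}"
definition int_fun where
  "int_fun D F R I f xs = (THE y. y \<in> int_dom D F R I \<and> sat D F R (asg (xs @ [y])) (ifun I (f, length xs)))"
definition int_rel where
  "int_rel D F R I r xs = sat D F R (asg xs) (irel I (r, length xs))"

text \<open>The semantic content of an interpretation, with no theory mentioned. It holds in the
  models of an interpreting theory, and it is verified directly for the interpretation of
  \<open>U\<close> in \<open>R\<close> before the translated axioms are known to be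
  provable.\<close>

locale interpretation_in =
  fixes D :: "'a set" and F R and I :: interp and L :: lang
  assumes dom_fv: "fv (idom I) \<subseteq> {0}"
    and dom_nonempty: "int_dom D F R I \<noteq> {}"
    and rel_fv: "(r, n) \<in> rsyms L \<Longrightarrow> fv (irel I (r, n)) \<subseteq> {..<n}"
    and fun_fv: "(f, n) \<in> fsyms L \<Longrightarrow> fv (ifun I (f, n)) \<subseteq> {..n}"
    and fun_total: "\<lbrakk>(f, length xs) \<in> fsyms L; set xs \<subseteq> int_dom D F R I\<rbrakk> \<Longrightarrow>
      \<exists>!y. y \<in> int_dom D F R I \<and> sat D F R (asg (xs @ [y])) (ifun I (f, length xs))"
begin

abbreviation iD where "iD \<equiv> int_dom D F R I"
abbreviation iF where "iF \<equiv> int_fun D F R I"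
abbreviation iR where "iR \<equiv> int_rel D F R I"

lemma int_fun_spec:
  assumes "(f, length xs) \<in> fsyms L" "set xs \<subseteq> iD"
  shows "iF f xs \<in> iD" and "y \<in> iD \<Longrightarrow> sat D F R (asg (xs @ [y])) (ifun I (f, length xs)) \<longleftrightarrow> y = iF f xs"
proof -
  note * = theI'[OF fun_total[OF assms], folded int_fun_def]
  then show "iF f xs \<in> iD" by blast
  show "sat D F R (asg (xs @ [y])) (ifun I (f, length xs)) \<longleftrightarrow> y = iF f xs" if "y \<in> iD"
    using that * fun_total[OF assms] by blast
qed

lemma int_val_in_dom: "trm_in L t \<Longrightarrow> e ` tvars t \<subseteq> iD \<Longrightarrow> val iF e t \<in> iD"
proof (induction t)
  case (Fn f ts)
  then have "set (map (val iF e) ts) \<subseteq> iD" by fastforce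
  then show ?case using int_fun_spec(1)[of f "map (val iF e) ts"] Fn.prems by simp
qed auto

lemma sat_inst_dom: "e b \<in> D \<Longrightarrow> sat D F R e (inst (idom I) [b]) \<longleftrightarrow> e b \<in> iD"
  using dom_fv by (subst sat_inst) (auto simp: int_dom_def)

text \<open>The first assumption stands for the induction hypothesis of the later induction on
  terms, because \<open>tr_trm\<close> and \<open>tr_args\<close> are mutually recursive.\<close>

lemma sat_tr_args_aux:
  assumes "\<And>t y e. \<lbrakk>t \<in> set ts; range e \<subseteq> D; e ` tvars t \<subseteq> iD; e y \<in> iD\<rbrakk> \<Longrightarrow>
      sat D F R e (tr_trm I t y) \<longleftrightarrow> e y = val iF e t"
    and "range e \<subseteq> D" "\<And>t. t \<in> set ts \<Longrightarrow> e ` tvars t \<subseteq> iD"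
  shows "sat D F R e (tr_args I ts b) \<longleftrightarrow> (\<forall>i<length ts. e (b + i) \<in> iD \<and> e (b + i) = val iF e (ts ! i))"
  using assms
proof (induction ts arbitrary: b)
  case (Cons t ts)
  have IH: "sat D F R e (tr_args I ts (Suc b)) \<longleftrightarrow>
      (\<forall>i<length ts. e (b + Suc i) \<in> iD \<and> e (b + Suc i) = val iF e (ts ! i))"
    using Cons.IH[of "Suc b"] Cons.prems by simp
  have "sat D F R e (inst (idom I) [b]) \<longleftrightarrow> e b \<in> iD"
    by (rule sat_inst_dom) (use Cons.prems(2) in auto)
  moreover have "e b \<in> iD \<Longrightarrow> sat D F R e (tr_trm I t b) \<longleftrightarrow> e b = val iF e t"
    using Cons.prems by simp
  ultimately have "sat D F R e (tr_args I (t # ts) b) \<longleftrightarrow>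
      (e b \<in> iD \<and> e b = val iF e t) \<and> (\<forall>i<length ts. e (b + Suc i) \<in> iD \<and> e (b + Suc i) = val iF e (ts ! i))"
    using IH by auto
  also have "\<dots> \<longleftrightarrow> (\<forall>i<length (t # ts). e (b + i) \<in> iD \<and> e (b + i) = val iF e ((t # ts) ! i))"
    by (simp add: All_less_Suc2)
  finally show ?case .
qed simp

lemma sat_tr_args_block:
  assumes "\<And>t y e. \<lbrakk>t \<in> set ts; range e \<subseteq> D; e ` tvars t \<subseteq> iD; e y \<in> iD\<rbrakk> \<Longrightarrow>
      sat D F R e (tr_trm I t y) \<longleftrightarrow> e y = val iF e t"
    and e: "range e \<subseteq> D" "\<And>t. t \<in> set ts \<Longrightarrow> e ` tvars t \<subseteq> iD"
    and b: "\<And>t x. t \<in> set ts \<Longrightarrow> x \<in> tvars t \<Longrightarrow> x < b"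
    and ts: "\<And>t. t \<in> set ts \<Longrightarrow> trm_in L t"
  shows "sat D F R e (exs [b..<b + length ts] (And (tr_args I ts b) \<phi>))
    \<longleftrightarrow> sat D F R (upds e b (map (val iF e) ts)) \<phi>"
proof -
  let ?vs = "map (val iF e) ts"
  have vs: "set ?vs \<subseteq> iD" using int_val_in_dom ts e(2) by auto
  \<comment> \<open>The translated argument list determines its block of variables uniquely, so the
    existential block may be evaluated at the list of values.\<close>
  have args: "sat D F R (upds e b ds) (tr_args I ts b) \<longleftrightarrow> ds = ?vs"
    if "length ds = length ts" "set ds \<subseteq> D" for ds
  proof -
    have eq: "val iF (upds e b ds) t = val iF e t" if "t \<in> set ts" for t
      using b[OF that] by (intro val_cong) (simp add: upds_below)
    have im: "upds e b ds ` tvars t \<subseteq> iD" if "t \<in> set ts" for t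
      using e(2)[OF that] b[OF that] by (auto simp: upds_below)
    have "sat D F R (upds e b ds) (tr_args I ts b) \<longleftrightarrow>
        (\<forall>i<length ts. ds ! i \<in> iD \<and> ds ! i = val iF e (ts ! i))"
      using assms(1) range_upds[OF e(1) that(2)] im
      by (subst sat_tr_args_aux) (auto simp: upds_block that eq)
    also have "\<dots> \<longleftrightarrow> ds = ?vs"
      using that vs by (auto simp: list_eq_iff_nth_eq)
    finally show ?thesis .
  qed
  have "set ?vs \<subseteq> D" using vs by (auto simp: int_dom_def)
  then have "(\<exists>ds. length ds = length ts \<and> set ds \<subseteq> D \<and> sat D F R (upds e b ds) (And (tr_args I ts b) \<phi>))
      \<longleftrightarrow> sat D F R (upds e b ?vs) \<phi>"
    using args by (metis length_map sat_connectives(3))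
  then show ?thesis unfolding sat_exs_block .
qed

lemma sat_tr_trm:
  "\<lbrakk>trm_in L t; range e \<subseteq> D; e ` tvars t \<subseteq> iD; e y \<in> iD\<rbrakk> \<Longrightarrow>
     sat D F R e (tr_trm I t y) \<longleftrightarrow> e y = val iF e t"
proof (induction t arbitrary: e y)
  case (Fn f ts)
  define b where "b = fresh (insert y (\<Union>t\<in>set ts. tvars t))"
  have b: "x < b" if "x \<in> insert y (\<Union>t\<in>set ts. tvars t)" for x
    unfolding b_def by (rule fresh_gt) (use that in auto)
  then have b': "x < b" if "t \<in> set ts" "x \<in> tvars t" for t x using that by blast
  let ?vs = "map (val iF e) ts"
  have ts: "trm_in L t" "e ` tvars t \<subseteq> iD" if "t \<in> set ts" for t
    using Fn.prems that by auto
  have vs: "set ?vs \<subseteq> iD" using int_val_in_dom ts by auto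
  have "sat D F R e (tr_trm I (Fn f ts) y) \<longleftrightarrow>
      sat D F R (upds e b ?vs) (inst (ifun I (f, length ts)) ([b..<b + length ts] @ [y]))"
    unfolding tr_trm.simps Let_def b_def[symmetric]
    using Fn.IH Fn.prems(2) ts b' by (intro sat_tr_args_block) auto
  also have "\<dots> \<longleftrightarrow> sat D F R (asg (?vs @ [e y])) (ifun I (f, length ?vs))"
    using fun_fv[of f "length ts"] Fn.prems(1) map_upds_block[of e b ?vs] upds_below[of y b e ?vs] b
    by (subst sat_inst) (auto simp: subset_iff)
  also have "\<dots> \<longleftrightarrow> e y = iF f ?vs"
    using int_fun_spec(2)[OF _ vs] Fn.prems by simp
  finally show ?case by simp
qed auto

lemma sat_tr:
  "\<lbrakk>fm_in L \<phi>; range e \<subseteq> D; e ` fv \<phi> \<subseteq> iD\<rbrakk> \<Longrightarrow> sat D F R e (tr I \<phi>) \<longleftrightarrow> sat iD iF iR e \<phi>"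
proof (induction \<phi> arbitrary: e)
  case (Eq s t)
  define b where "b = fresh (tvars s \<union> tvars t)"
  have b: "x < b" if "x \<in> tvars s \<union> tvars t" for x
    unfolding b_def by (rule fresh_gt) (use that in auto)
  have two: "[b, Suc b] = [b..<b + length [s, t]]" by (simp add: upt_rec)
  have "sat D F R e (tr I (Eq s t)) \<longleftrightarrow>
      sat D F R (upds e b (map (val iF e) [s, t])) (Eq (Var b) (Var (Suc b)))"
    unfolding tr.simps Let_def b_def[symmetric] two
    by (rule sat_tr_args_block) (use Eq b sat_tr_trm in \<open>auto simp: image_Un\<close>)
  then show ?case by (simp add: upds_def)
next
  case (Rel r ts)
  define b where "b = fresh (\<Union>t\<in>set ts. tvars t)"
  have b: "x < b" if "x \<in> (\<Union>t\<in>set ts. tvars t)" for x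
    unfolding b_def by (rule fresh_gt) (use that in auto)
  let ?vs = "map (val iF e) ts"
  have "sat D F R e (tr I (Rel r ts)) \<longleftrightarrow>
      sat D F R (upds e b ?vs) (inst (irel I (r, length ts)) [b..<b + length ts])"
    unfolding tr.simps Let_def b_def[symmetric]
    by (rule sat_tr_args_block) (use Rel b sat_tr_trm in \<open>auto simp: image_UN\<close>)
  also have "\<dots> \<longleftrightarrow> sat D F R (asg ?vs) (irel I (r, length ?vs))"
    using rel_fv[of r "length ts"] Rel.prems(1) map_upds_block[of e b ?vs]
    by (subst sat_inst) auto
  finally show ?case by (simp add: int_rel_def)
next
  case (All x \<phi>)
  have "sat D F R (e(x := d)) (Imp (inst (idom I) [x]) (tr I \<phi>)) \<longleftrightarrow> (d \<in> iD \<longrightarrow> sat iD iF iR (e(x := d)) \<phi>)"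
    if "d \<in> D" for d
  proof -
    have "sat D F R (e(x := d)) (inst (idom I) [x]) \<longleftrightarrow> d \<in> iD"
      using sat_inst_dom[of "e(x := d)" x] that by simp
    moreover have "sat D F R (e(x := d)) (tr I \<phi>) \<longleftrightarrow> sat iD iF iR (e(x := d)) \<phi>" if "d \<in> iD"
      using All.prems that \<open>d \<in> D\<close> by (intro All.IH) auto
    ultimately show ?thesis by auto
  qed
  then show ?case by (auto simp: int_dom_def)
qed (auto simp: image_Un)

end

lemma sat_fun_ok:
  assumes ok: "sat D F R e (fun_ok I (f, n))" and e: "range e \<subseteq> D"
    and fv: "fv (idom I) \<subseteq> {0}" "fv (ifun I (f, n)) \<subseteq> {..n}"
    and xs: "length xs = n" "set xs \<subseteq> int_dom D F R I"
  shows "\<exists>!y. y \<in> int_dom D F R I \<and> sat D F R (asg (xs @ [y])) (ifun I (f, n))"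
proof -
  let ?e = "upds e 0 xs"
  have xsD: "set xs \<subseteq> D" using xs(2) by (auto simp: int_dom_def)
  have dom: "sat D F R e' (inst (idom I) [i]) \<longleftrightarrow> e' i \<in> int_dom D F R I" if "e' i \<in> D" for e' i
    using fv(1) that by (subst sat_inst) (auto simp: int_dom_def)
  have m: "map ?e [0..<n] = xs"
    using map_upds_block[of e 0 xs] xs(1) by simp
  have fvl: "fv (ifun I (f, n)) \<subseteq> {..<length (vs @ [v])}" if "length vs = n" for vs v
    using fv(2) that by auto
  have hyp: "sat D F R ?e (conjs (map (\<lambda>i. inst (idom I) [i]) [0..<n]))"
    unfolding sat_conjs using xs dom range_upds[OF e xsD, of 0]
    by (auto simp: upds_def image_subset_iff dest: nth_mem)
  have "\<exists>y\<in>D. y \<in> int_dom D F R I \<and> sat D F R (asg (xs @ [y])) (ifun I (f, n)) \<and>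
     (\<forall>z\<in>D. z \<in> int_dom D F R I \<and> sat D F R (asg (xs @ [z])) (ifun I (f, n)) \<longrightarrow> z = y)"
    using hyp ok[unfolded fun_ok_def Let_def snd_conv sat_alls_block[of D F R e 0 n, unfolded add_0],
      rule_format, OF xs(1) xsD]
    by (simp add: dom sat_inst[OF fvl] m)
  then show ?thesis by (auto simp: int_dom_def)
qed

lemma is_interpretation_in:
  assumes I: "is_interpretation I T S" and M: "model D F R (snd S)"
  shows "interpretation_in D F R I (fst T)"
proof -
  obtain d where d: "d \<in> D" using M by (auto simp: model_def)
  define e :: "nat \<Rightarrow> 'a" where "e = (\<lambda>_. d)"
  have e: "range e \<subseteq> D" using d by (auto simp: e_def)
  note I = I[unfolded is_interpretation_def]
  have fvd: "fv (idom I) \<subseteq> {0}" using I by blast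
  have "sat D F R e (Ex 0 (idom I))" using soundness[OF _ M e] I by blast
  then obtain a where a: "a \<in> D" "sat D F R (e(0 := a)) (idom I)" by auto
  have "sat D F R (asg [a]) (idom I)"
    using a(2) by (rule iffD1[OF sat_cong, rotated]) (use fvd in \<open>auto simp: asg_def\<close>)
  then have ne: "int_dom D F R I \<noteq> {}" using a(1) by (auto simp: int_dom_def)
  show ?thesis
  proof
    fix f xs assume "(f, length xs) \<in> fsyms (fst T)" "set xs \<subseteq> int_dom D F R I"
    moreover from this have "prv (snd S) (fun_ok I (f, length xs))" "fv (ifun I (f, length xs)) \<subseteq> {..length xs}"
      using I by auto
    ultimately show "\<exists>!y. y \<in> int_dom D F R I \<and> sat D F R (asg (xs @ [y])) (ifun I (f, length xs))"
      using sat_fun_ok[OF soundness[OF _ M e] e fvd] by blast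
  qed (use I ne in blast)+
qed

lemma interpreted_model:
  assumes I: "is_interpretation I T S" and M: "model D F R (snd S)" and T: "wf_thy T"
    and \<phi>: "\<phi> \<in> snd T"
  shows "sat (int_dom D F R I) (int_fun D F R I) (int_rel D F R I) e \<phi>"
proof -
  interpret interpretation_in D F R I "fst T" by (rule is_interpretation_in[OF I M])
  obtain d where d: "d \<in> D" using M by (auto simp: model_def)
  have \<phi>': "fm_in (fst T) \<phi>" "fv \<phi> = {}" using T \<phi> by (auto simp: wf_thy_def sentences_def)
  have "sat D F R (\<lambda>_. d) (tr I \<phi>)" using I \<phi> d by (intro soundness[OF _ M]) (auto simp: is_interpretation_def)
  then have "sat iD iF iR (\<lambda>_. d) \<phi>" using sat_tr[OF \<phi>'(1), of "\<lambda>_. d"] d \<phi>'(2) by auto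
  then show ?thesis using sat_cong[of \<phi> "\<lambda>_. d" e] \<phi>'(2) by auto
qed

section \<open>\<open>R\<close> is not interpretable in \<open>U\<close>\<close>

datatype point = Point (colouring: "int \<Rightarrow> bool") (copy: nat) (pos: int)

definition shift :: "int \<Rightarrow> point \<Rightarrow> point" where
  "shift d a = Point (colouring a) (copy a) (pos a + d)"
definition marked :: "point \<Rightarrow> bool" where "marked a = colouring a (pos a)"

lemma shift_shift [simp]: "shift d (shift d' a) = shift (d + d') a"
  by (simp add: shift_def)

lemma shift_0 [simp]: "shift 0 a = a"
  by (simp add: shift_def)

lemma shift_eq_shift: "shift d a = shift d' b \<longleftrightarrow> a = shift (d' - d) b"
  by (cases a; cases b; auto simp: shift_def)

text \<open>Disjoint lines of type \<open>int\<close>, one (in infinitely many copies) for each colouring. Every local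
  pattern thus occurs on a line not used so far, so that truth is determined by colours and
  distances up to a bounded radius.\<close>

definition line_fun :: "point \<Rightarrow> nat \<Rightarrow> point list \<Rightarrow> point" where
  "line_fun z f xs = (if xs = [] then z else shift 1 (hd xs))"

lemma line_fun_simps [simp]: "line_fun z f [] = z" "line_fun z f (x # xs) = shift 1 x"
  by (simp_all add: line_fun_def)

definition line_rel :: "nat \<Rightarrow> point list \<Rightarrow> bool" where
  "line_rel r xs = marked (hd xs)"

text \<open>The back-and-forth invariant: related points agree on all distances up to
  \<open>r\<close> and on the colours up to distance \<open>r\<close>. Larger distances are not
  compared.\<close>

definition sim :: "int \<Rightarrow> (point \<times> point) set \<Rightarrow> bool" where
  "sim r Z \<longleftrightarrow> (\<forall>a a' b b' d. (a, a') \<in> Z \<longrightarrow> (b, b') \<in> Z \<longrightarrow> \<bar>d\<bar> \<le> r \<longrightarrow>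
     (a = shift d b \<longleftrightarrow> a' = shift d b') \<and> (marked (shift d a) \<longleftrightarrow> marked (shift d a')))"

lemma sim_converse: "sim r (Z\<inverse>) = sim r Z"
  unfolding sim_def by fast

lemma sim_subset: "sim r Z \<Longrightarrow> Z' \<subseteq> Z \<Longrightarrow> s \<le> r \<Longrightarrow> sim s Z'"
  unfolding sim_def by (blast intro: order_trans)

lemma simD:
  assumes "sim r Z" "(a, a') \<in> Z" "(b, b') \<in> Z" "\<bar>d\<bar> \<le> r"
  shows "a = shift d b \<longleftrightarrow> a' = shift d b'" "marked (shift d a) \<longleftrightarrow> marked (shift d a')"
  using assms unfolding sim_def by blast+

lemma sim_forth:
  assumes Z: "sim (2 * r) Z" "finite Z" and r: "0 \<le> r"
  shows "\<exists>a'. sim r (insert (a, a') Z)"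
proof -
  have flip: "p = shift d q \<longleftrightarrow> q = shift (- d) p" for p q d
    by (cases p; cases q; auto simp: shift_def)
  have "\<exists>a'. (\<forall>(b, b')\<in>Z. \<forall>d. \<bar>d\<bar> \<le> r \<longrightarrow> (a = shift d b \<longleftrightarrow> a' = shift d b')) \<and>
      (\<forall>d. \<bar>d\<bar> \<le> r \<longrightarrow> marked (shift d a) = marked (shift d a'))"
  proof (cases "\<exists>(b, b')\<in>Z. \<exists>d. \<bar>d\<bar> \<le> r \<and> a = shift d b")
    case True
    then obtain c c' d where c: "(c, c') \<in> Z" "\<bar>d\<bar> \<le> r" "a = shift d c" by blast
    \<comment> \<open>\<open>a\<close> lies at offset \<open>d\<close> from \<open>c\<close>, so its
      offset \<open>d'\<close> from \<open>b\<close> amounts to the offset \<open>d' - d\<close> of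
      \<open>c\<close> from \<open>b\<close>, at most \<open>2 * r\<close> in absolute value. Hence
      the doubled radius.\<close>
    have "a = shift d' b \<longleftrightarrow> shift d c' = shift d' b'" if "(b, b') \<in> Z" "\<bar>d'\<bar> \<le> r" for b b' d'
      using simD(1)[OF Z(1) c(1) that(1), of "d' - d"] that(2) c by (simp add: shift_eq_shift)
    moreover have "marked (shift d' a) = marked (shift d' (shift d c'))" if "\<bar>d'\<bar> \<le> r" for d'
      using simD(2)[OF Z(1) c(1) c(1), of "d' + d"] that c by simp
    ultimately show ?thesis by blast
  next
    case False
    \<comment> \<open>Nothing related is near \<open>a\<close>. Its image is the origin of a line
      coloured as seen from \<open>a\<close>, in a copy that contains no point of the range of
      \<open>Z\<close>.\<close>
    define p where "p i = marked (shift i a)" for i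
    have "finite ((\<lambda>(b, b'). copy b') ` Z)" using Z(2) by simp
    then obtain k where k: "k \<notin> (\<lambda>(b, b'). copy b') ` Z"
      using ex_new_if_finite[OF infinite_UNIV_nat] by blast
    have "Point p k 0 \<noteq> shift d b'" if "(b, b') \<in> Z" for b b' d
    proof
      assume "Point p k 0 = shift d b'"
      then have "k = copy b'" by (simp add: shift_def)
      with k that show False by force
    qed
    then show ?thesis using False
      by (intro exI[of _ "Point p k 0"]) (auto simp: p_def marked_def shift_def)
  qed
  then obtain a' where a': "\<And>b b' d. (b, b') \<in> Z \<Longrightarrow> \<bar>d\<bar> \<le> r \<Longrightarrow> a = shift d b \<longleftrightarrow> a' = shift d b'"
    "\<And>d. \<bar>d\<bar> \<le> r \<Longrightarrow> marked (shift d a) = marked (shift d a')" by blast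
  have "b = shift d a \<longleftrightarrow> b' = shift d a'" if "(b, b') \<in> Z" "\<bar>d\<bar> \<le> r" for b b' d
    using a'(1)[of b b' "- d"] that flip by (metis abs_minus_cancel)
  moreover have "a = shift d a \<longleftrightarrow> a' = shift d a'" for d
    by (cases a; cases a'; auto simp: shift_def)
  moreover have "sim r Z" using sim_subset[OF Z(1), of Z r] r by simp
  ultimately have "sim r (insert (a, a') Z)"
    using a' unfolding sim_def by auto
  then show ?thesis ..
qed

lemma line_val:
  "trm_in L_U t \<Longrightarrow> \<exists>k\<ge>0. (\<exists>x\<in>tvars t. \<forall>e. val (line_fun z) e t = shift k (e x)) \<or>
     (\<forall>e. val (line_fun z) e t = shift k z)"
proof (induction t)
  case (Var x)
  show ?case by (rule exI[of _ 0]) simp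
next
  case (Fn f ts)
  show ?case
  proof (cases ts)
    case Nil
    then show ?thesis by (intro exI[of _ 0]) simp
  next
    case (Cons u us)
    with Fn.prems have ts: "ts = [u]" by (auto simp: L_U_def)
    from Fn ts obtain k where k: "k \<ge> 0" "(\<exists>x\<in>tvars u. \<forall>e. val (line_fun z) e u = shift k (e x)) \<or>
     (\<forall>e. val (line_fun z) e u = shift k z)" by auto
    then show ?thesis using ts by (intro exI[of _ "1 + k"]) auto
  qed
qed

abbreviation lsat :: "point \<Rightarrow> (nat \<Rightarrow> point) \<Rightarrow> fm \<Rightarrow> bool" where
  "lsat z \<equiv> sat UNIV (line_fun z) line_rel"

text \<open>The constant is treated like an element that both sides must match, so that distances to
  it are compared as well.\<close>

definition pairs :: "point \<Rightarrow> (nat \<Rightarrow> point) \<Rightarrow> (nat \<Rightarrow> point) \<Rightarrow> nat set \<Rightarrow> (point \<times> point) set" where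
  "pairs z e e' V = insert (z, z) ((\<lambda>x. (e x, e' x)) ` V)"

lemma line_val_pairs:
  assumes "trm_in L_U t"
  obtains k where "0 \<le> k" "\<And>e e' V. tvars t \<subseteq> V \<Longrightarrow> \<exists>(a, a')\<in>pairs z e e' V.
    val (line_fun z) e t = shift k a \<and> val (line_fun z) e' t = shift k a'"
proof -
  obtain k where k: "k \<ge> 0" "(\<exists>x\<in>tvars t. \<forall>e. val (line_fun z) e t = shift k (e x)) \<or>
     (\<forall>e. val (line_fun z) e t = shift k z)" using line_val[OF assms] by blast
  show thesis
  proof (rule that[OF k(1)])
    fix e e' V assume V: "tvars t \<subseteq> V"
    from k(2) show "\<exists>(a, a')\<in>pairs z e e' V. val (line_fun z) e t = shift k a \<and> val (line_fun z) e' t = shift k a'"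
    proof
      assume "\<exists>x\<in>tvars t. \<forall>e. val (line_fun z) e t = shift k (e x)"
      then obtain x where "x \<in> tvars t" "\<And>e. val (line_fun z) e t = shift k (e x)" by blast
      with V show ?thesis by (intro bexI[of _ "(e x, e' x)"]) (auto simp: pairs_def)
    next
      assume "\<forall>e. val (line_fun z) e t = shift k z"
      then show ?thesis by (intro bexI[of _ "(z, z)"]) (auto simp: pairs_def)
    qed
  qed
qed

text \<open>An Ehrenfeucht-Fraisse argument: the radius depends on the formula alone, covers the
  successors occurring in atoms, and is doubled by each quantifier.\<close>

lemma locality:
  "fm_in L_U \<phi> \<Longrightarrow> \<exists>r\<ge>0. \<forall>e e'. sim r (pairs z e e' (fv \<phi>)) \<longrightarrow> lsat z e \<phi> = lsat z e' \<phi>"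
proof (induction \<phi>)
  case Bot
  show ?case by auto
next
  case (Eq s t)
  then have st: "trm_in L_U s" "trm_in L_U t" by auto
  obtain k where k: "0 \<le> k" "\<And>e e' V. tvars s \<subseteq> V \<Longrightarrow> \<exists>(a, a')\<in>pairs z e e' V.
    val (line_fun z) e s = shift k a \<and> val (line_fun z) e' s = shift k a'" by (rule line_val_pairs[OF st(1)]) blast
  obtain l where l: "0 \<le> l" "\<And>e e' V. tvars t \<subseteq> V \<Longrightarrow> \<exists>(a, a')\<in>pairs z e e' V.
    val (line_fun z) e t = shift l a \<and> val (line_fun z) e' t = shift l a'" by (rule line_val_pairs[OF st(2)]) blast
  have "lsat z e (Eq s t) = lsat z e' (Eq s t)" if sim: "sim (k + l) (pairs z e e' (fv (Eq s t)))" for e e'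
  proof -
    obtain a a' where a: "(a, a') \<in> pairs z e e' (fv (Eq s t))"
      "val (line_fun z) e s = shift k a" "val (line_fun z) e' s = shift k a'" using k(2)[of "fv (Eq s t)" e e'] by auto
    obtain b b' where b: "(b, b') \<in> pairs z e e' (fv (Eq s t))"
      "val (line_fun z) e t = shift l b" "val (line_fun z) e' t = shift l b'" using l(2)[of "fv (Eq s t)" e e'] by auto
    show ?thesis using simD(1)[OF sim a(1) b(1), of "l - k"] k(1) l(1) by (simp add: a b shift_eq_shift)
  qed
  then show ?case using k(1) l(1) by (intro exI[of _ "k + l"]) auto
next
  case (Rel r ts)
  then obtain t where t: "ts = [t]" "trm_in L_U t" by (auto simp: L_U_def length_Suc_conv)
  obtain k where k: "0 \<le> k" "\<And>e e' V. tvars t \<subseteq> V \<Longrightarrow> \<exists>(a, a')\<in>pairs z e e' V.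
    val (line_fun z) e t = shift k a \<and> val (line_fun z) e' t = shift k a'" by (rule line_val_pairs[OF t(2)]) blast
  have "lsat z e (Rel r ts) = lsat z e' (Rel r ts)" if sim: "sim k (pairs z e e' (fv (Rel r ts)))" for e e'
  proof -
    obtain a a' where a: "(a, a') \<in> pairs z e e' (fv (Rel r ts))"
      "val (line_fun z) e t = shift k a" "val (line_fun z) e' t = shift k a'" using k(2)[of "fv (Rel r ts)" e e'] t by auto
    show ?thesis using simD(2)[OF sim a(1) a(1), of k] k(1) by (simp add: a t line_rel_def)
  qed
  then show ?case using k(1) by (intro exI[of _ k]) auto
next
  case (Imp \<phi> \<psi>)
  then obtain r s where r: "r \<ge> 0" "\<And>e e'. sim r (pairs z e e' (fv \<phi>)) \<Longrightarrow> lsat z e \<phi> = lsat z e' \<phi>"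
    and s: "s \<ge> 0" "\<And>e e'. sim s (pairs z e e' (fv \<psi>)) \<Longrightarrow> lsat z e \<psi> = lsat z e' \<psi>" by auto
  have "lsat z e (Imp \<phi> \<psi>) = lsat z e' (Imp \<phi> \<psi>)" if "sim (max r s) (pairs z e e' (fv (Imp \<phi> \<psi>)))" for e e'
  proof -
    have "sim r (pairs z e e' (fv \<phi>))" "sim s (pairs z e e' (fv \<psi>))"
      using that by (auto elim!: sim_subset simp: pairs_def)
    then show ?thesis using r(2) s(2) by simp
  qed
  then show ?case using r(1) by (intro exI[of _ "max r s"]) auto
next
  case (All x \<phi>)
  then obtain r where r: "r \<ge> 0" "\<And>e e'. sim r (pairs z e e' (fv \<phi>)) \<Longrightarrow> lsat z e \<phi> = lsat z e' \<phi>" by auto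
  have conv: "(pairs z e e' V)\<inverse> = pairs z e' e V" for e e' V
    by (auto simp: pairs_def)
  \<comment> \<open>For \<open>b\<close> on the side of \<open>e'\<close>, the forth property of the
    converse relation supplies the element at which the assumption is used. Exchanging the
    assignments gives the other direction.\<close>
  have half: "lsat z e' (All x \<phi>)" if sim: "sim (2 * r) (pairs z e e' (fv (All x \<phi>)))" and e: "lsat z e (All x \<phi>)" for e e'
    unfolding sat.simps
  proof
    fix b
    have "sim (2 * r) (pairs z e' e (fv (All x \<phi>)))" using sim sim_converse conv by metis
    moreover have "finite (pairs z e' e (fv (All x \<phi>)))" by (simp add: pairs_def)
    ultimately obtain a where "sim r (insert (b, a) (pairs z e' e (fv (All x \<phi>))))" using sim_forth r(1) by blast
    then have "sim r (pairs z (e'(x := b)) (e(x := a)) (fv \<phi>))"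
      by (rule sim_subset) (auto simp: pairs_def)
    then have "lsat z (e'(x := b)) \<phi> = lsat z (e(x := a)) \<phi>" by (rule r(2))
    then show "lsat z (e'(x := b)) \<phi>" using e by simp
  qed
  have "lsat z e (All x \<phi>) = lsat z e' (All x \<phi>)" if "sim (2 * r) (pairs z e e' (fv (All x \<phi>)))" for e e'
    using half[OF that] half[of e' e] that sim_converse conv by metis
  then show ?case using r(1) by (intro exI[of _ "2 * r"]) auto
qed

text \<open>There are only finitely many colour patterns of radius \<open>r\<close>. Hence two chain
  elements have the same pattern while being far from \<open>z\<close> and from each other; swapping
  them goes unnoticed by \<open>\<psi>\<close>, against antisymmetry.\<close>

lemma no_definable_chain:
  assumes \<psi>: "fm_in L_U \<psi>" "fv \<psi> \<subseteq> {..<2}" and c: "inj (c :: nat \<Rightarrow> point)"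
    and ord: "\<And>m n. lsat z (asg [c m, c n]) \<psi> \<longleftrightarrow> m \<le> n"
  shows False
proof -
  obtain r where r: "r \<ge> 0" "\<And>e e'. sim r (pairs z e e' (fv \<psi>)) \<Longrightarrow> lsat z e \<psi> = lsat z e' \<psi>"
    using locality[OF \<psi>(1)] by blast
  define near where "near a = (\<lambda>d. shift d a) ` {-r..r}" for a
  have fin: "finite {n. c n \<in> near a}" for a
  proof -
    have "finite (near a)" by (simp add: near_def)
    then show ?thesis using finite_vimageI[OF _ c, of "near a"] by (simp add: vimage_def)
  qed
  have nearD: "a \<noteq> shift d b \<and> b \<noteq> shift d a" if "a \<notin> near b" "\<bar>d\<bar> \<le> r" for a b d
  proof -
    have "shift d' b \<in> near b" if "\<bar>d'\<bar> \<le> r" for d' using that by (auto simp: near_def abs_le_iff)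
    moreover have "b = shift d a \<Longrightarrow> a = shift (- d) b" by (simp add: shift_def)
    ultimately show ?thesis using that by (metis abs_minus_cancel)
  qed
  define W where "W = {n. c n \<notin> near z}"
  have "W = UNIV - {n. c n \<in> near z}" by (auto simp: W_def)
  then have "infinite W" using fin by (simp add: Diff_infinite_finite)
  define type where "type n = {d \<in> {-r..r}. marked (shift d (c n))}" for n
  have "finite (type ` W)" by (rule finite_subset[of _ "Pow {-r..r}"]) (auto simp: type_def)
  then obtain m where m: "m \<in> W" "infinite {n \<in> W. type n = type m}"
    using pigeonhole_infinite[OF \<open>infinite W\<close>] by blast
  then have "infinite ({n \<in> W. type n = type m} - {n. c n \<in> near (c m)})"
    using fin by (simp add: Diff_infinite_finite)
  then have "{n \<in> W. type n = type m} - {n. c n \<in> near (c m)} \<noteq> {}"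
    using finite.emptyI by metis
  then obtain n where n: "n \<in> W" "type n = type m" "c n \<notin> near (c m)" by blast
  have mk: "marked (shift d (c m)) = marked (shift d (c n))" if "\<bar>d\<bar> \<le> r" for d
  proof -
    have "d \<in> type m \<longleftrightarrow> d \<in> type n" using n(2) by simp
    then show ?thesis using that by (auto simp: type_def abs_le_iff)
  qed
  have self: "a = shift d a \<longleftrightarrow> d = 0" for a d by (cases a; auto simp: shift_def)
  \<comment> \<open>\<open>z\<close> stays fixed and the two elements change places. The three
    points are pairwise far apart, so only colours and distances of a point to itself remain to be
    compared.\<close>
  have "sim r {(z, z), (c m, c n), (c n, c m)}"
    unfolding sim_def using mk nearD[OF n(3)] nearD[of "c m" z] nearD[of "c n" z] m(1) n(1)
    by (auto simp: W_def self)
  then have "sim r (pairs z (asg [c m, c n]) (asg [c n, c m]) (fv \<psi>))"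
    by (rule sim_subset) (use \<psi>(2) in \<open>auto simp: pairs_def asg_def nth_Cons split: nat.splits\<close>)
  then have "m \<le> n \<longleftrightarrow> n \<le> m" using r(2) ord by blast
  then have "m = n" by auto
  then show False using n(3) r(1) by (auto simp: near_def intro!: image_eqI[of _ _ 0])
qed

section \<open>Numerals in structures satisfying the axioms of \<open>R\<close>\<close>

lemma wf_R: "wf_thy R_thy"
proof -
  have n: "tvars (num n) = {}" "trm_in L_R (num n)" for n
    by (induction n) (auto simp: L_R_def)
  have d: "fm_in L_R (disjs \<phi>s) \<longleftrightarrow> (\<forall>\<phi>\<in>set \<phi>s. fm_in L_R \<phi>)" "fv (disjs \<phi>s) = (\<Union>\<phi>\<in>set \<phi>s. fv \<phi>)" for \<phi>s
    by (induction \<phi>s) (auto simp: disjs_def)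
  show ?thesis
    by (auto simp: wf_thy_def R_thy_def sentences_def plus_def times_def leq_def n d simp del: upt_Suc)
      (auto simp: L_R_def)
qed

lemma sat_disjs_num:
  "sat D F R e (disjs (map (\<lambda>i. Eq (Var 0) (num i)) [0..<Suc n])) \<longleftrightarrow> (\<exists>i\<le>n. e 0 = val F e (num i))"
  unfolding sat_disjs by (auto simp del: upt_Suc simp: less_Suc_eq_le)

lemma tvars_num [simp]: "tvars (num n) = {}"
  by (induction n) auto

text \<open>Weaker than \<open>model\<close>, since an interpreted structure need not be closed
  under function names outside the language.\<close>

locale R_structure =
  fixes D :: "'a set" and F R and c :: "nat \<Rightarrow> 'a"
  assumes axioms: "\<phi> \<in> snd R_thy \<Longrightarrow> sat D F R e \<phi>"
    and num: "val F e (num n) = c n"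
    and num_dom: "c n \<in> D"
begin

lemma inj_num: "inj c"
proof (rule injI, rule ccontr)
  fix m n assume "c m = c n" "m \<noteq> n"
  moreover have "sat D F R e (Neg (Eq (num m) (num n)))" if "m \<noteq> n" for e
    using that by (intro axioms) (auto simp: R_thy_def)
  ultimately show False by (simp add: num)
qed

lemma le_numD: "\<exists>i\<le>n. d = c i" if "R 1 [d, c n]" "d \<in> D"
proof -
  have "sat D F R e (All 0 (Imp (leq (Var 0) (num n)) (disjs (map (\<lambda>i. Eq (Var 0) (num i)) [0..<Suc n]))))" for e
    by (intro axioms) (auto simp: R_thy_def)
  then have "sat D F R (e(0 := d)) (leq (Var 0) (num n)) \<longrightarrow>
      sat D F R (e(0 := d)) (disjs (map (\<lambda>i. Eq (Var 0) (num i)) [0..<Suc n]))" for e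
    using that(2) unfolding sat.simps by blast
  then show ?thesis using that(1) unfolding sat_disjs_num by (simp add: leq_def num)
qed

lemma le_total_num: "R 1 [d, c n] \<or> R 1 [c n, d]" if "d \<in> D"
proof -
  have "sat D F R e (All 0 (Or (leq (Var 0) (num n)) (leq (num n) (Var 0))))" for e
    by (intro axioms) (auto simp: R_thy_def)
  then show ?thesis using that by (simp add: leq_def num)
qed

text \<open>No axiom asserts an inequality of numerals outright. It follows from comparability: the
  reverse inequality would force the two numerals to be equal.\<close>

lemma le_num_iff: "R 1 [c m, c n] \<longleftrightarrow> m \<le> n"
proof -
  have le: "m \<le> n" if "R 1 [c m, c n]" for m n
    using le_numD[OF that num_dom] injD[OF inj_num, of m] by auto
  show ?thesis
  proof
    assume "m \<le> n"
    from le_total_num[OF num_dom, of m n] show "R 1 [c m, c n]"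
    proof
      assume *: "R 1 [c n, c m]"
      with le \<open>m \<le> n\<close> have "m = n" by (simp add: le_antisym)
      with * show ?thesis by simp
    qed
  qed (rule le)
qed

lemma num_simps: "F 0 [] = c 0" "F 1 [c n] = c (Suc n)" "F (Suc 0) [c n] = c (Suc n)"
  "F 2 [c m, c n] = c (m + n)" "F 3 [c m, c n] = c (m * n)"
proof -
  have *: "sat D F R e (Eq (plus (num m) (num n)) (num (m + n)))" "sat D F R e (Eq (times (num m) (num n)) (num (m * n)))" for e
    by (intro axioms; auto simp: R_thy_def)+
  show "F 2 [c m, c n] = c (m + n)" "F 3 [c m, c n] = c (m * n)"
    using * by (simp_all add: plus_def times_def num)
  show "F 0 [] = c 0" using num[of _ 0] by simp
  show "F 1 [c n] = c (Suc n)" "F (Suc 0) [c n] = c (Suc n)" using num[of _ "Suc n"] num[of _ n] by simp_all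
qed

end

theorem R_not_interpretable:
  assumes AB: "A \<inter> B = {}"
  shows "\<not> interpretable R_thy (U_thy A B)"
proof
  assume "interpretable R_thy (U_thy A B)"
  then obtain I where I: "is_interpretation I R_thy (U_thy A B)" by (auto simp: interpretable_def)
  \<comment> \<open>Numeral \<open>n\<close> denotes position \<open>n\<close> on the line of
    \<open>z\<close>, so colouring the nonnegative positions by \<open>A\<close> satisfies the
    axioms for \<open>A\<close>; disjointness gives those for \<open>B\<close>.\<close>
  define z :: point where "z = Point (\<lambda>i. 0 \<le> i \<and> nat i \<in> A) 0 0"
  have num: "val (line_fun z) e (num n) = shift (int n) z" for e n
    by (induction n) simp_all
  have M: "model UNIV (line_fun z) line_rel (snd (U_thy A B))"
    unfolding model_def U_thy_def using AB
    by (auto simp: num line_rel_def marked_def shift_def) (auto simp: z_def)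
  interpret interpretation_in UNIV "line_fun z" line_rel I L_R
    using is_interpretation_in[OF I M] by (simp add: R_thy_def)
  have t: "trm_in L_R (num n)" for n by (induction n) (auto simp: L_R_def)
  interpret R_structure iD iF iR "\<lambda>n. val iF undefined (num n)"
  proof
    show "sat iD iF iR e \<phi>" if "\<phi> \<in> snd R_thy" for \<phi> e
      by (rule interpreted_model[OF I M wf_R that])
    show "val iF e (num n) = val iF undefined (num n)" for e n by (rule val_cong) simp
    show "val iF undefined (num n) \<in> iD" for n using t by (intro int_val_in_dom) auto
  qed
  have ir: "fm_in L_U (irel I (1, 2))" "fv (irel I (1, 2)) \<subseteq> {..<2}"
    using I by (auto simp: is_interpretation_def R_thy_def L_R_def U_thy_def)
  show False
  proof (rule no_definable_chain[OF ir inj_num])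
    show "lsat z (asg [val iF undefined (num m), val iF undefined (num n)]) (irel I (1, 2)) \<longleftrightarrow> m \<le> n" for m n
      using le_num_iff[of m n] by (simp add: int_rel_def numeral_2_eq_2)
  qed
qed

section \<open>Sigma-1 predicates\<close>

text \<open>Predicates on assignments, with de Bruijn indexing: a quantifier binds index 0 of
  the extended assignment \<open>case_nat v e\<close>.\<close>

inductive delta0 :: "((nat \<Rightarrow> nat) \<Rightarrow> bool) \<Rightarrow> bool" where
  delta0_eq: "delta0 (\<lambda>e. e i = e j)"
| delta0_zero: "delta0 (\<lambda>e. e i = 0)"
| delta0_Suc: "delta0 (\<lambda>e. e i = Suc (e j))"
| delta0_add: "delta0 (\<lambda>e. e i = e j + e k)"
| delta0_mult: "delta0 (\<lambda>e. e i = e j * e k)"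
| delta0_False: "delta0 (\<lambda>e. False)"
| delta0_imp: "delta0 P \<Longrightarrow> delta0 Q \<Longrightarrow> delta0 (\<lambda>e. P e \<longrightarrow> Q e)"
| delta0_ball: "delta0 P \<Longrightarrow> delta0 (\<lambda>e. \<forall>v\<le>e i. P (case_nat v e))"

lemma delta0_not: "delta0 P \<Longrightarrow> delta0 (\<lambda>e. \<not> P e)"
  using delta0_imp[OF _ delta0_False] by simp

lemma delta0_disj: "delta0 P \<Longrightarrow> delta0 Q \<Longrightarrow> delta0 (\<lambda>e. P e \<or> Q e)"
  unfolding disj_imp by (rule delta0_imp[OF delta0_not])

lemma delta0_conj: "delta0 P \<Longrightarrow> delta0 Q \<Longrightarrow> delta0 (\<lambda>e. P e \<and> Q e)"
  using delta0_not[OF delta0_imp[OF _ delta0_not, of P Q]] by simp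

lemma delta0_bex: "delta0 P \<Longrightarrow> delta0 (\<lambda>e. \<exists>v\<le>e i. P (case_nat v e))"
  using delta0_not[OF delta0_ball[OF delta0_not]] by simp

lemma case_nat_reindex:
  "(\<lambda>i. case_nat v e (case_nat 0 (\<lambda>i. Suc (\<rho> i)) i)) = case_nat v (\<lambda>i. e (\<rho> i))"
  by (auto simp: fun_eq_iff split: nat.splits)

lemma delta0_reindex: "delta0 P \<Longrightarrow> delta0 (\<lambda>e. P (\<lambda>i. e (\<rho> i)))"
proof (induction arbitrary: \<rho> rule: delta0.induct)
  case (delta0_ball P i)
  then show ?case
    using delta0.delta0_ball[OF delta0_ball.IH[of "case_nat 0 (\<lambda>i. Suc (\<rho> i))"], of "\<rho> i"]
    by (simp only: case_nat_reindex)
qed (auto intro: delta0.intros)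

text \<open>A single unbounded quantifier in front of a decidable matrix can be realised by one
  \<open>Mn\<close> search, and its witnesses can be compared in Rosser's manner. Closure properties
  contract several quantifiers into one by means of a common bound.\<close>

definition sigma1 :: "((nat \<Rightarrow> nat) \<Rightarrow> bool) \<Rightarrow> bool" where
  "sigma1 P \<longleftrightarrow> (\<exists>Q. delta0 Q \<and> (\<forall>e. P e \<longleftrightarrow> (\<exists>v. Q (case_nat v e))))"

lemma sigma1I: "delta0 Q \<Longrightarrow> (\<And>e. P e \<longleftrightarrow> (\<exists>v. Q (case_nat v e))) \<Longrightarrow> sigma1 P"
  by (auto simp: sigma1_def)

lemma sigma1_delta0: "delta0 P \<Longrightarrow> sigma1 P"
  by (rule sigma1I[OF delta0_reindex[where \<rho> = Suc]]) auto

lemma sigma1_reindex: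
  assumes "sigma1 P"
  shows "sigma1 (\<lambda>e. P (\<lambda>i. e (\<rho> i)))"
proof -
  obtain Q where Q: "delta0 Q" "\<And>e. P e \<longleftrightarrow> (\<exists>v. Q (case_nat v e))" using assms by (auto simp: sigma1_def)
  show ?thesis
    by (intro sigma1I[OF delta0_reindex[OF Q(1), of "case_nat 0 (\<lambda>i. Suc (\<rho> i))"]])
      (simp only: Q(2) case_nat_reindex)
qed

lemma delta0_bex_tl:
  assumes "delta0 Q"
  shows "delta0 (\<lambda>e. \<exists>v\<le>e 0. Q (case_nat v (\<lambda>i. e (Suc i))))"
proof -
  have "(\<lambda>i. case_nat v e (case_nat 0 (\<lambda>i. Suc (Suc i)) i)) = case_nat v (\<lambda>i. e (Suc i))" for v and e :: "nat \<Rightarrow> nat"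
    by (auto simp: fun_eq_iff split: nat.splits)
  then show ?thesis
    using delta0_bex[OF delta0_reindex[OF assms, of "case_nat 0 (\<lambda>i. Suc (Suc i))"], of 0] by simp
qed

lemma sigma1_conj:
  assumes "sigma1 P" "sigma1 P'"
  shows "sigma1 (\<lambda>e. P e \<and> P' e)"
proof -
  obtain Q where Q: "delta0 Q" "\<And>e. P e \<longleftrightarrow> (\<exists>v. Q (case_nat v e))"
    using assms(1) by (auto simp: sigma1_def)
  obtain Q' where Q': "delta0 Q'" "\<And>e. P' e \<longleftrightarrow> (\<exists>v. Q' (case_nat v e))"
    using assms(2) by (auto simp: sigma1_def)
  \<comment> \<open>The one remaining unbounded variable is a bound on both witnesses.\<close>
  have "((\<exists>v. A v) \<and> (\<exists>v. B v)) = (\<exists>u. (\<exists>v\<le>u. A v) \<and> (\<exists>v\<le>u. B v))" for A B :: "nat \<Rightarrow> bool"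
    by (metis max.cobounded1 max.cobounded2)
  note * = this
  show ?thesis
    by (rule sigma1I[OF delta0_conj[OF delta0_bex_tl[OF Q(1)] delta0_bex_tl[OF Q'(1)]]])
      (simp only: Q(2) Q'(2) nat.case, rule *)
qed

lemma sigma1_disj:
  assumes "sigma1 P" "sigma1 P'"
  shows "sigma1 (\<lambda>e. P e \<or> P' e)"
proof -
  obtain Q where Q: "delta0 Q" "\<And>e. P e \<longleftrightarrow> (\<exists>v. Q (case_nat v e))"
    using assms(1) by (auto simp: sigma1_def)
  obtain Q' where Q': "delta0 Q'" "\<And>e. P' e \<longleftrightarrow> (\<exists>v. Q' (case_nat v e))"
    using assms(2) by (auto simp: sigma1_def)
  show ?thesis
    by (rule sigma1I[OF delta0_disj[OF Q(1) Q'(1)]]) (auto simp: Q(2) Q'(2))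
qed

lemma delta0_bex_tl2:
  assumes "delta0 Q"
  shows "delta0 (\<lambda>e. \<exists>w\<le>e 1. Q (case_nat w (case_nat (e 0) (\<lambda>i. e (Suc (Suc i))))))"
proof -
  let ?\<rho> = "case_nat 0 (case_nat 1 (\<lambda>i. Suc (Suc (Suc i))))"
  have "(\<lambda>i. case_nat w e (?\<rho> i)) = case_nat w (case_nat (e 0) (\<lambda>i. e (Suc (Suc i))))" for w and e :: "nat \<Rightarrow> nat"
    by (auto simp: fun_eq_iff split: nat.splits)
  then show ?thesis
    using delta0_bex[OF delta0_reindex[OF assms, of ?\<rho>], of 1] by simp
qed

lemma sigma1_ex:
  assumes "sigma1 (\<lambda>e. P (e 0) (\<lambda>i. e (Suc i)))"
  shows "sigma1 (\<lambda>e. \<exists>v. P v e)"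
proof -
  obtain Q where Q: "delta0 Q" "\<And>e. P (e 0) (\<lambda>i. e (Suc i)) \<longleftrightarrow> (\<exists>w. Q (case_nat w e))"
    using assms by (auto simp: sigma1_def)
  have P: "P v e \<longleftrightarrow> (\<exists>w. Q (case_nat w (case_nat v e)))" for v e
    using Q(2)[of "case_nat v e"] by simp
  have "(\<exists>v w. A v w) = (\<exists>u. \<exists>v\<le>u. \<exists>w\<le>u. A v w)" for A :: "nat \<Rightarrow> nat \<Rightarrow> bool"
    by (metis max.cobounded1 max.cobounded2)
  then show ?thesis
    by (intro sigma1I[OF delta0_bex[OF delta0_bex_tl2[OF Q(1)], of 0]]) (simp add: P)
qed

lemma bounded_collection:
  "(\<forall>v<n. \<exists>w. A v w) \<longleftrightarrow> (\<exists>u :: nat. \<forall>v<n :: nat. \<exists>w\<le>u. A v w)"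
proof
  assume "\<forall>v<n. \<exists>w. A v w"
  then obtain f where f: "\<And>v. v < n \<Longrightarrow> A v (f v)" by metis
  have "f v \<le> (\<Sum>v<n. f v)" if "v < n" for v using that by (intro member_le_sum) auto
  with f show "\<exists>u. \<forall>v<n. \<exists>w\<le>u. A v w" by blast
qed blast

lemma sigma1_ball_var:
  assumes "sigma1 (\<lambda>e. P (e 0) (\<lambda>i. e (Suc i)))"
  shows "sigma1 (\<lambda>e. \<forall>v<e j. P v e)"
proof -
  obtain Q where Q: "delta0 Q" "\<And>e. P (e 0) (\<lambda>i. e (Suc i)) \<longleftrightarrow> (\<exists>w. Q (case_nat w e))"
    using assms by (auto simp: sigma1_def)
  have P: "P v e \<longleftrightarrow> (\<exists>w. Q (case_nat w (case_nat v e)))" for v e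
    using Q(2)[of "case_nat v e"] by simp
  \<comment> \<open>\<open>delta0\<close> offers only the bound \<open>v \<le> n\<close>, so the
    endpoint is exempted by the disjunct \<open>v = n\<close>.\<close>
  have "(\<forall>v<n. \<exists>w. A v w) = (\<exists>u. \<forall>v\<le>n. v = n \<or> (\<exists>w\<le>u. A v w))" for n and A :: "nat \<Rightarrow> nat \<Rightarrow> bool"
    using bounded_collection[of n A] by (simp add: le_less)
  note * = this
  have d: "delta0 (\<lambda>e. \<forall>v\<le>e (Suc j). case_nat v e 0 = case_nat v e (Suc (Suc j)) \<or>
      (\<exists>w\<le>case_nat v e 1. Q (case_nat w (case_nat (case_nat v e 0) (\<lambda>i. case_nat v e (Suc (Suc i)))))))"
    by (rule delta0_ball[OF delta0_disj[OF delta0_eq delta0_bex_tl2[OF Q(1)]]])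
  show ?thesis
    by (rule sigma1I[OF d]) (simp only: P nat.case One_nat_def, rule *)
qed

text \<open>Total functions with a Sigma-1 graph play the part of terms: such an expression is
  substituted into a predicate by naming its value with an existential quantifier.\<close>

definition sfun :: "((nat \<Rightarrow> nat) \<Rightarrow> nat) \<Rightarrow> bool" where
  "sfun t \<longleftrightarrow> sigma1 (\<lambda>e. e 0 = t (\<lambda>i. e (Suc i)))"

lemma sfun_reindex: "sfun t \<Longrightarrow> sfun (\<lambda>e. t (\<lambda>i. e (\<rho> i)))"
  unfolding sfun_def by (drule sigma1_reindex[where \<rho> = "case_nat 0 (\<lambda>i. Suc (\<rho> i))"]) simp

lemma sigma1_subst:
  assumes "sfun t" "sigma1 (\<lambda>e. P (e 0) (\<lambda>i. e (Suc i)))"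
  shows "sigma1 (\<lambda>e. P (t e) e)"
proof -
  have "sigma1 (\<lambda>e. \<exists>v. v = t e \<and> P v e)"
    by (intro sigma1_ex sigma1_conj assms(2) assms(1)[unfolded sfun_def])
  then show ?thesis by simp
qed

lemma sigma1_rel1:
  assumes "sigma1 (\<lambda>e. P (e 0))" "sfun t"
  shows "sigma1 (\<lambda>e. P (t e))"
  using sigma1_subst[OF assms(2), of "\<lambda>v e. P v"] assms(1) by simp

lemma sigma1_rel2:
  assumes "sigma1 (\<lambda>e. P (e 0) (e 1))" "sfun t" "sfun u"
  shows "sigma1 (\<lambda>e. P (t e) (u e))"
proof (rule sigma1_subst[OF assms(2), of "\<lambda>v e. P v (u e)"])
  have "sigma1 (\<lambda>e. P (e 1) (e 0))"
    using sigma1_reindex[OF assms(1), of "\<lambda>i. if i = 0 then 1 else 0"] by simp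
  then show "sigma1 (\<lambda>e. P (e 0) (u (\<lambda>i. e (Suc i))))"
    using sigma1_subst[OF sfun_reindex[OF assms(3), of Suc], of "\<lambda>v e. P (e 0) v"] by simp
qed

lemma sigma1_rel3:
  assumes "sigma1 (\<lambda>e. P (e 0) (e 1) (e 2))" "sfun t" "sfun u" "sfun s"
  shows "sigma1 (\<lambda>e. P (t e) (u e) (s e))"
proof (rule sigma1_subst[OF assms(2), of "\<lambda>v e. P v (u e) (s e)"])
  have "sigma1 (\<lambda>e. P (e 2) (e 1) (e 0))"
    using sigma1_reindex[OF assms(1), of "\<lambda>i. if i = 0 then 2 else if i = 1 then 1 else 0"] by simp
  then have "sigma1 (\<lambda>e. P (e 1) (e 0) (s (\<lambda>i. e (Suc (Suc i)))))"
    using sigma1_subst[OF sfun_reindex[OF assms(4), of "\<lambda>i. Suc (Suc i)"], of "\<lambda>v e. P (e 1) (e 0) v"]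
    by (simp add: numeral_2_eq_2)
  then show "sigma1 (\<lambda>e. P (e 0) (u (\<lambda>i. e (Suc i))) (s (\<lambda>i. e (Suc i))))"
    using sigma1_subst[OF sfun_reindex[OF assms(3), of Suc], of "\<lambda>v e. P (e 0) v (s (\<lambda>i. e (Suc i)))"] by simp
qed

lemma sfun_var: "sfun (\<lambda>e. e i)"
  unfolding sfun_def by (rule sigma1_delta0[OF delta0_eq])

lemma sfun_lift1:
  assumes "sigma1 (\<lambda>e. e 0 = f (e 1))" "sfun t"
  shows "sfun (\<lambda>e. f (t e))"
  unfolding sfun_def
  by (rule sigma1_rel2[OF assms(1) sfun_var sfun_reindex[OF assms(2)]])

lemma sfun_lift2:
  assumes "sigma1 (\<lambda>e. e 0 = f (e 1) (e 2))" "sfun t" "sfun u"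
  shows "sfun (\<lambda>e. f (t e) (u e))"
  unfolding sfun_def
  by (rule sigma1_rel3[OF assms(1) sfun_var sfun_reindex[OF assms(2)] sfun_reindex[OF assms(3)]])

lemma sfun_Suc: "sfun t \<Longrightarrow> sfun (\<lambda>e. Suc (t e))"
  by (rule sfun_lift1[OF sigma1_delta0[OF delta0_Suc]])

lemma sfun_add: "sfun t \<Longrightarrow> sfun u \<Longrightarrow> sfun (\<lambda>e. t e + u e)"
  by (rule sfun_lift2[where f = "(+)", OF sigma1_delta0[OF delta0_add]])

lemma sfun_mult: "sfun t \<Longrightarrow> sfun u \<Longrightarrow> sfun (\<lambda>e. t e * u e)"
  by (rule sfun_lift2[where f = "(*)", OF sigma1_delta0[OF delta0_mult]])

lemma sfun_const: "sfun (\<lambda>e. c)"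
proof (induction c)
  case 0
  show ?case unfolding sfun_def by (rule sigma1_delta0[OF delta0_zero])
qed (rule sfun_Suc)

lemma sigma1_eq: "sfun t \<Longrightarrow> sfun u \<Longrightarrow> sigma1 (\<lambda>e. t e = u e)"
  by (rule sigma1_rel2[where P = "(=)", OF sigma1_delta0[OF delta0_eq]])

lemma sigma1_le:
  assumes "sfun t" "sfun u"
  shows "sigma1 (\<lambda>e. t e \<le> u e)"
proof -
  have "sigma1 (\<lambda>e. \<exists>k. u e = t e + k)"
    by (intro sigma1_ex sigma1_eq sfun_add sfun_var assms[THEN sfun_reindex])
  then show ?thesis by (simp add: le_iff_add)
qed

lemma sigma1_less: "sfun t \<Longrightarrow> sfun u \<Longrightarrow> sigma1 (\<lambda>e. t e < u e)"
  using sigma1_le[OF sfun_Suc, of t u] by (simp add: Suc_le_eq)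

lemma sigma1_neq: "sfun t \<Longrightarrow> sfun u \<Longrightarrow> sigma1 (\<lambda>e. t e \<noteq> u e)"
  using sigma1_disj[OF sigma1_less sigma1_less, of t u u t] by (simp add: neq_iff)

lemma sigma1_ball:
  assumes "sfun t" "sigma1 (\<lambda>e. P (e 0) (\<lambda>i. e (Suc i)))"
  shows "sigma1 (\<lambda>e. \<forall>v<t e. P v e)"
proof (rule sigma1_subst[OF assms(1), of "\<lambda>b e. \<forall>v<b. P v e"])
  have "sigma1 (\<lambda>e. P (e 0) (\<lambda>i. e (Suc (Suc i))))"
    using sigma1_reindex[OF assms(2), of "case_nat 0 (\<lambda>i. Suc (Suc i))"] by simp
  then show "sigma1 (\<lambda>e. \<forall>v<e 0. P v (\<lambda>i. e (Suc i)))"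
    by (rule sigma1_ball_var[of "\<lambda>v e. P v (\<lambda>i. e (Suc i))"])
qed

lemma sfun_prod_encode:
  assumes "sfun t" "sfun u"
  shows "sfun (\<lambda>e. prod_encode (t e, u e))"
proof (rule sfun_lift2[OF _ assms])
  have tr: "2 * triangle s = s * Suc s" for s by (simp add: triangle_def)
  \<comment> \<open>Doubling removes the division by 2 in the triangular number.\<close>
  have "p = prod_encode (a, b) \<longleftrightarrow> p + p = (a + b) * Suc (a + b) + (a + a)" for p a b
    unfolding prod_encode_def using tr[of "a + b"] by auto
  then show "sigma1 (\<lambda>e. e 0 = prod_encode (e 1, e 2))"
    by (simp only:) (intro sigma1_eq sfun_add sfun_mult sfun_Suc sfun_var)
qed

lemmas sigma1_intros = sigma1_ex sigma1_conj sigma1_disj sigma1_ball sigma1_eq sigma1_neq sigma1_less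
  sigma1_le sfun_Suc sfun_add sfun_mult sfun_prod_encode sfun_const sfun_var

section \<open>Goedel's beta function\<close>

definition beta :: "nat \<Rightarrow> nat \<Rightarrow> nat \<Rightarrow> nat" where
  "beta c d i = c mod Suc (Suc i * d)"

lemma sfun_beta:
  assumes "sfun t" "sfun u" "sfun s"
  shows "sfun (\<lambda>e. beta (t e) (u e) (s e))"
proof -
  have "v = c mod m \<longleftrightarrow> v < m \<and> (\<exists>q. c = q * m + v)" if "0 < m" for v c m :: nat
  proof
    assume "v = c mod m"
    then have "v < m" "c = (c div m) * m + v" using that by simp_all
    then show "v < m \<and> (\<exists>q. c = q * m + v)" by blast
  qed auto
  then have "v = beta c d i \<longleftrightarrow> v < Suc (Suc i * d) \<and> (\<exists>q. c = q * Suc (Suc i * d) + v)" for v c d i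
    unfolding beta_def by blast
  then show ?thesis unfolding sfun_def
    by (simp only:) (intro sigma1_intros assms[THEN sfun_reindex])
qed

lemma beta_sequence: "\<exists>c d. \<forall>i\<le>n. beta c d i = s i"
proof -
  \<comment> \<open>\<open>M\<close> exceeds \<open>n\<close>, so \<open>fact M\<close> is divisible
    by every index difference and the moduli are coprime; \<open>M\<close> also bounds every entry,
    so each entry is its own remainder.\<close>
  define M where "M = (\<Sum>i\<le>n. s i) + n + 1"
  define d where "d = (fact M :: nat)"
  have cop: "coprime (Suc (Suc i * d)) (Suc (Suc j * d))" if ij: "i < j" "j \<le> n" for i j
  proof (rule ccontr)
    assume "\<not> coprime (Suc (Suc i * d)) (Suc (Suc j * d))"
    then obtain p where p: "prime p" "p dvd Suc (Suc i * d)" "p dvd Suc (Suc j * d)"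
      by (meson coprime_iff_gcd_eq_1 gcd_greatest_iff prime_factor_nat)
    \<comment> \<open>This combination of the two moduli cancels \<open>d\<close> and leaves the
      index difference.\<close>
    have "Suc j * Suc (Suc i * d) - Suc i * Suc (Suc j * d) = j - i"
      by (simp add: algebra_simps)
    moreover have "p dvd Suc j * Suc (Suc i * d) - Suc i * Suc (Suc j * d)"
      using p by (intro dvd_diff_nat dvd_mult)
    ultimately have "p dvd j - i" by simp
    moreover have "j - i dvd d" unfolding d_def M_def using ij by (intro dvd_fact) auto
    ultimately have "p dvd Suc i * d" by (meson dvd_mult dvd_trans)
    then have "p dvd 1" using p(2) by (metis Suc_eq_plus1 dvd_add_right_iff)
    then show False using p(1) by (simp add: not_prime_1)
  qed
  have "\<forall>i\<in>{..n}. \<forall>j\<in>{..n}. i \<noteq> j \<longrightarrow> coprime (Suc (Suc i * d)) (Suc (Suc j * d))"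
    using cop by (metis atMost_iff coprime_commute linorder_neqE_nat)
  then obtain c where c: "\<forall>i\<in>{..n}. [c = s i] (mod Suc (Suc i * d))"
    using chinese_remainder_nat[of "{..n}" "\<lambda>i. Suc (Suc i * d)" s] by blast
  have "beta c d i = s i" if "i \<le> n" for i
  proof -
    have "s i \<le> (\<Sum>i\<le>n. s i)" using that by (intro member_le_sum) auto
    also have "\<dots> \<le> M" by (simp add: M_def)
    also have "M \<le> d" unfolding d_def by (rule fact_ge_self)
    finally have "s i < Suc (Suc i * d)" by simp
    moreover have "c mod Suc (Suc i * d) = s i mod Suc (Suc i * d)" using c that by (auto simp: cong_def)
    ultimately show ?thesis unfolding beta_def by (simp only: mod_less)
  qed
  then show ?thesis by blast
qed

text \<open>This replaces a quantifier over sequences by two over numbers, for properties that look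
  only at finitely many entries.\<close>

lemma ex_beta_iff:
  assumes "\<And>s s'. (\<And>i. i \<le> n \<Longrightarrow> s i = s' i) \<Longrightarrow> P s = P s'"
  shows "(\<exists>s. P s) \<longleftrightarrow> (\<exists>c d. P (beta c d))"
proof
  assume "\<exists>s. P s"
  then obtain s where s: "P s" ..
  obtain c d where "\<And>i. i \<le> n \<Longrightarrow> beta c d i = s i" using beta_sequence by blast
  then have "P (beta c d) = P s" by (rule assms)
  with s show "\<exists>c d. P (beta c d)" by blast
qed blast

text \<open>The common pattern of all syntactic relations below: \<open>r2 x y z\<close> lets
  \<open>x\<close> follow from \<open>y\<close> and \<open>z\<close>. A rule with a single premise
  leaves the other argument unconstrained, and its premise can then be used twice.\<close>

inductive clo :: "(nat \<Rightarrow> bool) \<Rightarrow> (nat \<Rightarrow> nat \<Rightarrow> nat \<Rightarrow> bool) \<Rightarrow> nat \<Rightarrow> bool" for r0 r2 where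
  clo_base: "r0 x \<Longrightarrow> clo r0 r2 x"
| clo_step: "r2 x y z \<Longrightarrow> clo r0 r2 y \<Longrightarrow> clo r0 r2 z \<Longrightarrow> clo r0 r2 x"

context fixes r0 :: "nat \<Rightarrow> bool" and r2 :: "nat \<Rightarrow> nat \<Rightarrow> nat \<Rightarrow> bool"
begin

text \<open>The newest entry stands first and rests on the tail, hence the reversal when entries are
  numbered.\<close>

fun derivation :: "nat list \<Rightarrow> bool" where
  "derivation [] = True"
| "derivation (x # xs) = (derivation xs \<and> (r0 x \<or> (\<exists>y\<in>set xs. \<exists>z\<in>set xs. r2 x y z)))"

lemma derivation_append: "derivation xs \<Longrightarrow> derivation ys \<Longrightarrow> derivation (xs @ ys)"
  by (induction xs) auto

lemma clo_derivation: "clo r0 r2 x \<Longrightarrow> \<exists>xs. derivation (x # xs)"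
proof (induction rule: clo.induct)
  case (clo_base x)
  then have "derivation [x]" by simp
  then show ?case ..
next
  case (clo_step x y z)
  then obtain xs ys where "derivation (y # xs)" "derivation (z # ys)" by blast
  then have "derivation ((y # xs) @ (z # ys))" by (rule derivation_append)
  then have "derivation (x # (y # xs) @ (z # ys))" using clo_step.hyps(1) by auto
  then show ?case ..
qed

lemma derivation_nth:
  "derivation xs \<Longrightarrow> i < length xs \<Longrightarrow>
    r0 (rev xs ! i) \<or> (\<exists>j k. j < i \<and> k < i \<and> r2 (rev xs ! i) (rev xs ! j) (rev xs ! k))"
proof (induction xs arbitrary: i)
  case (Cons x xs)
  show ?case
  proof (cases "i < length xs")
    case True
    then show ?thesis using Cons by (fastforce simp: nth_append)
  next
    case False
    with Cons.prems(2) have i: "i = length xs" by simp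
    show ?thesis
    proof (cases "r0 x")
      case True
      then show ?thesis using i by (simp add: nth_append)
    next
      case False
      then obtain y z where yz: "y \<in> set (rev xs)" "z \<in> set (rev xs)" "r2 x y z" using Cons.prems by auto
      then obtain j k where "j < length xs" "rev xs ! j = y" "k < length xs" "rev xs ! k = z"
        unfolding in_set_conv_nth by auto
      then show ?thesis using i yz(3) by (intro disjI2 exI[of _ j] exI[of _ k]) (simp add: nth_append)
    qed
  qed
qed simp

lemma clo_iff_sequence:
  "clo r0 r2 x \<longleftrightarrow> (\<exists>n s. (\<forall>i<Suc n. r0 (s i) \<or> (\<exists>j k. j < i \<and> k < i \<and> r2 (s i) (s j) (s k))) \<and> x = s n)"
proof
  assume "clo r0 r2 x"
  then obtain xs where xs: "derivation (x # xs)" using clo_derivation by blast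
  then show "\<exists>n s. (\<forall>i<Suc n. r0 (s i) \<or> (\<exists>j k. j < i \<and> k < i \<and> r2 (s i) (s j) (s k))) \<and> x = s n"
    using derivation_nth[OF xs]
    by (intro exI[of _ "length xs"] exI[of _ "(!) (rev (x # xs))"]) (simp add: nth_append)
next
  assume "\<exists>n s. (\<forall>i<Suc n. r0 (s i) \<or> (\<exists>j k. j < i \<and> k < i \<and> r2 (s i) (s j) (s k))) \<and> x = s n"
  then obtain n s where s: "\<And>i. i < Suc n \<Longrightarrow> r0 (s i) \<or> (\<exists>j k. j < i \<and> k < i \<and> r2 (s i) (s j) (s k))" "x = s n"
    by blast
  have "i < Suc n \<Longrightarrow> clo r0 r2 (s i)" for i
  proof (induction i rule: less_induct)
    case (less i)
    from s(1)[OF less.prems] show ?case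
    proof
      assume "\<exists>j k. j < i \<and> k < i \<and> r2 (s i) (s j) (s k)"
      then obtain j k where "j < i" "k < i" "r2 (s i) (s j) (s k)" by blast
      then show ?thesis using less by (intro clo_step[of r2 "s i" "s j" "s k"]) auto
    qed (rule clo_base)
  qed
  then show "clo r0 r2 x" using s(2) by simp
qed

text \<open>A derivation becomes a sequence coded by \<open>beta\<close>. Since the rules themselves
  may be Sigma-1, one inductive definition can be used inside another.\<close>

lemma sigma1_clo:
  assumes "sigma1 (\<lambda>e. r0 (e 0))" "sigma1 (\<lambda>e. r2 (e 0) (e 1) (e 2))"
  shows "sigma1 (\<lambda>e. clo r0 r2 (e 0))"
proof -
  have eq: "clo r0 r2 x \<longleftrightarrow> (\<exists>n c d. (\<forall>i<Suc n. r0 (beta c d i) \<or>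
      (\<exists>j k. j < i \<and> k < i \<and> r2 (beta c d i) (beta c d j) (beta c d k))) \<and> x = beta c d n)" for x
    unfolding clo_iff_sequence
  proof (intro arg_cong[where f = HOL.Ex] ext ex_beta_iff)
    fix n :: nat and s s' :: "nat \<Rightarrow> nat" assume ss: "\<And>i. i \<le> n \<Longrightarrow> s i = s' i"
    then have "r2 (s i) (s j) (s k) = r2 (s' i) (s' j) (s' k)" "s i = s' i" if "i < Suc n" "j < i" "k < i" for i j k
      using that by simp_all
    then show "((\<forall>i<Suc n. r0 (s i) \<or> (\<exists>j k. j < i \<and> k < i \<and> r2 (s i) (s j) (s k))) \<and> x = s n) =
      ((\<forall>i<Suc n. r0 (s' i) \<or> (\<exists>j k. j < i \<and> k < i \<and> r2 (s' i) (s' j) (s' k))) \<and> x = s' n)"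
      using ss by (metis less_Suc_eq_le order_refl)
  qed
  show ?thesis unfolding eq
    by (intro sigma1_intros sfun_beta sigma1_rel1[OF assms(1)] sigma1_rel3[OF assms(2)])
qed

end

section \<open>Graphs of partial recursive functions are Sigma-1\<close>

inductive_cases eval_ZrE: "eval Zr xs y"
inductive_cases eval_ScE: "eval Sc xs y"
inductive_cases eval_IdE: "eval (Id i) xs y"
inductive_cases eval_CnE: "eval (Cn f gs) xs y"
inductive_cases eval_Pr0E: "eval (Pr f g) (0 # xs) y"
inductive_cases eval_PrSE: "eval (Pr f g) (Suc n # xs) y"
inductive_cases eval_PrNilE: "eval (Pr f g) [] y"
inductive_cases eval_MnE: "eval (Mn f) xs y"

lemma eval_iffs:
  "eval Zr xs y \<longleftrightarrow> y = 0"
  "eval Sc (x # xs) y \<longleftrightarrow> y = Suc x"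
  "\<not> eval Sc [] y"
  "eval (Id i) xs y \<longleftrightarrow> i < length xs \<and> y = xs ! i"
  "eval (Cn f gs) xs y \<longleftrightarrow> (\<exists>ys. list_all2 (\<lambda>g. eval g xs) gs ys \<and> eval f ys y)"
  "\<not> eval (Pr f g) [] y"
  "eval (Mn f) xs y \<longleftrightarrow> eval f (y # xs) 0 \<and> (\<forall>m<y. \<exists>v. eval f (m # xs) v \<and> v \<noteq> 0)"
  by (auto elim: eval_ZrE eval_ScE eval_IdE eval_CnE eval_PrNilE eval_MnE intro: eval.intros)

lemma eval_Pr_iff:
  "eval (Pr f g) (n # xs) y \<longleftrightarrow>
    (\<exists>s. eval f xs (s 0) \<and> (\<forall>i<n. eval g (s i # i # xs) (s (Suc i))) \<and> y = s n)"
proof (induction n arbitrary: y)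
  case 0
  show ?case by (auto elim: eval_Pr0E intro: ev_Pr0 exI[of _ "\<lambda>_. y"])
next
  case (Suc n)
  show ?case
  proof
    assume "eval (Pr f g) (Suc n # xs) y"
    then obtain u where u: "eval (Pr f g) (n # xs) u" "eval g (u # n # xs) y" by (rule eval_PrSE)
    then obtain s where s: "eval f xs (s 0)" "\<forall>i<n. eval g (s i # i # xs) (s (Suc i))" "u = s n"
      using Suc.IH by blast
    show "\<exists>s. eval f xs (s 0) \<and> (\<forall>i<Suc n. eval g (s i # i # xs) (s (Suc i))) \<and> y = s (Suc n)"
      using s u(2) by (intro exI[of _ "s(Suc n := y)"]) (auto simp: less_Suc_eq)
  next
    assume "\<exists>s. eval f xs (s 0) \<and> (\<forall>i<Suc n. eval g (s i # i # xs) (s (Suc i))) \<and> y = s (Suc n)"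
    then obtain s where s: "eval f xs (s 0)" "\<forall>i<Suc n. eval g (s i # i # xs) (s (Suc i))" "y = s (Suc n)" by blast
    then have "eval (Pr f g) (n # xs) (s n)" using Suc.IH by auto
    then show "eval (Pr f g) (Suc n # xs) y" using s by (auto intro: ev_PrS)
  qed
qed

text \<open>Arguments and result are arbitrary Sigma-1 functions of the assignment, because the
  induction hypothesis is used beneath quantifiers, for values bound there.\<close>

lemma sigma1_eval:
  "(\<And>u. u \<in> set ts \<Longrightarrow> sfun u) \<Longrightarrow> sfun t \<Longrightarrow> sigma1 (\<lambda>e. eval f (map (\<lambda>u. u e) ts) (t e))"
proof (induction f arbitrary: ts t)
  case Zr
  then show ?case by (simp add: eval_iffs) (intro sigma1_intros)
next
  case Sc
  have F: "sigma1 (\<lambda>e. False)" by (rule sigma1_delta0[OF delta0_False])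
  show ?case using Sc F by (cases ts) (auto simp: eval_iffs intro!: sigma1_eq sfun_Suc)
next
  case (Id i)
  have F: "sigma1 (\<lambda>e. False)" by (rule sigma1_delta0[OF delta0_False])
  show ?case using Id F by (cases "i < length ts") (auto simp: eval_iffs intro!: sigma1_eq)
next
  case (Cn f gs)
  \<comment> \<open>The list of intermediate values is unrolled into one quantifier per entry:
    \<open>hs\<close> are the functions still to be evaluated, \<open>us\<close> the values already
    bound.\<close>
  have "sigma1 (\<lambda>e. \<exists>ys. list_all2 (\<lambda>g. eval g (map (\<lambda>u. u e) ts)) hs ys \<and> eval f (map (\<lambda>u. u e) us @ ys) (t e))"
    if "set hs \<subseteq> set gs" "\<And>u. u \<in> set ts \<Longrightarrow> sfun u" "\<And>u. u \<in> set us \<Longrightarrow> sfun u" "sfun t" for hs ts us t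
    using that
  proof (induction hs arbitrary: ts us t)
    case Nil
    then show ?case using Cn.IH(1)[of us t] by simp
  next
    case (Cons h hs)
    let ?S = "\<lambda>u e. u (\<lambda>i. e (Suc i)) :: nat"
    have S: "sfun (?S u)" if "sfun u" for u using that by (rule sfun_reindex)
    have 1: "sigma1 (\<lambda>e. eval h (map (\<lambda>u. u (\<lambda>i. e (Suc i))) ts) (e 0))"
      using Cn.IH(2)[of h "map ?S ts" "\<lambda>e. e 0"] Cons.prems(1,2) S sfun_var by (auto simp: comp_def)
    have 2: "sigma1 (\<lambda>e. \<exists>ys. list_all2 (\<lambda>g. eval g (map (\<lambda>u. u (\<lambda>i. e (Suc i))) ts)) hs ys \<and>
        eval f ((map (\<lambda>u. u (\<lambda>i. e (Suc i))) us @ [e 0]) @ ys) (t (\<lambda>i. e (Suc i))))"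
      using Cons.IH[of "map ?S ts" "map ?S us @ [\<lambda>e. e 0]" "?S t"] Cons.prems S sfun_var by (auto simp: comp_def)
    have "sigma1 (\<lambda>e. \<exists>v. eval h (map (\<lambda>u. u e) ts) v \<and> (\<exists>ys. list_all2 (\<lambda>g. eval g (map (\<lambda>u. u e) ts)) hs ys \<and>
        eval f ((map (\<lambda>u. u e) us @ [v]) @ ys) (t e)))"
      by (intro sigma1_ex sigma1_conj 1 2)
    moreover have "(\<exists>ys. list_all2 (\<lambda>g. eval g (map (\<lambda>u. u e) ts)) (h # hs) ys \<and> eval f (map (\<lambda>u. u e) us @ ys) (t e))
      \<longleftrightarrow> (\<exists>v. eval h (map (\<lambda>u. u e) ts) v \<and> (\<exists>ys. list_all2 (\<lambda>g. eval g (map (\<lambda>u. u e) ts)) hs ys \<and>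
        eval f ((map (\<lambda>u. u e) us @ [v]) @ ys) (t e)))" for e
      by (auto simp: list_all2_Cons1)
    ultimately show ?case by presburger
  qed
  from this[of gs ts "[]" t] show ?case using Cn.prems by (simp add: eval_iffs)
next
  case (Pr f g)
  show ?case
  proof (cases ts)
    case Nil
    then show ?thesis using sigma1_delta0[OF delta0_False] by (simp add: eval_iffs)
  next
    case (Cons m ts')
    have m: "sfun m" and ts': "\<And>u. u \<in> set ts' \<Longrightarrow> sfun u" using Pr.prems(1) Cons by auto
    let ?S2 = "\<lambda>u e. u (\<lambda>i. e (Suc (Suc i))) :: nat" and ?S3 = "\<lambda>u e. u (\<lambda>i. e (Suc (Suc (Suc i)))) :: nat"
    have 1: "sigma1 (\<lambda>e. eval f (map (\<lambda>u. u (\<lambda>i. e (Suc (Suc i)))) ts') (beta (e (Suc 0)) (e 0) 0))"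
      using Pr.IH(1)[of "map ?S2 ts'" "\<lambda>e. beta (e (Suc 0)) (e 0) 0"] sfun_reindex[OF ts', of _ "\<lambda>i. Suc (Suc i)"]
        sfun_beta sfun_var sfun_const by (auto simp: comp_def)
    have b: "sfun (\<lambda>e. beta (e (Suc (Suc 0))) (e (Suc 0)) (e 0))"
      "sfun (\<lambda>e. beta (e (Suc (Suc 0))) (e (Suc 0)) (Suc (e 0)))"
      by (intro sfun_beta sfun_Suc sfun_var)+
    have 2: "sigma1 (\<lambda>e. eval g (beta (e (Suc (Suc 0))) (e (Suc 0)) (e 0) # e 0 # map (\<lambda>u. u (\<lambda>i. e (Suc (Suc (Suc i))))) ts')
        (beta (e (Suc (Suc 0))) (e (Suc 0)) (Suc (e 0))))"
      using Pr.IH(2)[of "(\<lambda>e. beta (e (Suc (Suc 0))) (e (Suc 0)) (e 0)) # (\<lambda>e. e 0) # map ?S3 ts'"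
          "\<lambda>e. beta (e (Suc (Suc 0))) (e (Suc 0)) (Suc (e 0))"] sfun_reindex[OF ts', of _ "\<lambda>i. Suc (Suc (Suc i))"]
        b sfun_var by (auto simp: comp_def)
    have "sigma1 (\<lambda>e. \<exists>c d. eval f (map (\<lambda>u. u e) ts') (beta c d 0) \<and>
        (\<forall>i<m e. eval g (beta c d i # i # map (\<lambda>u. u e) ts') (beta c d (Suc i))) \<and> t e = beta c d (m e))"
      by (intro sigma1_ex sigma1_conj 1 sigma1_ball 2 sigma1_eq sfun_beta sfun_var m[THEN sfun_reindex] Pr.prems(2)[THEN sfun_reindex])
    moreover have "eval (Pr f g) (n # xs) y \<longleftrightarrow> (\<exists>c d. eval f xs (beta c d 0) \<and>
        (\<forall>i<n. eval g (beta c d i # i # xs) (beta c d (Suc i))) \<and> y = beta c d n)" for n xs y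
      unfolding eval_Pr_iff by (rule ex_beta_iff[of n]) simp
    ultimately show ?thesis using Cons by simp
  qed
next
  case (Mn f)
  let ?S1 = "\<lambda>u e. u (\<lambda>i. e (Suc i)) :: nat" and ?S2 = "\<lambda>u e. u (\<lambda>i. e (Suc (Suc i))) :: nat"
  have 1: "sigma1 (\<lambda>e. eval f (t e # map (\<lambda>u. u e) ts) 0)"
    using Mn.IH[of "t # ts" "\<lambda>e. 0"] Mn.prems sfun_const by auto
  have 2: "sigma1 (\<lambda>e. eval f (e (Suc 0) # map (\<lambda>u. u (\<lambda>i. e (Suc (Suc i)))) ts) (e 0))"
    using Mn.IH[of "(\<lambda>e. e (Suc 0)) # map ?S2 ts" "\<lambda>e. e 0"] sfun_reindex[OF Mn.prems(1), of _ "\<lambda>i. Suc (Suc i)"] sfun_var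
    by (auto simp: comp_def)
  show ?case unfolding eval_iffs
    by (intro sigma1_ex sigma1_conj 1 sigma1_ball 2 sigma1_neq sfun_var sfun_const Mn.prems(2))
qed

lemma re_set_sigma1:
  assumes "re_set A"
  shows "sigma1 (\<lambda>e. e 0 \<in> A)"
proof -
  obtain f where f: "\<And>n. n \<in> A \<longleftrightarrow> (\<exists>v. eval f [n] v)" using assms by (auto simp: re_set_def)
  have "sigma1 (\<lambda>e. eval f [e (Suc 0)] (e 0))"
    using sigma1_eval[of "[\<lambda>e. e (Suc 0)]" "\<lambda>e. e 0" f] sfun_var by simp
  then show ?thesis unfolding f by (rule sigma1_ex)
qed

section \<open>From Sigma-1 definitions back to recursive functions\<close>

definition computable :: "nat \<Rightarrow> (nat list \<Rightarrow> nat) \<Rightarrow> bool" where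
  "computable n g \<longleftrightarrow> (\<exists>f. \<forall>xs. length xs = n \<longrightarrow> eval f xs (g xs))"

lemma computable_cong: "(\<And>xs. length xs = n \<Longrightarrow> g xs = h xs) \<Longrightarrow> computable n g = computable n h"
  by (simp add: computable_def)

lemma computable_proj: "i < n \<Longrightarrow> computable n (\<lambda>xs. xs ! i)"
  unfolding computable_def by (auto intro: exI[of _ "Id i"] ev_Id)

lemma computable_comp:
  assumes "computable m h" "length gs = m" "\<And>g. g \<in> set gs \<Longrightarrow> computable n g"
  shows "computable n (\<lambda>xs. h (map (\<lambda>g. g xs) gs))"
proof -
  obtain f where f: "\<And>xs. length xs = m \<Longrightarrow> eval f xs (h xs)" using assms(1) by (auto simp: computable_def)
  obtain F where F: "\<And>g xs. g \<in> set gs \<Longrightarrow> length xs = n \<Longrightarrow> eval (F g) xs (g xs)"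
    using assms(3) unfolding computable_def by metis
  have "eval (Cn f (map F gs)) xs (h (map (\<lambda>g. g xs) gs))" if "length xs = n" for xs
    using F that f assms(2) by (intro ev_Cn[where ys = "map (\<lambda>g. g xs) gs"]) (auto simp: list_all2_conv_all_nth)
  then show ?thesis by (auto simp: computable_def)
qed

lemma computable_comp1:
  assumes "computable 1 (\<lambda>xs. h (xs ! 0))" "computable n g"
  shows "computable n (\<lambda>xs. h (g xs))"
  using computable_comp[OF assms(1), of "[g]"] assms(2) by simp

lemma computable_comp2:
  assumes "computable 2 (\<lambda>xs. h (xs ! 0) (xs ! 1))" "computable n g" "computable n g'"
  shows "computable n (\<lambda>xs. h (g xs) (g' xs))"
  using computable_comp[OF assms(1), of "[g, g']"] assms(2,3) by auto

lemma computable_cons: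
  assumes "computable (Suc n) h" "computable n g"
  shows "computable n (\<lambda>xs. h (g xs # xs))"
proof -
  have c: "computable n (\<lambda>xs. h (map (\<lambda>g. g xs) (g # map (\<lambda>i xs. xs ! i) [0..<n])))"
    using assms computable_proj by (intro computable_comp) auto
  have m: "map (\<lambda>g. g xs) (g # map (\<lambda>i xs. xs ! i) [0..<n]) = g xs # xs" if "length xs = n" for xs
    using that map_nth[of xs] by (simp add: comp_def)
  show ?thesis by (rule iffD1[OF computable_cong c]) (simp only: m)
qed

lemma computable_0: "computable n (\<lambda>xs. 0)"
  unfolding computable_def by (auto intro: ev_Zr)

lemma computable_Suc:
  assumes "computable n g"
  shows "computable n (\<lambda>xs. Suc (g xs))"
proof (rule computable_comp1[OF _ assms])
  have "eval Sc xs (Suc (xs ! 0))" if "length xs = 1" for xs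
    using that by (cases xs) (auto intro: ev_Sc)
  then show "computable 1 (\<lambda>xs. Suc (xs ! 0))" by (auto simp: computable_def)
qed

lemma computable_rec:
  assumes "computable n g" "computable (Suc (Suc n)) h"
  shows "computable (Suc n) (\<lambda>xs. rec_nat (g (tl xs)) (\<lambda>k y. h (y # k # tl xs)) (hd xs))"
proof -
  obtain f where f: "\<And>xs. length xs = n \<Longrightarrow> eval f xs (g xs)" using assms(1) by (auto simp: computable_def)
  obtain f' where f': "\<And>xs. length xs = Suc (Suc n) \<Longrightarrow> eval f' xs (h xs)" using assms(2) by (auto simp: computable_def)
  have "eval (Pr f f') (m # xs) (rec_nat (g xs) (\<lambda>k y. h (y # k # xs)) m)" if "length xs = n" for m xs
    using that by (induction m) (auto intro!: ev_Pr0 ev_PrS f f')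
  then have "eval (Pr f f') xs (rec_nat (g (tl xs)) (\<lambda>k y. h (y # k # tl xs)) (hd xs))" if "length xs = Suc n" for xs
    using that by (cases xs) auto
  then show ?thesis by (auto simp: computable_def)
qed

lemma computable_rec2:
  assumes "computable 1 (\<lambda>xs. g (xs ! 0))" "computable 3 (\<lambda>xs. h (xs ! 0) (xs ! 1) (xs ! 2))"
    and "computable n t" "computable n u"
  shows "computable n (\<lambda>xs. rec_nat (g (u xs)) (\<lambda>k y. h y k (u xs)) (t xs))"
proof (rule computable_comp2[OF _ assms(3,4)])
  have "computable (Suc 1) (\<lambda>xs. rec_nat (g (tl xs ! 0)) (\<lambda>k y. h ((y # k # tl xs) ! 0) ((y # k # tl xs) ! 1) ((y # k # tl xs) ! 2)) (hd xs))"
    using assms(1,2) by (intro computable_rec) (auto simp: numeral_3_eq_3)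
  moreover have "rec_nat (g (tl xs ! 0)) (\<lambda>k y. h ((y # k # tl xs) ! 0) ((y # k # tl xs) ! 1) ((y # k # tl xs) ! 2)) (hd xs)
      = rec_nat (g (xs ! 1)) (\<lambda>k y. h y k (xs ! 1)) (xs ! 0)" if "length xs = 2" for xs
    using that by (cases xs) (auto simp: nth_tl hd_conv_nth)
  ultimately show "computable 2 (\<lambda>xs. rec_nat (g (xs ! 1)) (\<lambda>k y. h y k (xs ! 1)) (xs ! 0))"
    unfolding Suc_1 by (rule iffD1[OF computable_cong, rotated])
qed

lemma computable_add:
  assumes "computable n t" "computable n u"
  shows "computable n (\<lambda>xs. t xs + u xs)"
proof -
  have "a + b = rec_nat b (\<lambda>k y. Suc y) a" for a b by (induction a) auto
  then show ?thesis
    using computable_rec2[of "\<lambda>x. x" "\<lambda>y k x. Suc y", OF _ _ assms] computable_Suc computable_proj by simp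
qed

lemma computable_mult:
  assumes "computable n t" "computable n u"
  shows "computable n (\<lambda>xs. t xs * u xs)"
proof -
  have "a * b = rec_nat 0 (\<lambda>k y. y + b) a" for a b :: nat by (induction a) auto
  then show ?thesis
    using computable_rec2[of "\<lambda>x. 0" "\<lambda>y k x. y + x", OF _ _ assms] computable_add computable_proj computable_0 by simp
qed

lemma computable_diff:
  assumes "computable n t" "computable n u"
  shows "computable n (\<lambda>xs. t xs - u xs)"
proof -
  have "a - 1 = rec_nat 0 (\<lambda>k y. k) a" for a :: nat by (induction a) auto
  then have "computable m (\<lambda>xs. s xs - 1)" if "computable m s" for m s
    using computable_rec2[of "\<lambda>x. 0" "\<lambda>y k x. k", OF _ _ that computable_0] computable_proj computable_0 by simp
  then have c: "computable n (\<lambda>xs. rec_nat (t xs) (\<lambda>k y. y - 1) (u xs))"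
    using computable_rec2[of "\<lambda>x. x" "\<lambda>y k x. y - 1", OF _ _ assms(2,1)] computable_proj by simp
  have "rec_nat a (\<lambda>k y. y - 1) b = a - b" for a b :: nat by (induction b) auto
  then show ?thesis by (intro iffD1[OF computable_cong c])
qed

text \<open>A \<open>delta0\<close> predicate reads an infinite assignment; padding with 0 supplies
  one from a finite argument list.\<close>

definition env :: "nat list \<Rightarrow> nat \<Rightarrow> nat" where
  "env xs i = (if i < length xs then xs ! i else 0)"

lemma env_Cons: "env (x # xs) = case_nat x (env xs)"
  by (auto simp: env_def fun_eq_iff split: nat.splits)

lemma computable_env: "computable n (\<lambda>xs. env xs i)"
proof (cases "i < n")
  case True
  then show ?thesis using computable_proj[OF True] by (simp add: env_def cong: computable_cong)
next
  case False
  then show ?thesis using computable_0 by (simp add: env_def cong: computable_cong)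
qed

lemma computable_of_bool_eq:
  assumes "computable n t" "computable n u"
  shows "computable n (\<lambda>xs. of_bool (t xs = u xs))"
proof -
  have "of_bool (a = b) = Suc 0 - ((a - b) + (b - a))" for a b :: nat by auto
  then show ?thesis
    using computable_diff[OF computable_Suc[OF computable_0] computable_add[OF computable_diff[OF assms] computable_diff[OF assms(2,1)]]]
    by (simp only:)
qed

lemma delta0_computable: "delta0 P \<Longrightarrow> computable n (\<lambda>xs. of_bool (P (env xs)))"
proof (induction arbitrary: n rule: delta0.induct)
  case (delta0_imp P Q)
  have "of_bool (p \<longrightarrow> q) = Suc 0 - (of_bool p * (Suc 0 - of_bool q))" for p q by auto
  then show ?case
    using computable_diff[OF computable_Suc[OF computable_0] computable_mult[OF delta0_imp.IH(1)
      computable_diff[OF computable_Suc[OF computable_0] delta0_imp.IH(2)]]] by (simp only:)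
next
  case (delta0_ball P i)
  \<comment> \<open>The step function of \<open>Pr\<close> receives the accumulated value before the
    counter; the predicate must see the counter as its variable 0 and skip the accumulated
    value.\<close>
  have "computable (Suc (Suc n)) (\<lambda>xs. of_bool (P (env (xs ! 1 # tl (tl xs)))))"
  proof -
    have c: "computable (Suc (Suc n)) (\<lambda>xs. of_bool (P (env (map (\<lambda>g. g xs) (map (\<lambda>i xs. xs ! Suc i) [0..<Suc n])))))"
      using delta0_ball.IH computable_proj by (intro computable_comp[of "Suc n"]) (auto simp del: upt_Suc)
    have m: "map (\<lambda>g. g xs) (map (\<lambda>i xs. xs ! Suc i) [0..<Suc n]) = xs ! 1 # tl (tl xs)" if len: "length xs = Suc (Suc n)" for xs
    proof -
      obtain a b ys where "xs = a # b # ys" using len by (auto simp: length_Suc_conv)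
      then show ?thesis using len map_nth[of "b # ys"] by (simp add: comp_def del: upt_Suc)
    qed
    show ?thesis by (rule iffD1[OF computable_cong c]) (simp only: m)
  qed
  then have "computable (Suc (Suc n)) (\<lambda>xs. xs ! 0 * of_bool (P (env (xs ! 1 # tl (tl xs)))))"
    by (rule computable_mult[OF computable_proj, rotated]) simp
  then have "computable (Suc n) (\<lambda>xs. rec_nat (Suc 0) (\<lambda>k y. (y # k # tl xs) ! 0 *
      of_bool (P (env ((y # k # tl xs) ! 1 # tl (tl (y # k # tl xs)))))) (hd xs))"
    by (rule computable_rec[where g = "\<lambda>xs. Suc 0", OF computable_Suc[OF computable_0]])
  \<comment> \<open>The recursion multiplies truth values strictly below its argument, so it runs up
    to the successor of the bound.\<close>
  from computable_cons[OF this computable_Suc[OF computable_env[of n i]]]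
  have "computable n (\<lambda>xs. rec_nat (Suc 0) (\<lambda>k y. y * of_bool (P (env (k # xs)))) (Suc (env xs i)))"
    by (simp only: list.sel nth_Cons_0 nth_Cons_Suc One_nat_def)
  moreover have "rec_nat (Suc 0) (\<lambda>k y. y * of_bool (P (env (k # xs)))) m = of_bool (\<forall>v<m. P (case_nat v (env xs)))" for m xs
    by (induction m) (auto simp: env_Cons less_Suc_eq)
  ultimately show ?case by (simp only: less_Suc_eq_le)
next
  case delta0_False
  show ?case using computable_0 by simp
qed (intro computable_of_bool_eq computable_env computable_0 computable_Suc computable_add computable_mult)+

lemma eval_det: "eval f xs y \<Longrightarrow> eval f xs z \<Longrightarrow> y = z"
proof (induction arbitrary: z rule: eval.induct)
  case (ev_Cn xs gs ys f y)
  then obtain zs where zs: "list_all2 (\<lambda>g. eval g xs) gs zs" "eval f zs z" by (auto simp: eval_iffs)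
  have "ys = zs" using ev_Cn.hyps(1) ev_Cn.IH(1) zs(1)
    by (intro nth_equalityI) (auto simp: list_all2_conv_all_nth)
  then show ?case using ev_Cn.IH zs(2) by blast
next
  case (ev_Mn f n xs)
  then have z: "eval f (z # xs) 0" "\<forall>m<z. \<exists>v. eval f (m # xs) v \<and> v \<noteq> 0" by (auto simp: eval_iffs)
  show ?case
  proof (rule linorder_cases[of n z])
    assume "n < z"
    then obtain v where "eval f (n # xs) v" "v \<noteq> 0" using z(2) by blast
    then show ?thesis using ev_Mn.IH(1) by blast
  next
    assume "z < n"
    then show ?thesis using ev_Mn.IH(2) z(1) by blast
  qed
next
  case (ev_Pr0 f xs y g)
  from ev_Pr0.prems have "eval f xs z" by (rule eval_Pr0E)
  then show ?case by (rule ev_Pr0.IH)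
next
  case (ev_PrS f g n xs y w)
  from ev_PrS.prems obtain u where "eval (Pr f g) (n # xs) u" "eval g (u # n # xs) z" by (rule eval_PrSE)
  then show ?case using ev_PrS.IH by blast
qed (simp_all add: eval_iffs)

lemma sigma1_re_set:
  assumes "sigma1 (\<lambda>e. e 0 \<in> A)"
  shows "re_set A"
proof -
  obtain Q where Q: "delta0 Q" "\<And>e. e 0 \<in> A \<longleftrightarrow> (\<exists>v. Q (case_nat v e))" using assms by (auto simp: sigma1_def)
  \<comment> \<open>\<open>Mn\<close> searches for a zero, hence the negation.\<close>
  obtain g where g: "\<And>xs. length xs = 2 \<Longrightarrow> eval g xs (of_bool (\<not> Q (env xs)))"
    using delta0_computable[OF delta0_not[OF Q(1)], of 2] by (auto simp: computable_def)
  have A: "n \<in> A \<longleftrightarrow> (\<exists>v. Q (env [v, n]))" for n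
    using Q(2)[of "env [n]"] by (simp add: env_Cons)
  have gn: "eval g [v, n] (of_bool (\<not> Q (env [v, n])))" for v n by (rule g) simp
  have "n \<in> A \<longleftrightarrow> (\<exists>v. eval (Mn g) [n] v)" for n
  proof
    assume "n \<in> A"
    then have ex: "\<exists>v. Q (env [v, n])" by (simp add: A)
    define v where "v = (LEAST v. Q (env [v, n]))"
    have "Q (env [v, n])" unfolding v_def by (rule LeastI_ex[OF ex])
    then have "eval g [v, n] 0" using gn[of v n] by simp
    moreover have "\<exists>u. eval g [m, n] u \<and> u \<noteq> 0" if "m < v" for m
      using gn[of m n] not_less_Least[OF that[unfolded v_def]] by (intro exI[of _ 1]) simp
    ultimately show "\<exists>v. eval (Mn g) [n] v" by (auto simp: eval_iffs)
  next
    assume "\<exists>v. eval (Mn g) [n] v"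
    then obtain v where "eval g [v, n] 0" by (auto simp: eval_iffs)
    then have "of_bool (\<not> Q (env [v, n])) = (0 :: nat)" using gn eval_det by blast
    then show "n \<in> A" unfolding A by (metis of_bool_eq_0_iff)
  qed
  then show ?thesis by (auto simp: re_set_def)
qed

text \<open>Post's theorem. One search finds a witness for membership or for non-membership; testing
  the first matrix at the number found decides which, as a witness of one kind excludes those of the
  other.\<close>

lemma sigma1_recursive_set:
  assumes "sigma1 (\<lambda>e. e 0 \<in> A)" "sigma1 (\<lambda>e. e 0 \<notin> A)"
  shows "recursive_set A"
proof -
  obtain Q where Q: "delta0 Q" "\<And>e. e 0 \<in> A \<longleftrightarrow> (\<exists>v. Q (case_nat v e))"
    using assms(1) unfolding sigma1_def by blast
  obtain Q' where Q': "delta0 Q'" "\<And>e. e 0 \<notin> A \<longleftrightarrow> (\<exists>v. Q' (case_nat v e))"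
    using assms(2) unfolding sigma1_def by blast
  obtain g where g: "\<And>xs. length xs = 2 \<Longrightarrow> eval g xs (of_bool (\<not> (Q (env xs) \<or> Q' (env xs))))"
    using delta0_computable[OF delta0_not[OF delta0_disj[OF Q(1) Q'(1)]], of 2] unfolding computable_def by blast
  obtain f where f: "\<And>xs. length xs = 2 \<Longrightarrow> eval f xs (of_bool (Q (env xs)))"
    using delta0_computable[OF Q(1), of 2] unfolding computable_def by blast
  have A: "n \<in> A \<longleftrightarrow> (\<exists>v. Q (env [v, n]))" "n \<notin> A \<longleftrightarrow> (\<exists>v. Q' (env [v, n]))" for n
    using Q(2)[of "env [n]"] Q'(2)[of "env [n]"] by (simp_all add: env_Cons)
  have gn: "eval g [v, n] (of_bool (\<not> (Q (env [v, n]) \<or> Q' (env [v, n]))))" for v n by (rule g) simp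
  have "eval (Cn f [Mn g, Id 0]) [n] (if n \<in> A then 1 else 0)" for n
  proof -
    have ex: "\<exists>v. Q (env [v, n]) \<or> Q' (env [v, n])" using A[of n] by blast
    define v where "v = (LEAST v. Q (env [v, n]) \<or> Q' (env [v, n]))"
    have v: "Q (env [v, n]) \<or> Q' (env [v, n])" unfolding v_def by (rule LeastI_ex[OF ex])
    then have "eval g [v, n] 0" using gn[of v n] by simp
    moreover have "\<exists>u. eval g [m, n] u \<and> u \<noteq> 0" if "m < v" for m
      using gn[of m n] not_less_Least[OF that[unfolded v_def]] by (intro exI[of _ 1]) simp
    ultimately have "eval (Mn g) [n] v" by (auto simp: eval_iffs)
    moreover have "eval (Id 0) [n] n" by (simp add: eval_iffs)
    moreover have "eval f [v, n] (if n \<in> A then 1 else 0)"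
    proof -
      have "Q (env [v, n]) \<longleftrightarrow> n \<in> A" using v A[of n] by blast
      then show ?thesis using f[of "[v, n]"] by (simp add: of_bool_def)
    qed
    ultimately show ?thesis by (intro ev_Cn[where ys = "[v, n]"]) simp_all
  qed
  then show ?thesis unfolding recursive_set_def by blast
qed

section \<open>\<open>U\<close> is interpretable in \<open>R\<close>\<close>

definition numv :: "(nat \<Rightarrow> 'a list \<Rightarrow> 'a) \<Rightarrow> nat \<Rightarrow> 'a" where
  "numv F n = val F undefined (num n)"

lemma val_num: "val F e (num n) = numv F n"
  unfolding numv_def by (rule val_cong) simp

lemma R_model_structure:
  assumes M: "model D F R (snd R_thy)"
  shows "R_structure D F R (numv F)"
proof
  obtain d where d: "d \<in> D" using M by (auto simp: model_def)
  show "sat D F R e \<phi>" if "\<phi> \<in> snd R_thy" for e \<phi>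
  proof -
    have "sat D F R (\<lambda>_. d) \<phi>" using M that d by (auto simp: model_def)
    moreover have "fv \<phi> = {}" using wf_R that by (auto simp: wf_thy_def sentences_def)
    ultimately show ?thesis using sat_cong[of \<phi> "\<lambda>_. d" e] by auto
  qed
  show "val F e (num n) = numv F n" for e n by (rule val_num)
  have "val F (\<lambda>_. d) (num n) \<in> D" for n
    using M d by (intro val_in_dom) (auto simp: model_def)
  then show "numv F n \<in> D" for n by (simp add: val_num)
qed

text \<open>At numerals the truth of such formulas is the same in all models of \<open>R\<close>,
  because nonstandard elements never enter a quantifier bounded by a numeral. \<open>\<rho>\<close>
  names the variable for each index; its finite range leaves a fresh name for the bound
  variable.\<close>

lemma delta0_formula:
  fixes \<rho> :: "nat \<Rightarrow> nat"
  assumes "delta0 P" "finite (range \<rho>)"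
  shows "\<exists>\<phi>. fm_in L_R \<phi> \<and> fv \<phi> \<subseteq> range \<rho> \<and>
    (\<forall>(D :: 'a set) F R e. model D F R (snd R_thy) \<longrightarrow>
      (sat D F R (\<lambda>x. numv F (e x)) \<phi> \<longleftrightarrow> P (\<lambda>i. e (\<rho> i))))"
  using assms
proof (induction arbitrary: \<rho> rule: delta0.induct)
  case (delta0_eq i j)
  show ?case
    by (rule exI[of _ "Eq (Var (\<rho> i)) (Var (\<rho> j))"])
      (auto simp: inj_eq[OF R_structure.inj_num[OF R_model_structure]])
next
  case (delta0_zero i)
  show ?case
    by (rule exI[of _ "Eq (Var (\<rho> i)) (num 0)"])
      (auto simp: inj_eq[OF R_structure.inj_num[OF R_model_structure]] L_R_def
        R_structure.num_simps[OF R_model_structure])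
next
  case (delta0_Suc i j)
  show ?case
    by (rule exI[of _ "Eq (Var (\<rho> i)) (Fn 1 [Var (\<rho> j)])"])
      (auto simp: inj_eq[OF R_structure.inj_num[OF R_model_structure]] L_R_def
        R_structure.num_simps[OF R_model_structure])
next
  case (delta0_add i j k)
  show ?case
    by (rule exI[of _ "Eq (Var (\<rho> i)) (plus (Var (\<rho> j)) (Var (\<rho> k)))"])
      (auto simp: inj_eq[OF R_structure.inj_num[OF R_model_structure]] L_R_def plus_def
        R_structure.num_simps[OF R_model_structure])
next
  case (delta0_mult i j k)
  show ?case
    by (rule exI[of _ "Eq (Var (\<rho> i)) (times (Var (\<rho> j)) (Var (\<rho> k)))"])
      (auto simp: inj_eq[OF R_structure.inj_num[OF R_model_structure]] L_R_def times_def
        R_structure.num_simps[OF R_model_structure])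
next
  case delta0_False
  show ?case by (rule exI[of _ Bot]) auto
next
  case (delta0_imp P Q)
  from delta0_imp.IH(1)[OF delta0_imp.prems] delta0_imp.IH(2)[OF delta0_imp.prems]
  show ?case
  proof (elim exE)
    fix \<phi> \<psi>
    assume "fm_in L_R \<phi> \<and> fv \<phi> \<subseteq> range \<rho> \<and> (\<forall>(D :: 'a set) F R e. model D F R (snd R_thy) \<longrightarrow>
      (sat D F R (\<lambda>x. numv F (e x)) \<phi> \<longleftrightarrow> P (\<lambda>i. e (\<rho> i))))"
      "fm_in L_R \<psi> \<and> fv \<psi> \<subseteq> range \<rho> \<and> (\<forall>(D :: 'a set) F R e. model D F R (snd R_thy) \<longrightarrow>
      (sat D F R (\<lambda>x. numv F (e x)) \<psi> \<longleftrightarrow> Q (\<lambda>i. e (\<rho> i))))"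
    then show ?thesis by (intro exI[of _ "Imp \<phi> \<psi>"]) simp
  qed
next
  case (delta0_ball P i)
  define z where "z = fresh (range \<rho>)"
  have z: "z \<noteq> \<rho> j" for j using fresh_notin[OF delta0_ball.prems] by (auto simp: z_def)
  have ran: "range (case_nat z \<rho>) = insert z (range \<rho>)"
  proof -
    have "case_nat z \<rho> j \<in> insert z (range \<rho>)" for j by (cases j) auto
    moreover have "z \<in> range (case_nat z \<rho>)" "\<rho> j \<in> range (case_nat z \<rho>)" for j
      using rangeI[of "case_nat z \<rho>" 0] rangeI[of "case_nat z \<rho>" "Suc j"] by simp_all
    ultimately show ?thesis by blast
  qed
  then have "finite (range (case_nat z \<rho>))" using delta0_ball.prems by simp
  from delta0_ball.IH[OF this] obtain \<phi> where \<phi>: "fm_in L_R \<phi>" "fv \<phi> \<subseteq> insert z (range \<rho>)"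
    "\<And>(D :: 'a set) F R e. model D F R (snd R_thy) \<Longrightarrow>
      sat D F R (\<lambda>x. numv F (e x)) \<phi> \<longleftrightarrow> P (\<lambda>i. e (case_nat z \<rho> i))"
    unfolding ran by blast
  let ?\<psi> = "All z (Imp (leq (Var z) (Var (\<rho> i))) \<phi>)"
  have "sat D F R (\<lambda>x. numv F (e x)) ?\<psi> \<longleftrightarrow> (\<forall>v\<le>e (\<rho> i). P (case_nat v (\<lambda>j. e (\<rho> j))))"
    if M: "model D F R (snd R_thy)" for D :: "'a set" and F R e
  proof -
    interpret R_structure D F R "numv F" by (rule R_model_structure[OF M])
    have upd: "(\<lambda>x. numv F (e x))(z := numv F v) = (\<lambda>x. numv F ((e(z := v)) x))" for v by auto
    have "(\<lambda>j. (e(z := v)) (case_nat z \<rho> j)) = case_nat v (\<lambda>j. e (\<rho> j))" for v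
      using z by (auto simp: fun_eq_iff split: nat.splits)
    then have 1: "sat D F R ((\<lambda>x. numv F (e x))(z := numv F v)) \<phi> \<longleftrightarrow> P (case_nat v (\<lambda>j. e (\<rho> j)))" for v
      unfolding upd using \<phi>(3)[OF M, of "e(z := v)"] by (simp only:)
    have "sat D F R (\<lambda>x. numv F (e x)) ?\<psi> \<longleftrightarrow>
        (\<forall>d\<in>D. R 1 [d, numv F (e (\<rho> i))] \<longrightarrow> sat D F R ((\<lambda>x. numv F (e x))(z := d)) \<phi>)"
      using z[of i] by (simp add: leq_def)
    also have "\<dots> \<longleftrightarrow> (\<forall>v\<le>e (\<rho> i). sat D F R ((\<lambda>x. numv F (e x))(z := numv F v)) \<phi>)"
      using le_numD le_num_iff num_dom by metis
    finally show ?thesis unfolding 1 .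
  qed
  moreover have "fm_in L_R ?\<psi>" using \<phi>(1) by (simp add: leq_def L_R_def)
  moreover have "fv ?\<psi> \<subseteq> range \<rho>" using \<phi>(2) by (auto simp: leq_def)
  ultimately show ?case by blast
qed

text \<open>Only the matrix is represented, with the witness in variable \<open>w\<close>, because
  Rosser's comparison needs access to the witnesses.\<close>

lemma sigma1_formula:
  assumes A: "sigma1 (\<lambda>e. e 0 \<in> A)" and w: "w \<noteq> 0"
  obtains \<alpha> Q where "fm_in L_R \<alpha>" "fv \<alpha> \<subseteq> {0, w}" "\<And>n. n \<in> A \<longleftrightarrow> (\<exists>v. Q n v)"
    "\<And>(D :: 'a set) F R n v e. \<lbrakk>model D F R (snd R_thy); e 0 = numv F n; e w = numv F v\<rbrakk> \<Longrightarrow>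
      sat D F R e \<alpha> \<longleftrightarrow> Q n v"
proof -
  obtain P where P: "delta0 P" "\<And>e. e 0 \<in> A \<longleftrightarrow> (\<exists>v. P (case_nat v e))" using A by (auto simp: sigma1_def)
  \<comment> \<open>Index 0, the witness, goes to \<open>w\<close>. The matrix may read any further
    index; all of these are identified with variable 0, since membership can be evaluated at a
    constant assignment.\<close>
  define \<rho> where "\<rho> = case_nat w (\<lambda>_. 0)"
  have \<rho>: "range \<rho> \<subseteq> {0, w}" by (auto simp: \<rho>_def split: nat.splits)
  then have "finite (range \<rho>)" by (rule finite_subset) simp
  from delta0_formula[OF P(1) this] obtain \<alpha> where \<alpha>: "fm_in L_R \<alpha>" "fv \<alpha> \<subseteq> range \<rho>"
    "\<And>(D :: 'a set) F R e. model D F R (snd R_thy) \<Longrightarrow>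
      sat D F R (\<lambda>x. numv F (e x)) \<alpha> \<longleftrightarrow> P (\<lambda>i. e (\<rho> i))" by blast
  have fv: "fv \<alpha> \<subseteq> {0, w}" using \<alpha>(2) \<rho> by (rule order_trans)
  show thesis
  proof (rule that[of \<alpha> "\<lambda>n v. P (case_nat v (\<lambda>_. n))", OF \<alpha>(1) fv])
    show "n \<in> A \<longleftrightarrow> (\<exists>v. P (case_nat v (\<lambda>_. n)))" for n using P(2)[of "\<lambda>_. n"] by simp
    fix D :: "'a set" and F R n v e
    assume M: "model D F R (snd R_thy)" and e: "e 0 = numv F n" "e w = numv F v"
    define e' where "e' = (\<lambda>_ :: nat. n)(w := v)"
    have "sat D F R e \<alpha> \<longleftrightarrow> sat D F R (\<lambda>x. numv F (e' x)) \<alpha>"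
      using fv e w by (intro sat_cong) (auto simp: e'_def)
    also have "\<dots> \<longleftrightarrow> P (\<lambda>i. e' (\<rho> i))" by (rule \<alpha>(3)[OF M])
    also have "(\<lambda>i. e' (\<rho> i)) = case_nat v (\<lambda>_. n)"
      using w by (auto simp: e'_def \<rho>_def fun_eq_iff split: nat.splits)
    finally show "sat D F R e \<alpha> \<longleftrightarrow> P (case_nat v (\<lambda>_. n))" .
  qed
qed

text \<open>Rosser's trick: \<open>x\<close> is put on the side of \<open>A\<close> if a witness for \<open>x \<in> A\<close> appears before
  any witness for \<open>x \<in> B\<close>.\<close>

lemma separating_formula:
  assumes "re_set A" "re_set B" and AB: "A \<inter> B = {}"
  obtains \<sigma> where "fm_in L_R \<sigma>" "fv \<sigma> \<subseteq> {0}"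
    "\<And>(D :: 'a set) F R n. model D F R (snd R_thy) \<Longrightarrow> n \<in> A \<Longrightarrow> sat D F R (asg [numv F n]) \<sigma>"
    "\<And>(D :: 'a set) F R n. model D F R (snd R_thy) \<Longrightarrow> n \<in> B \<Longrightarrow> \<not> sat D F R (asg [numv F n]) \<sigma>"
proof -
  obtain \<alpha> P where \<alpha>: "fm_in L_R \<alpha>" "fv \<alpha> \<subseteq> {0, 1}" "\<And>n. n \<in> A \<longleftrightarrow> (\<exists>v. P n v)"
    "\<And>(D :: 'a set) F R n v e. \<lbrakk>model D F R (snd R_thy); e 0 = numv F n; e 1 = numv F v\<rbrakk> \<Longrightarrow>
      sat D F R e \<alpha> \<longleftrightarrow> P n v"
    by (rule sigma1_formula[OF re_set_sigma1[OF assms(1)], of 1]) auto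
  obtain \<beta> Q where \<beta>: "fm_in L_R \<beta>" "fv \<beta> \<subseteq> {0, 2}" "\<And>n. n \<in> B \<longleftrightarrow> (\<exists>v. Q n v)"
    "\<And>(D :: 'a set) F R n v e. \<lbrakk>model D F R (snd R_thy); e 0 = numv F n; e 2 = numv F v\<rbrakk> \<Longrightarrow>
      sat D F R e \<beta> \<longleftrightarrow> Q n v"
    by (rule sigma1_formula[OF re_set_sigma1[OF assms(2)], of 2]) auto
  let ?\<sigma> = "Ex 1 (And \<alpha> (All 2 (Imp (leq (Var 2) (Var 1)) (Neg \<beta>))))"
  have sat: "sat D F R e ?\<sigma> \<longleftrightarrow> (\<exists>a\<in>D. sat D F R (e(1 := a)) \<alpha> \<and>
      (\<forall>b\<in>D. R 1 [b, a] \<longrightarrow> \<not> sat D F R (e(1 := a, 2 := b)) \<beta>))" for D :: "'a set" and F R e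
    by (simp add: leq_def)
  show thesis
  proof (rule that[of ?\<sigma>])
    show "fm_in L_R ?\<sigma>" using \<alpha>(1) \<beta>(1) by (simp add: leq_def L_R_def)
    show "fv ?\<sigma> \<subseteq> {0}" using \<alpha>(2) \<beta>(2) by (auto simp: leq_def)
    fix D :: "'a set" and F R n assume M: "model D F R (snd R_thy)"
    interpret R_structure D F R "numv F" by (rule R_model_structure[OF M])
    let ?e = "asg [numv F n]"
    have e0: "?e 0 = numv F n" by (simp add: asg_def)
    show "sat D F R ?e ?\<sigma>" if "n \<in> A"
    proof -
      obtain v where v: "P n v" using \<alpha>(3) \<open>n \<in> A\<close> by blast
      have "sat D F R (?e(1 := numv F v)) \<alpha>" using \<alpha>(4)[OF M, of _ n v] v e0 by simp
      \<comment> \<open>Everything below the standard witness is a numeral, and no numeral witnesses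
        membership in \<open>B\<close>.\<close>
      moreover have "\<not> sat D F R (?e(1 := numv F v, 2 := b)) \<beta>" if b: "b \<in> D" "R 1 [b, numv F v]" for b
      proof -
        obtain w where "b = numv F w" using le_numD[OF b(2,1)] by blast
        then have "sat D F R (?e(1 := numv F v, 2 := b)) \<beta> \<longleftrightarrow> Q n w"
          using \<beta>(4)[OF M, of _ n w] e0 by simp
        then show ?thesis using \<beta>(3)[of n] \<open>n \<in> A\<close> AB by blast
      qed
      ultimately show ?thesis unfolding sat using num_dom by blast
    qed
    show "\<not> sat D F R ?e ?\<sigma>" if "n \<in> B"
    proof
      obtain w where w: "Q n w" using \<beta>(3) \<open>n \<in> B\<close> by blast
      assume "sat D F R ?e ?\<sigma>"
      then obtain a where a: "a \<in> D" "sat D F R (?e(1 := a)) \<alpha>"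
        "\<And>b. b \<in> D \<Longrightarrow> R 1 [b, a] \<Longrightarrow> \<not> sat D F R (?e(1 := a, 2 := b)) \<beta>" unfolding sat by blast
      \<comment> \<open>\<open>a\<close> may be nonstandard. If it is below the standard witness
        \<open>w\<close>, it is a numeral witnessing membership in \<open>A\<close>; if it is above,
        \<open>w\<close> is itself a forbidden witness below \<open>a\<close>.\<close>
      from le_total_num[OF a(1), of w] show False
      proof
        assume "R 1 [a, numv F w]"
        then obtain v where "a = numv F v" using le_numD a(1) by blast
        then have "P n v" using \<alpha>(4)[OF M, of "?e(1 := a)" n v] a(2) e0 by simp
        then show False using \<alpha>(3)[of n] \<open>n \<in> B\<close> AB by blast
      next
        assume "R 1 [numv F w, a]"
        then show False using a(3)[OF num_dom] \<beta>(4)[OF M, of "?e(1 := a, 2 := numv F w)" n w] w e0 by simp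
      qed
    qed
  qed
qed

lemma wf_U: "wf_thy (U_thy A B)"
proof -
  have "trm_in L_U (num n)" for n by (induction n) (auto simp: L_U_def)
  then show ?thesis by (auto simp: wf_thy_def U_thy_def sentences_def) (auto simp: L_U_def)
qed

lemma R_completeness:
  "(\<And>(D :: trm set) F R e. model D F R (snd R_thy) \<Longrightarrow> range e \<subseteq> D \<Longrightarrow> sat D F R e \<phi>) \<Longrightarrow> prv (snd R_thy) \<phi>"
  using wf_R by (intro completeness) (auto simp: wf_thy_def sentences_def)

theorem U_interpretable_R:
  assumes "re_set A" "re_set B" "A \<inter> B = {}"
  shows "interpretable (U_thy A B) R_thy"
proof -
  obtain \<sigma> where \<sigma>: "fm_in L_R \<sigma>" "fv \<sigma> \<subseteq> {0}"
    "\<And>(D :: trm set) F R n. model D F R (snd R_thy) \<Longrightarrow> n \<in> A \<Longrightarrow> sat D F R (asg [numv F n]) \<sigma>"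
    "\<And>(D :: trm set) F R n. model D F R (snd R_thy) \<Longrightarrow> n \<in> B \<Longrightarrow> \<not> sat D F R (asg [numv F n]) \<sigma>"
    by (rule separating_formula[OF assms, where 'a = trm]) blast
  \<comment> \<open>Domain, zero and successor are kept; the separating formula interprets the
    predicate.\<close>
  define I :: interp where "I = (Top, \<lambda>_. \<sigma>, \<lambda>(f, n). if f = 0 then Eq (Var 0) (num 0) else Eq (Var 1) (Fn 1 [Var 0]))"
  have I: "idom I = Top" "irel I r = \<sigma>" "ifun I (0, n) = Eq (Var 0) (num 0)" "ifun I (1, n) = Eq (Var 1) (Fn 1 [Var 0])"
    "ifun I (Suc 0, n) = Eq (Var 1) (Fn 1 [Var 0])" for r n
    by (simp_all add: I_def idom_def irel_def ifun_def)
  have dom: "int_dom D F R I = D" for D :: "trm set" and F R by (auto simp: int_dom_def I)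
  have int: "interpretation_in D F R I L_U" if M: "model D F R (snd R_thy)" for D :: "trm set" and F R
  proof
    interpret R_structure D F R "numv F" by (rule R_model_structure[OF M])
    fix f xs assume fx: "(f, length xs) \<in> fsyms L_U" "set xs \<subseteq> int_dom D F R I"
    then consider "f = 0" "xs = []" | x where "f = 1" "xs = [x]" "x \<in> D"
      by (auto simp: L_U_def dom length_Suc_conv)
    then show "\<exists>!y. y \<in> int_dom D F R I \<and> sat D F R (asg (xs @ [y])) (ifun I (f, length xs))"
    proof cases
      case 1
      then show ?thesis using num_dom[of 0] num_simps(1) by (auto simp: dom I asg_def)
    next
      case 2
      moreover have "F 1 [x] \<in> D" using M 2 by (auto simp: model_def)
      ultimately show ?thesis by (auto simp: dom I asg_def)
    qed
  qed (use M \<sigma>(2) in \<open>auto simp: I L_U_def dom model_def\<close>)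
  have tr: "prv (snd R_thy) (tr I \<phi>)" if \<phi>: "\<phi> \<in> snd (U_thy A B)" for \<phi>
  proof (rule R_completeness)
    fix D :: "trm set" and F R and e :: "nat \<Rightarrow> trm" assume M: "model D F R (snd R_thy)" and e: "range e \<subseteq> D"
    interpret R_structure D F R "numv F" by (rule R_model_structure[OF M])
    interpret interpretation_in D F R I L_U by (rule int[OF M])
    have iF: "iF 0 [] = F 0 []" "d \<in> D \<Longrightarrow> iF 1 [d] = F 1 [d]" for d
    proof -
      show "iF 0 [] = F 0 []"
        using int_fun_spec(2)[of 0 "[]" "F 0 []"] num_dom[of 0] num_simps(1) by (simp add: L_U_def dom I asg_def)
      show "iF 1 [d] = F 1 [d]" if "d \<in> D"
        using int_fun_spec(2)[of 1 "[d]" "F 1 [d]"] M that by (simp add: L_U_def dom I asg_def model_def)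
    qed
    have n: "val iF e (num n) = numv F n" for n
    proof (induction n)
      case (Suc n)
      then show ?case using iF(2)[OF num_dom, of n] num_simps(2) by simp
    qed (use iF(1) num_simps(1) in simp)
    have \<phi>': "fm_in L_U \<phi>" "fv \<phi> = {}" using wf_U[of A B] \<phi> by (auto simp: wf_thy_def sentences_def U_thy_def)
    have "sat iD iF iR e \<phi>"
      using \<phi> \<sigma>(3,4)[OF M] inj_eq[OF inj_num] by (auto simp: U_thy_def n int_rel_def I)
    then show "sat D F R e (tr I \<phi>)" using sat_tr[OF \<phi>'(1) e] \<phi>'(2) by simp
  qed
  have fo: "prv (snd R_thy) (fun_ok I fn)" if "fn \<in> fsyms L_U" for fn
  proof (rule R_completeness)
    fix D :: "trm set" and F R and e :: "nat \<Rightarrow> trm" assume M: "model D F R (snd R_thy)" and e: "range e \<subseteq> D"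
    interpret R_structure D F R "numv F" by (rule R_model_structure[OF M])
    have F: "F 0 [] \<in> D" "d \<in> D \<Longrightarrow> F (Suc 0) [d] \<in> D" for d using M by (auto simp: model_def)
    have i: "sat D F R e (inst Top vs)" for e vs by (simp add: sat_inst)
    from that show "sat D F R e (fun_ok I fn)"
      using F by (auto simp: L_U_def fun_ok_def Let_def alls_def conjs_def I i sat_inst asg_def)
  qed
  have "prv (snd R_thy) (Ex 0 Top)" by (rule R_completeness) (auto simp: model_def)
  then have "is_interpretation I (U_thy A B) R_thy"
    unfolding is_interpretation_def using tr fo \<sigma>(1,2)
    by (auto simp: U_thy_def R_thy_def I) (auto simp: L_U_def I L_R_def)
  then show ?thesis unfolding interpretable_def by blast
qed

section \<open>Provability is recursively enumerable\<close>

lemma enc_list_inj: "enc_list xs = enc_list ys \<longleftrightarrow> xs = ys"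
proof (induction xs arbitrary: ys)
  case Nil
  show ?case by (cases ys) auto
next
  case (Cons x xs)
  then show ?case by (cases ys) auto
qed

lemma enc_trm_inj: "enc_trm s = enc_trm t \<longleftrightarrow> s = t"
proof (induction s arbitrary: t)
  case (Var x)
  show ?case by (cases t) auto
next
  case (Fn f ss)
  show ?case
  proof (cases t)
    case (Fn g ts)
    have "map enc_trm ss = map enc_trm ts \<longleftrightarrow> ss = ts"
      using Fn.IH by (auto simp: list_eq_iff_nth_eq)
    then show ?thesis using Fn by (simp add: enc_list_inj)
  qed auto
qed

lemma map_enc_trm_inj: "map enc_trm ss = map enc_trm ts \<longleftrightarrow> ss = ts"
  by (rule inj_map_eq_map) (simp add: inj_def enc_trm_inj)

lemma enc_fm_inj: "enc_fm \<phi> = enc_fm \<psi> \<longleftrightarrow> \<phi> = \<psi>"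
proof (induction \<phi> arbitrary: \<psi>)
  case Bot
  show ?case by (cases \<psi>) auto
next
  case (Eq s t)
  show ?case by (cases \<psi>) (auto simp: enc_trm_inj)
next
  case (Rel r ts)
  show ?case by (cases \<psi>) (auto simp: enc_list_inj map_enc_trm_inj)
next
  case (Imp \<phi>1 \<phi>2)
  then show ?case by (cases \<psi>) auto
next
  case (All x \<phi>)
  then show ?case by (cases \<psi>) auto
qed

section \<open>Syntactic operations on codes\<close>

abbreviation "pr a b \<equiv> prod_encode (a, b)"
abbreviation "cCons a l \<equiv> Suc (pr a l)"
abbreviation "cVar x \<equiv> pr 0 x"
abbreviation "cFn f l \<equiv> pr 1 (pr f l)"
abbreviation "cBot \<equiv> pr 0 0"
abbreviation "cEq s t \<equiv> pr 1 (pr s t)"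
abbreviation "cRel r l \<equiv> pr 2 (pr r l)"
abbreviation "cImp a b \<equiv> pr 3 (pr a b)"
abbreviation "cAll x a \<equiv> pr 4 (pr x a)"
abbreviation "cNeg a \<equiv> cImp a cBot"
abbreviation "cAnd a b \<equiv> cNeg (cImp a (cNeg b))"
abbreviation "cEx x a \<equiv> cNeg (cAll x (cNeg a))"
abbreviation "tuple3 a b c \<equiv> pr a (pr b c)"
abbreviation "tuple4 a b c d \<equiv> pr a (pr b (pr c d))"

text \<open>Alpha-equivalence and freeness are tested on codes by comparing normal forms, which involve
  only substitutions with finitely many deviations from \<open>dbl\<close>.\<close>

fun alist_subst :: "(nat \<times> trm) list \<Rightarrow> nat \<Rightarrow> trm" where
  "alist_subst [] = dbl"
| "alist_subst ((x, t) # ps) = (alist_subst ps)(x := t)"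

fun enc_alist :: "(nat \<times> trm) list \<Rightarrow> nat" where
  "enc_alist [] = 0"
| "enc_alist ((x, t) # ps) = cCons (pr x (enc_trm t)) (enc_alist ps)"

text \<open>The relation is generated as a set of codes of triples, the form that \<open>clo\<close>
  can handle. Doubling is written \<open>x + x\<close> to fit the closure rules for Sigma-1
  functions.\<close>

definition lookup_code :: "nat \<Rightarrow> nat \<Rightarrow> nat \<Rightarrow> bool" where
  "lookup_code l x t = clo
     (\<lambda>p. (\<exists>x. p = tuple3 0 x (cVar (x + x))) \<or> (\<exists>x t l. p = tuple3 (cCons (pr x t) l) x t))
     (\<lambda>p q q'. \<exists>y s l x t. y \<noteq> x \<and> p = tuple3 (cCons (pr y s) l) x t \<and> q = tuple3 l x t)
     (tuple3 l x t)"

lemma sigma1_lookup_code: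
  "sfun l \<Longrightarrow> sfun x \<Longrightarrow> sfun t \<Longrightarrow> sigma1 (\<lambda>e. lookup_code (l e) (x e) (t e))"
  unfolding lookup_code_def
  by (rule sigma1_rel1[OF sigma1_clo]) (intro sigma1_intros; assumption)+

lemma lookup_code_iff: "lookup_code (enc_alist ps) x t \<longleftrightarrow> t = enc_trm (alist_subst ps x)"
proof
  have "clo (\<lambda>p. (\<exists>x. p = tuple3 0 x (cVar (x + x))) \<or> (\<exists>x t l. p = tuple3 (cCons (pr x t) l) x t))
     (\<lambda>p q q'. \<exists>y s l x t. y \<noteq> x \<and> p = tuple3 (cCons (pr y s) l) x t \<and> q = tuple3 l x t) p \<Longrightarrow>
     p = tuple3 (enc_alist ps) x t \<Longrightarrow> t = enc_trm (alist_subst ps x)" for p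
  proof (induction arbitrary: ps x t rule: clo.induct)
    case (clo_base p)
    then show ?case
      by (cases ps rule: enc_alist.cases) (auto simp: dbl_def mult_2)
  next
    case (clo_step p q q')
    from clo_step.hyps(1) obtain y s l x' t' where *: "y \<noteq> x'" "p = tuple3 (cCons (pr y s) l) x' t'" "q = tuple3 l x' t'"
      by blast
    show ?case
    proof (cases ps rule: enc_alist.cases)
      case 1
      then show ?thesis using * clo_step.prems by simp
    next
      case (2 z u qs)
      then have "l = enc_alist qs" "x' = x" "t' = t" "y = z" using * clo_step.prems by auto
      then show ?thesis using clo_step.IH(1)[of qs x t] * 2 by simp
    qed
  qed
  then show "lookup_code (enc_alist ps) x t \<Longrightarrow> t = enc_trm (alist_subst ps x)"
    unfolding lookup_code_def by blast
  have "lookup_code (enc_alist ps) x (enc_trm (alist_subst ps x))"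
  proof (induction ps rule: enc_alist.induct)
    case 1
    show ?case unfolding lookup_code_def by (rule clo_base) (auto simp: dbl_def mult_2)
  next
    case (2 y s ps)
    show ?case
    proof (cases "y = x")
      case True
      then show ?thesis unfolding lookup_code_def by (intro clo_base disjI2) auto
    next
      case False
      show ?thesis unfolding lookup_code_def
        by (rule clo_step[OF _ 2[unfolded lookup_code_def] 2[unfolded lookup_code_def]]) (use False in auto)
    qed
  qed
  then show "t = enc_trm (alist_subst ps x) \<Longrightarrow> lookup_code (enc_alist ps) x t" by simp
qed

text \<open>The first component distinguishes terms (0) from lists of terms (1).\<close>

definition tsubst_code :: "nat \<Rightarrow> nat \<Rightarrow> nat \<Rightarrow> nat \<Rightarrow> bool" where
  "tsubst_code k l a b = clo
     (\<lambda>p. (\<exists>l x t. lookup_code l x t \<and> p = tuple4 0 l (cVar x) t) \<or> (\<exists>l. p = tuple4 1 l 0 0))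
     (\<lambda>p q q'. (\<exists>l f a b. p = tuple4 0 l (cFn f a) (cFn f b) \<and> q = tuple4 1 l a b) \<or>
        (\<exists>l a b as bs. p = tuple4 1 l (cCons a as) (cCons b bs) \<and> q = tuple4 0 l a b \<and> q' = tuple4 1 l as bs))
     (tuple4 k l a b)"

lemma sigma1_tsubst_code:
  "sfun k \<Longrightarrow> sfun l \<Longrightarrow> sfun a \<Longrightarrow> sfun b \<Longrightarrow> sigma1 (\<lambda>e. tsubst_code (k e) (l e) (a e) (b e))"
  unfolding tsubst_code_def
  by (rule sigma1_rel1[OF sigma1_clo]) (intro sigma1_intros sigma1_lookup_code; assumption)+

text \<open>The relation holds only for genuine codes of terms or term lists, so it serves as the
  syntax check for terms too.\<close>

lemma tsubst_code_sound:
  assumes "tsubst_code k (enc_alist ps) a b"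
  shows "(k = 0 \<longrightarrow> (\<exists>t. a = enc_trm t \<and> b = enc_trm (tsubst (alist_subst ps) t))) \<and>
    (k = 1 \<longrightarrow> (\<exists>ts. a = enc_list (map enc_trm ts) \<and> b = enc_list (map enc_trm (map (tsubst (alist_subst ps)) ts))))"
proof -
  have "clo (\<lambda>p. (\<exists>l x t. lookup_code l x t \<and> p = tuple4 0 l (cVar x) t) \<or> (\<exists>l. p = tuple4 1 l 0 0))
     (\<lambda>p q q'. (\<exists>l f a b. p = tuple4 0 l (cFn f a) (cFn f b) \<and> q = tuple4 1 l a b) \<or>
        (\<exists>l a b as bs. p = tuple4 1 l (cCons a as) (cCons b bs) \<and> q = tuple4 0 l a b \<and> q' = tuple4 1 l as bs)) p
    \<Longrightarrow> p = tuple4 k (enc_alist ps) a b \<Longrightarrow>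
    (k = 0 \<longrightarrow> (\<exists>t. a = enc_trm t \<and> b = enc_trm (tsubst (alist_subst ps) t))) \<and>
    (k = 1 \<longrightarrow> (\<exists>ts. a = enc_list (map enc_trm ts) \<and> b = enc_list (map enc_trm (map (tsubst (alist_subst ps)) ts))))" for p
  proof (induction arbitrary: k a b rule: clo.induct)
    case (clo_base p)
    from clo_base.hyps show ?case
    proof
      assume "\<exists>l x t. lookup_code l x t \<and> p = tuple4 0 l (cVar x) t"
      then obtain x where "k = 0" "a = cVar x" "b = enc_trm (alist_subst ps x)"
        using clo_base.prems by (auto simp: lookup_code_iff)
      then show ?thesis by (auto intro!: exI[of _ "Var x"])
    next
      assume "\<exists>l. p = tuple4 1 l 0 0"
      then show ?thesis using clo_base.prems by (auto intro!: exI[of _ "[]"])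
    qed
  next
    case (clo_step p q q')
    from clo_step.hyps(1) show ?case
    proof
      assume "\<exists>l f a b. p = tuple4 0 l (cFn f a) (cFn f b) \<and> q = tuple4 1 l a b"
      then obtain f as bs where *: "k = 0" "a = cFn f as" "b = cFn f bs" "q = tuple4 1 (enc_alist ps) as bs"
        using clo_step.prems by auto
      then obtain ts where "as = enc_list (map enc_trm ts)" "bs = enc_list (map enc_trm (map (tsubst (alist_subst ps)) ts))"
        using clo_step.IH(1)[of 1 as bs] by auto
      then show ?thesis using * by (auto intro!: exI[of _ "Fn f ts"])
    next
      assume "\<exists>l a b as bs. p = tuple4 1 l (cCons a as) (cCons b bs) \<and> q = tuple4 0 l a b \<and> q' = tuple4 1 l as bs"
      then obtain a' b' as bs where *: "k = 1" "a = cCons a' as" "b = cCons b' bs"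
        "q = tuple4 0 (enc_alist ps) a' b'" "q' = tuple4 1 (enc_alist ps) as bs"
        using clo_step.prems by auto
      obtain t where "a' = enc_trm t" "b' = enc_trm (tsubst (alist_subst ps) t)"
        using clo_step.IH(1)[of 0 a' b'] * by auto
      moreover obtain ts where "as = enc_list (map enc_trm ts)" "bs = enc_list (map enc_trm (map (tsubst (alist_subst ps)) ts))"
        using clo_step.IH(2)[of 1 as bs] * by auto
      ultimately show ?thesis using * by (auto intro!: exI[of _ "t # ts"])
    qed
  qed
  then show ?thesis using assms unfolding tsubst_code_def by blast
qed

lemma tsubst_code_list:
  "(\<And>t. t \<in> set ts \<Longrightarrow> tsubst_code 0 (enc_alist ps) (enc_trm t) (enc_trm (tsubst (alist_subst ps) t))) \<Longrightarrow>
    tsubst_code 1 (enc_alist ps) (enc_list (map enc_trm ts)) (enc_list (map enc_trm (map (tsubst (alist_subst ps)) ts)))"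
proof (induction ts)
  case Nil
  show ?case unfolding tsubst_code_def by (rule clo_base) simp
next
  case (Cons t ts)
  have 1: "tsubst_code 0 (enc_alist ps) (enc_trm t) (enc_trm (tsubst (alist_subst ps) t))"
    and 2: "tsubst_code 1 (enc_alist ps) (enc_list (map enc_trm ts)) (enc_list (map enc_trm (map (tsubst (alist_subst ps)) ts)))"
    using Cons by auto
  show ?case unfolding tsubst_code_def
    by (rule clo_step[OF _ 1[unfolded tsubst_code_def] 2[unfolded tsubst_code_def]]) simp
qed

lemma tsubst_code_complete:
  "tsubst_code 0 (enc_alist ps) (enc_trm t) (enc_trm (tsubst (alist_subst ps) t))"
proof (induction t)
  case (Var x)
  show ?case unfolding tsubst_code_def by (rule clo_base) (auto simp: lookup_code_iff)
next
  case (Fn f ts)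
  note 1 = tsubst_code_list[OF Fn.IH]
  show ?case unfolding tsubst_code_def
    by (rule clo_step[OF _ 1[unfolded tsubst_code_def] 1[unfolded tsubst_code_def]]) simp
qed

text \<open>The association list is a component of the generated tuples and not a fixed parameter,
  because it grows at each quantifier; \<open>Suc (d + d)\<close> is the marker for depth
  \<open>d\<close>.\<close>

definition nf_code :: "nat \<Rightarrow> nat \<Rightarrow> nat \<Rightarrow> nat \<Rightarrow> bool" where
  "nf_code d l a b = clo
     (\<lambda>p. (\<exists>d l. p = tuple4 d l cBot cBot) \<or>
        (\<exists>d l s t u v. tsubst_code 0 l s u \<and> tsubst_code 0 l t v \<and> p = tuple4 d l (cEq s t) (cEq u v)) \<or>
        (\<exists>d l r as bs. tsubst_code 1 l as bs \<and> p = tuple4 d l (cRel r as) (cRel r bs)))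
     (\<lambda>p q q'. (\<exists>d l a b a' b'. p = tuple4 d l (cImp a a') (cImp b b') \<and> q = tuple4 d l a b \<and> q' = tuple4 d l a' b') \<or>
        (\<exists>d l x a b. p = tuple4 d l (cAll x a) (cAll 0 b) \<and> q = tuple4 (Suc d) (cCons (pr x (cVar (Suc (d + d)))) l) a b))
     (tuple4 d l a b)"

lemma sigma1_nf_code:
  "sfun d \<Longrightarrow> sfun l \<Longrightarrow> sfun a \<Longrightarrow> sfun b \<Longrightarrow> sigma1 (\<lambda>e. nf_code (d e) (l e) (a e) (b e))"
  unfolding nf_code_def
  by (rule sigma1_rel1[OF sigma1_clo]) (intro sigma1_intros sigma1_tsubst_code; assumption)+

lemma nf_code_sound:
  assumes "nf_code d (enc_alist ps) a b"
  shows "\<exists>\<phi>. a = enc_fm \<phi> \<and> b = enc_fm (nf d (alist_subst ps) \<phi>)"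
proof -
  have "clo (\<lambda>p. (\<exists>d l. p = tuple4 d l cBot cBot) \<or>
        (\<exists>d l s t u v. tsubst_code 0 l s u \<and> tsubst_code 0 l t v \<and> p = tuple4 d l (cEq s t) (cEq u v)) \<or>
        (\<exists>d l r as bs. tsubst_code 1 l as bs \<and> p = tuple4 d l (cRel r as) (cRel r bs)))
     (\<lambda>p q q'. (\<exists>d l a b a' b'. p = tuple4 d l (cImp a a') (cImp b b') \<and> q = tuple4 d l a b \<and> q' = tuple4 d l a' b') \<or>
        (\<exists>d l x a b. p = tuple4 d l (cAll x a) (cAll 0 b) \<and> q = tuple4 (Suc d) (cCons (pr x (cVar (Suc (d + d)))) l) a b)) p \<Longrightarrow>
    p = tuple4 d (enc_alist ps) a b \<Longrightarrow> \<exists>\<phi>. a = enc_fm \<phi> \<and> b = enc_fm (nf d (alist_subst ps) \<phi>)" for p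
  proof (induction arbitrary: d ps a b rule: clo.induct)
    case (clo_base p)
    from clo_base.hyps show ?case
    proof (elim disjE)
      assume "\<exists>d l. p = tuple4 d l cBot cBot"
      then show ?thesis using clo_base.prems by (auto intro!: exI[of _ Bot])
    next
      assume "\<exists>d l s t u v. tsubst_code 0 l s u \<and> tsubst_code 0 l t v \<and> p = tuple4 d l (cEq s t) (cEq u v)"
      then obtain s t u v where *: "tsubst_code 0 (enc_alist ps) s u" "tsubst_code 0 (enc_alist ps) t v" "a = cEq s t" "b = cEq u v"
        using clo_base.prems by auto
      obtain s' where "s = enc_trm s'" "u = enc_trm (tsubst (alist_subst ps) s')" using tsubst_code_sound[OF *(1)] by auto
      moreover obtain t' where "t = enc_trm t'" "v = enc_trm (tsubst (alist_subst ps) t')" using tsubst_code_sound[OF *(2)] by auto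
      ultimately show ?thesis using * by (auto intro!: exI[of _ "Eq s' t'"])
    next
      assume "\<exists>d l r as bs. tsubst_code 1 l as bs \<and> p = tuple4 d l (cRel r as) (cRel r bs)"
      then obtain r as bs where *: "tsubst_code 1 (enc_alist ps) as bs" "a = cRel r as" "b = cRel r bs"
        using clo_base.prems by auto
      obtain ts where "as = enc_list (map enc_trm ts)" "bs = enc_list (map enc_trm (map (tsubst (alist_subst ps)) ts))"
        using tsubst_code_sound[OF *(1)] by auto
      then show ?thesis using * by (auto intro!: exI[of _ "Rel r ts"])
    qed
  next
    case (clo_step p q q')
    from clo_step.hyps(1) show ?case
    proof
      assume "\<exists>d l a b a' b'. p = tuple4 d l (cImp a a') (cImp b b') \<and> q = tuple4 d l a b \<and> q' = tuple4 d l a' b'"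
      then obtain a1 a2 b1 b2 where *: "a = cImp a1 a2" "b = cImp b1 b2"
        "q = tuple4 d (enc_alist ps) a1 b1" "q' = tuple4 d (enc_alist ps) a2 b2"
        using clo_step.prems by auto
      obtain \<phi>1 where "a1 = enc_fm \<phi>1" "b1 = enc_fm (nf d (alist_subst ps) \<phi>1)" using clo_step.IH(1)[OF *(3)] by blast
      moreover obtain \<phi>2 where "a2 = enc_fm \<phi>2" "b2 = enc_fm (nf d (alist_subst ps) \<phi>2)" using clo_step.IH(2)[OF *(4)] by blast
      ultimately show ?thesis using * by (auto intro!: exI[of _ "Imp \<phi>1 \<phi>2"])
    next
      assume "\<exists>d l x a b. p = tuple4 d l (cAll x a) (cAll 0 b) \<and> q = tuple4 (Suc d) (cCons (pr x (cVar (Suc (d + d)))) l) a b"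
      then obtain x a1 b1 where *: "a = cAll x a1" "b = cAll 0 b1"
        "q = tuple4 (Suc d) (enc_alist ((x, Var (Suc (d + d))) # ps)) a1 b1"
        using clo_step.prems by auto
      obtain \<phi> where "a1 = enc_fm \<phi>" "b1 = enc_fm (nf (Suc d) ((alist_subst ps)(x := Var (Suc (d + d)))) \<phi>)"
        using clo_step.IH(1)[OF *(3), unfolded alist_subst.simps] by blast
      then show ?thesis using * by (intro exI[of _ "All x \<phi>"]) (simp add: mult_2)
    qed
  qed
  then show ?thesis using assms unfolding nf_code_def by blast
qed

lemma nf_code_complete: "nf_code d (enc_alist ps) (enc_fm \<phi>) (enc_fm (nf d (alist_subst ps) \<phi>))"
proof (induction \<phi> arbitrary: d ps)
  case Bot
  show ?case unfolding nf_code_def by (rule clo_base) simp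
next
  case (Eq s t)
  show ?case unfolding nf_code_def by (rule clo_base) (auto intro: tsubst_code_complete)
next
  case (Rel r ts)
  have "tsubst_code 1 (enc_alist ps) (enc_list (map enc_trm ts)) (enc_list (map enc_trm (map (tsubst (alist_subst ps)) ts)))"
    by (rule tsubst_code_list) (rule tsubst_code_complete)
  then show ?case unfolding nf_code_def by (intro clo_base disjI2) auto
next
  case (Imp \<phi> \<psi>)
  show ?case unfolding nf_code_def
    by (rule clo_step[OF _ Imp.IH(1)[unfolded nf_code_def] Imp.IH(2)[unfolded nf_code_def]]) simp
next
  case (All x \<phi>)
  note 1 = All.IH[of "Suc d" "(x, Var (Suc (d + d))) # ps"]
  show ?case unfolding nf_code_def
    by (rule clo_step[OF _ 1[unfolded nf_code_def] 1[unfolded nf_code_def]]) (simp add: mult_2)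
qed

lemma nf_code_iff:
  "nf_code d (enc_alist ps) a b \<longleftrightarrow> (\<exists>\<phi>. a = enc_fm \<phi> \<and> b = enc_fm (nf d (alist_subst ps) \<phi>))"
  using nf_code_sound nf_code_complete by blast

lemma nf_code_iffs:
  "nf_code d 0 a b \<longleftrightarrow> (\<exists>\<phi>. a = enc_fm \<phi> \<and> b = enc_fm (nf d dbl \<phi>))"
  "nf_code d (cCons (pr x (enc_trm t)) 0) a b \<longleftrightarrow> (\<exists>\<phi>. a = enc_fm \<phi> \<and> b = enc_fm (nf d (dbl(x := t)) \<phi>))"
  using nf_code_iff[of d "[]"] nf_code_iff[of d "[(x, t)]"] by simp_all

lemma tsubst_code_iff:
  "tsubst_code 0 0 a b \<longleftrightarrow> (\<exists>t. a = enc_trm t \<and> b = enc_trm (tsubst dbl t))"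
  using tsubst_code_sound[of 0 "[]" a b] tsubst_code_complete[of "[]"] by auto

text \<open>Normalization is defined for every formula and for no other number, so having a normal
  form is the syntax check.\<close>

definition fm_code :: "nat \<Rightarrow> bool" where
  "fm_code a \<longleftrightarrow> (\<exists>b. nf_code 0 0 a b)"

lemma fm_code_iff: "fm_code a \<longleftrightarrow> (\<exists>\<phi>. a = enc_fm \<phi>)"
  by (auto simp: fm_code_def nf_code_iffs)

lemma sigma1_fm_code: "sfun a \<Longrightarrow> sigma1 (\<lambda>e. fm_code (a e))"
  unfolding fm_code_def by (intro sigma1_ex sigma1_nf_code sfun_const sfun_var) (rule sfun_reindex)

text \<open>Where a scheme substitutes, any formula with the same normal form as the instance is
  accepted. For vacuous quantification, sending \<open>x\<close> to the odd variable 1, a value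
  \<open>dbl\<close> never takes, must leave the normal form unchanged; this says that
  \<open>x\<close> is not free.\<close>

definition axiom_code :: "nat \<Rightarrow> bool" where
  "axiom_code p \<longleftrightarrow>
    (\<exists>a b. fm_code a \<and> fm_code b \<and> p = cImp a (cImp b a)) \<or>
    (\<exists>a b c. fm_code a \<and> fm_code b \<and> fm_code c \<and>
       p = cImp (cImp a (cImp b c)) (cImp (cImp a b) (cImp a c))) \<or>
    (\<exists>a. fm_code a \<and> p = cImp (cNeg (cNeg a)) a) \<or>
    (\<exists>x a b t u c. tsubst_code 0 0 t u \<and> nf_code 0 0 b c \<and> nf_code 0 (cCons (pr x u) 0) a c \<and>
       p = cImp (cAll x a) b) \<or>
    (\<exists>x a c. nf_code 0 0 a c \<and> nf_code 0 (cCons (pr x (cVar 1)) 0) a c \<and> p = cImp a (cAll x a)) \<or>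
    (\<exists>x a b. fm_code a \<and> fm_code b \<and> p = cImp (cAll x (cImp a b)) (cImp (cAll x a) (cAll x b))) \<or>
    (\<exists>t u. tsubst_code 0 0 t u \<and> p = cEq t t) \<or>
    (\<exists>s t u v x a b c b' c'. tsubst_code 0 0 s u \<and> tsubst_code 0 0 t v \<and>
       nf_code 0 0 b b' \<and> nf_code 0 (cCons (pr x u) 0) a b' \<and>
       nf_code 0 0 c c' \<and> nf_code 0 (cCons (pr x v) 0) a c' \<and>
       p = cImp (cEq s t) (cImp b c))"

lemma sigma1_axiom_code: "sigma1 (\<lambda>e. axiom_code (e 0))"
  unfolding axiom_code_def
  by (intro sigma1_intros sigma1_fm_code sigma1_nf_code sigma1_tsubst_code)

lemma enc_fm_Neg [simp]: "enc_fm (Neg \<phi>) = cNeg (enc_fm \<phi>)"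
  by (simp add: Neg_def)

text \<open>Some accepted codes belong to alpha-variants that are no axioms;
  \<open>alpha_prv\<close> shows that these are provable all the same.\<close>

lemma axiom_code_sound:
  assumes "axiom_code p"
  shows "\<exists>\<phi>. p = enc_fm \<phi> \<and> prv T \<phi>"
  using assms unfolding axiom_code_def
proof (elim disjE)
  assume "\<exists>a b. fm_code a \<and> fm_code b \<and> p = cImp a (cImp b a)"
  then obtain \<phi> \<psi> where "p = enc_fm (Imp \<phi> (Imp \<psi> \<phi>))" by (auto simp: fm_code_iff)
  then show ?thesis using prv_K by blast
next
  assume "\<exists>a b c. fm_code a \<and> fm_code b \<and> fm_code c \<and>
       p = cImp (cImp a (cImp b c)) (cImp (cImp a b) (cImp a c))"
  then obtain \<phi> \<psi> \<chi> where "p = enc_fm (Imp (Imp \<phi> (Imp \<psi> \<chi>)) (Imp (Imp \<phi> \<psi>) (Imp \<phi> \<chi>)))" by (auto simp: fm_code_iff)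
  then show ?thesis using prv_S by blast
next
  assume "\<exists>a. fm_code a \<and> p = cImp (cNeg (cNeg a)) a"
  then obtain \<phi> where "p = enc_fm (Imp (Neg (Neg \<phi>)) \<phi>)" by (auto simp: fm_code_iff)
  then show ?thesis using prv_DN by blast
next
  assume "\<exists>x a b t u c. tsubst_code 0 0 t u \<and> nf_code 0 0 b c \<and> nf_code 0 (cCons (pr x u) 0) a c \<and>
       p = cImp (cAll x a) b"
  then obtain x t \<phi> \<psi> where *: "p = enc_fm (Imp (All x \<phi>) \<psi>)" "nf 0 dbl \<psi> = nf 0 (dbl(x := tsubst dbl t)) \<phi>"
    by (auto simp: tsubst_code_iff nf_code_iffs enc_fm_inj simp del: fun_upd_apply)
  have "prv T (Imp (ssubst (Var(x := t)) \<phi>) \<psi>)" by (rule alpha_prv) (simp only: nf_ssubst1 *(2))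
  then show ?thesis using * prv_inst prv_imp_trans by blast
next
  assume "\<exists>x a c. nf_code 0 0 a c \<and> nf_code 0 (cCons (pr x (cVar 1)) 0) a c \<and> p = cImp a (cAll x a)"
  then obtain x a c where *: "nf_code 0 0 a c" "nf_code 0 (cCons (pr x (enc_trm (Var 1))) 0) a c" "p = cImp a (cAll x a)"
    by auto
  then obtain \<phi> where p: "p = enc_fm (Imp \<phi> (All x \<phi>))" and "nf 0 dbl \<phi> = nf 0 (dbl(x := Var 1)) \<phi>"
    unfolding nf_code_iffs by (auto simp: enc_fm_inj simp del: fun_upd_apply)
  then have fv: "\<forall>y\<in>fv \<phi>. dbl y = (dbl(x := Var 1)) y" by (simp only: nf_eq_iff)
  have "x \<notin> fv \<phi>"
  proof
    assume "x \<in> fv \<phi>"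
    with fv have "2 * x = 1" by (auto simp: dbl_def)
    then show False by presburger
  qed
  then show ?thesis using p prv_vac by blast
next
  assume "\<exists>x a b. fm_code a \<and> fm_code b \<and> p = cImp (cAll x (cImp a b)) (cImp (cAll x a) (cAll x b))"
  then obtain x \<phi> \<psi> where "p = enc_fm (Imp (All x (Imp \<phi> \<psi>)) (Imp (All x \<phi>) (All x \<psi>)))" by (auto simp: fm_code_iff)
  then show ?thesis using prv_dist by blast
next
  assume "\<exists>t u. tsubst_code 0 0 t u \<and> p = cEq t t"
  then obtain t where "p = enc_fm (Eq t t)" by (auto simp: tsubst_code_iff)
  then show ?thesis using prv_refl by blast
next
  assume "\<exists>s t u v x a b c b' c'. tsubst_code 0 0 s u \<and> tsubst_code 0 0 t v \<and>
       nf_code 0 0 b b' \<and> nf_code 0 (cCons (pr x u) 0) a b' \<and>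
       nf_code 0 0 c c' \<and> nf_code 0 (cCons (pr x v) 0) a c' \<and>
       p = cImp (cEq s t) (cImp b c)"
  then obtain s t x \<phi> \<psi> \<chi> where *: "p = enc_fm (Imp (Eq s t) (Imp \<psi> \<chi>))"
    "nf 0 dbl \<psi> = nf 0 (dbl(x := tsubst dbl s)) \<phi>" "nf 0 dbl \<chi> = nf 0 (dbl(x := tsubst dbl t)) \<phi>"
    by (auto simp: tsubst_code_iff nf_code_iffs enc_fm_inj simp del: fun_upd_apply)
  have "prv T (Imp \<psi> (ssubst (Var(x := s)) \<phi>))" "prv T (Imp (ssubst (Var(x := t)) \<phi>) \<chi>)"
    by (rule alpha_prv, simp only: nf_ssubst1 *)+
  then have "loc T {\<psi>, Eq s t} \<chi>"
    using prv_leib[of T s t x \<phi>] by (meson insertI1 insertI2 loc.intros)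
  then have "prv T (Imp (Eq s t) (Imp \<psi> \<chi>))" by (meson loc_ded loc_empty)
  then show ?thesis using * by blast
qed

text \<open>In modus ponens \<open>q\<close> is the implication and \<open>q'\<close> its premise;
  generalization uses \<open>q\<close> alone. That the result codes a formula is inherited from the
  premises.\<close>

definition prv_code :: "fm set \<Rightarrow> nat \<Rightarrow> bool" where
  "prv_code T = clo (\<lambda>p. p \<in> enc_fm ` T \<or> axiom_code p)
     (\<lambda>p q q'. q = cImp q' p \<or> (\<exists>x. p = cAll x q))"

lemma sigma1_prv_code:
  assumes "sigma1 (\<lambda>e. e 0 \<in> enc_fm ` T)" "sfun t"
  shows "sigma1 (\<lambda>e. prv_code T (t e))"
  unfolding prv_code_def
  by (rule sigma1_rel1[OF sigma1_clo assms(2)]) (intro sigma1_intros sigma1_axiom_code assms(1))+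

lemma prv_code_iff: "prv_code T p \<longleftrightarrow> (\<exists>\<phi>. p = enc_fm \<phi> \<and> prv T \<phi>)"
proof
  assume "prv_code T p"
  then show "\<exists>\<phi>. p = enc_fm \<phi> \<and> prv T \<phi>" unfolding prv_code_def
  proof (induction rule: clo.induct)
    case (clo_base p)
    then show ?case using axiom_code_sound prv_ax by blast
  next
    case (clo_step p q q')
    then obtain \<phi> \<psi> where *: "q = enc_fm \<phi>" "prv T \<phi>" "q' = enc_fm \<psi>" "prv T \<psi>" by blast
    from clo_step.hyps(1) show ?case
    proof
      assume "q = cImp q' p"
      then obtain \<chi> where "\<phi> = Imp \<psi> \<chi>" "p = enc_fm \<chi>"
        using * by (cases \<phi>) (auto simp: enc_fm_inj)
      then show ?thesis using * prv_MP by blast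
    next
      assume "\<exists>x. p = cAll x q"
      then obtain x where "p = enc_fm (All x \<phi>)" using * by auto
      then show ?thesis using * prv_Gen by blast
    qed
  qed
next
  have ax: "prv_code T p" if "axiom_code p" for T p using that unfolding prv_code_def by (intro clo_base) simp
  have f: "fm_code (enc_fm \<phi>)" for \<phi> by (auto simp: fm_code_iff)
  have n: "nf_code 0 0 (enc_fm \<phi>) (enc_fm (nf 0 dbl \<phi>))" for \<phi> by (auto simp: nf_code_iffs)
  have t: "tsubst_code 0 0 (enc_trm t) (enc_trm (tsubst dbl t))" for t by (auto simp: tsubst_code_iff)
  have s: "nf_code 0 (cCons (pr x (enc_trm (tsubst dbl t))) 0) (enc_fm \<phi>) (enc_fm (nf 0 dbl (ssubst (Var(x := t)) \<phi>)))" for x t \<phi>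
    unfolding nf_code_iffs nf_ssubst1 by blast
  assume "\<exists>\<phi>. p = enc_fm \<phi> \<and> prv T \<phi>"
  then obtain \<phi> where \<phi>: "p = enc_fm \<phi>" "prv T \<phi>" by blast
  from \<phi>(2) have "prv_code T (enc_fm \<phi>)"
  proof (induction rule: prv.induct)
    case (prv_ax \<phi> T)
    then show ?case unfolding prv_code_def by (intro clo_base) simp
  next
    case (prv_K T \<phi> \<psi>)
    show ?case by (rule ax) (unfold axiom_code_def, rule disjI1, auto intro: f)
  next
    case (prv_S T \<phi> \<psi> \<chi>)
    show ?case by (rule ax) (unfold axiom_code_def, rule disjI2, rule disjI1, auto intro: f)
  next
    case (prv_DN T \<phi>)
    show ?case by (rule ax) (unfold axiom_code_def, rule disjI2, rule disjI2, rule disjI1, auto intro: f)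
  next
    case (prv_inst T x \<phi> t)
    show ?case
      by (rule ax) (unfold axiom_code_def enc_fm.simps, rule disjI2, rule disjI2, rule disjI2, rule disjI1,
        intro exI conjI, rule t, rule n, rule s, rule refl)
  next
    case (prv_vac x \<phi> T)
    have "nf 0 dbl \<phi> = nf 0 (dbl(x := Var 1)) \<phi>" using prv_vac by (auto simp: nf_eq_iff)
    then have v: "nf_code 0 (cCons (pr x (cVar 1)) 0) (enc_fm \<phi>) (enc_fm (nf 0 dbl \<phi>))"
      using nf_code_iffs(2)[of 0 x "Var 1"] by auto
    show ?case
      by (rule ax) (unfold axiom_code_def enc_fm.simps, rule disjI2, rule disjI2, rule disjI2, rule disjI2, rule disjI1,
        intro exI conjI, rule n, rule v, rule refl)
  next
    case (prv_dist T x \<phi> \<psi>)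
    show ?case
      by (rule ax) (unfold axiom_code_def enc_fm.simps, rule disjI2, rule disjI2, rule disjI2, rule disjI2, rule disjI2, rule disjI1,
        intro exI conjI, rule f, rule f, rule refl)
  next
    case (prv_refl T u)
    show ?case
      by (rule ax) (unfold axiom_code_def enc_fm.simps, rule disjI2, rule disjI2, rule disjI2, rule disjI2, rule disjI2, rule disjI2,
        rule disjI1, intro exI conjI, rule t, rule refl)
  next
    case (prv_leib T u v x \<phi>)
    show ?case
      by (rule ax) (unfold axiom_code_def enc_fm.simps, rule disjI2, rule disjI2, rule disjI2, rule disjI2, rule disjI2, rule disjI2,
        rule disjI2, intro exI conjI, rule t, rule t, rule n, rule s, rule n, rule s, rule refl)
  next
    case (prv_MP T \<phi> \<psi>)
    show ?case unfolding prv_code_def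
      by (rule clo_step[OF _ prv_MP.IH[unfolded prv_code_def]]) simp
  next
    case (prv_Gen T \<phi> x)
    show ?case unfolding prv_code_def
      by (rule clo_step[OF _ prv_Gen.IH[unfolded prv_code_def] prv_Gen.IH[unfolded prv_code_def]]) simp
  qed
  then show "prv_code T p" by (simp add: \<phi>)
qed

lemma sfun_funpow:
  assumes g: "sfun (\<lambda>e. g (e 0))" and t: "sfun t"
  shows "sfun (\<lambda>e. (g ^^ t e) c)"
proof -
  have "y = (g ^^ n) c \<longleftrightarrow> (\<exists>s. s 0 = c \<and> (\<forall>i<n. s (Suc i) = g (s i)) \<and> y = s n)" for y n
  proof
    assume "y = (g ^^ n) c"
    then show "\<exists>s. s 0 = c \<and> (\<forall>i<n. s (Suc i) = g (s i)) \<and> y = s n"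
      by (intro exI[of _ "\<lambda>i. (g ^^ i) c"]) simp
  next
    assume "\<exists>s. s 0 = c \<and> (\<forall>i<n. s (Suc i) = g (s i)) \<and> y = s n"
    then obtain s where s: "s 0 = c" "\<And>i. i < n \<Longrightarrow> s (Suc i) = g (s i)" "y = s n" by blast
    have "i \<le> n \<Longrightarrow> s i = (g ^^ i) c" for i by (induction i) (use s in auto)
    then show "y = (g ^^ n) c" using s(3) by simp
  qed
  also have "\<dots> y n \<longleftrightarrow> (\<exists>b d. beta b d 0 = c \<and> (\<forall>i<n. beta b d (Suc i) = g (beta b d i)) \<and> y = beta b d n)" for y n
    by (rule ex_beta_iff[of n]) simp
  finally have eq: "y = (g ^^ n) c \<longleftrightarrow> (\<exists>b d. beta b d 0 = c \<and> (\<forall>i<n. beta b d (Suc i) = g (beta b d i)) \<and> y = beta b d n)" for y n .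
  have g': "sfun (\<lambda>e. g (u e))" if "sfun u" for u
  proof (rule sfun_lift1[OF _ that])
    show "sigma1 (\<lambda>e. e 0 = g (e 1))" using g by (simp add: sfun_def)
  qed
  show ?thesis unfolding sfun_def eq
    by (intro sigma1_intros sfun_beta g' t[THEN sfun_reindex])
qed

section \<open>The first incompleteness theorem for \<open>U\<close>\<close>

lemma sfun_enc_num:
  assumes "sfun t"
  shows "sfun (\<lambda>e. enc_trm (num (t e)))"
proof -
  have "enc_trm (num n) = ((\<lambda>c. cFn 1 (cCons c 0)) ^^ n) (cFn 0 0)" for n
    by (induction n) simp_all
  then show ?thesis
    by (simp only:) (intro sfun_funpow assms sfun_prod_encode sfun_Suc sfun_const sfun_var)
qed

theorem re_U:
  assumes "re_set A" "re_set B"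
  shows "re_thy (U_thy A B)"
  unfolding re_thy_def
proof (rule sigma1_re_set)
  have eq: "c \<in> enc_fm ` snd (U_thy A B) \<longleftrightarrow>
      (\<exists>m n. m \<noteq> n \<and> c = cNeg (cEq (enc_trm (num m)) (enc_trm (num n)))) \<or>
      (\<exists>n. n \<in> A \<and> c = cRel 0 (cCons (enc_trm (num n)) 0)) \<or>
      (\<exists>n. n \<in> B \<and> c = cNeg (cRel 0 (cCons (enc_trm (num n)) 0)))" for c
  proof -
    have "c \<in> enc_fm ` snd (U_thy A B) \<longleftrightarrow>
        (\<exists>m n. m \<noteq> n \<and> c = enc_fm (Neg (Eq (num m) (num n)))) \<or>
        (\<exists>n. n \<in> A \<and> c = enc_fm (Rel 0 [num n])) \<or> (\<exists>n. n \<in> B \<and> c = enc_fm (Neg (Rel 0 [num n])))"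
      unfolding U_thy_def snd_conv by blast
    then show ?thesis by simp
  qed
  show "sigma1 (\<lambda>e. e 0 \<in> enc_fm ` snd (U_thy A B))"
    unfolding eq
    by (intro sigma1_intros sfun_enc_num sigma1_rel1[OF re_set_sigma1[OF assms(1)]]
      sigma1_rel1[OF re_set_sigma1[OF assms(2)]])
qed

text \<open>\<open>num_fm I n\<close> says that \<open>Var 0\<close> is the interpreted numeral \<open>n\<close>. Unlike the translation of the numeral,
  it involves no renaming of variables, so its code is computed by iterating a fixed function.\<close>

fun num_fm :: "interp \<Rightarrow> nat \<Rightarrow> fm" where
  "num_fm I 0 = And (idom I) (ifun I (0, 0))"
| "num_fm I (Suc n) = And (idom I) (Ex 1 (And (Eq (Var 1) (Var 0)) (Ex 0 (And (num_fm I n) (ifun I (1, 1))))))"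

text \<open>Stands in for the translation of P(n): it has the same truth value in every model in
  which \<open>I\<close> is an interpretation.\<close>

definition P_fm :: "interp \<Rightarrow> nat \<Rightarrow> fm" where
  "P_fm I n = Ex 0 (And (num_fm I n) (irel I (0, 1)))"

lemma sfun_enc_P_fm: "sfun (\<lambda>e. enc_fm (P_fm I (e 0)))"
proof -
  have And: "enc_fm (And \<phi> \<psi>) = cAnd (enc_fm \<phi>) (enc_fm \<psi>)" for \<phi> \<psi> by (simp add: And_def)
  have Ex: "enc_fm (Ex x \<phi>) = cEx x (enc_fm \<phi>)" for x \<phi> by (simp add: Ex_def)
  have "enc_fm (num_fm I n) = ((\<lambda>c. cAnd (enc_fm (idom I)) (cEx 1 (cAnd (enc_fm (Eq (Var 1) (Var 0)))
      (cEx 0 (cAnd c (enc_fm (ifun I (1, 1)))))))) ^^ n) (enc_fm (And (idom I) (ifun I (0, 0))))" for n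
    by (induction n) (simp_all only: num_fm.simps And Ex funpow.simps id_apply comp_apply)
  then show ?thesis unfolding P_fm_def And Ex
    by (simp only:) (intro sfun_prod_encode sfun_const sfun_funpow sfun_var)
qed

context interpretation_in
begin

lemma sat_num_fm:
  assumes L: "(0, 0) \<in> fsyms L" "(1, 1) \<in> fsyms L" and "e 0 \<in> D"
  shows "sat D F R e (num_fm I n) \<longleftrightarrow> e 0 = val iF undefined (num n)"
  using assms(3)
proof (induction n arbitrary: e)
  have dom: "sat D F R e (idom I) \<longleftrightarrow> e 0 \<in> iD" if "e 0 \<in> D" for e
  proof -
    have "sat D F R e (idom I) \<longleftrightarrow> sat D F R (asg [e 0]) (idom I)"
      using dom_fv by (intro sat_cong) (auto simp: asg_def)
    then show ?thesis using that by (simp add: int_dom_def)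
  qed
  {
    case 0
    have "sat D F R e (ifun I (0, 0)) \<longleftrightarrow> sat D F R (asg ([] @ [e 0])) (ifun I (0, length ([] :: 'a list)))"
      using fun_fv[OF L(1)] by (simp, intro sat_cong) (auto simp: asg_def)
    then show ?case using 0 dom[of e] int_fun_spec[of 0 "[]"] L(1) by auto
  next
    case (Suc n)
    let ?c = "val iF undefined (num n)"
    have t: "trm_in L (num m)" for m using L by (induction m) auto
    have c: "?c \<in> iD" "?c \<in> D" using int_val_in_dom[OF t[of n], of undefined] by (auto simp: int_dom_def)
    \<comment> \<open>Variable 1 keeps a copy of the outer value while variable 0 is reused for the
      predecessor; input 0 and output 1 are what the graph formula of a unary symbol
      expects.\<close>
    have f: "sat D F R (e(1 := e 0, 0 := ?c)) (ifun I (1, 1)) \<longleftrightarrow>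
        sat D F R (asg ([?c] @ [e 0])) (ifun I (1, length [?c]))"
      using fun_fv[OF L(2)] by (simp, intro sat_cong) (auto simp: asg_def le_Suc_eq subset_iff)
    have "sat D F R e (num_fm I (Suc n)) \<longleftrightarrow> e 0 \<in> iD \<and> sat D F R (e(1 := e 0, 0 := ?c)) (ifun I (1, 1))"
      using Suc.IH Suc.prems dom[of e] c(2) by auto
    also have "\<dots> \<longleftrightarrow> e 0 = iF 1 [?c]"
      unfolding f using int_fun_spec[of 1 "[?c]"] L(2) c(1) by auto
    finally show ?case by simp
  }
qed

lemma sat_P_fm:
  assumes L: "(0, 0) \<in> fsyms L" "(1, 1) \<in> fsyms L" "(0, 1) \<in> rsyms L"
  shows "sat D F R e (P_fm I n) \<longleftrightarrow> sat iD iF iR e' (Rel 0 [num n])"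
proof -
  let ?c = "val iF undefined (num n)"
  have t: "trm_in L (num m)" for m using L by (induction m) auto
  have c: "?c \<in> D" using int_val_in_dom[OF t[of n], of undefined] by (auto simp: int_dom_def)
  have "sat D F R e (P_fm I n) \<longleftrightarrow> sat D F R (e(0 := ?c)) (irel I (0, 1))"
    unfolding P_fm_def using sat_num_fm[OF L(1,2)] c by auto
  also have "\<dots> \<longleftrightarrow> sat D F R (asg [?c]) (irel I (0, 1))"
    using rel_fv[OF L(3)] by (intro sat_cong) (auto simp: asg_def)
  also have "?c = val iF e' (num n)" by (rule val_cong) simp
  finally show ?thesis by (simp add: int_rel_def)
qed

end

theorem G1_U:
  assumes AB: "rec_inseparable A B"
  shows "G1_holds (U_thy A B)"
  unfolding G1_holds_def
proof (intro allI impI notI)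
  fix S assume "wf_thy S \<and> rec_axiomatizable S \<and> consistent S \<and> interpretable (U_thy A B) S"
    and complete: "complete S"
  then have "rec_axiomatizable S" and con: "consistent S" and "interpretable (U_thy A B) S" and wf: "wf_thy S" by auto
  then obtain I Ax where I: "is_interpretation I (U_thy A B) S"
    and Ax: "recursive_set (enc_fm ` Ax)" "\<And>\<phi>. prv Ax \<phi> \<longleftrightarrow> prv (snd S) \<phi>"
    unfolding interpretable_def rec_axiomatizable_def by blast
  have LU: "fst (U_thy A B) = L_U" by (simp add: U_thy_def)
  have L: "(0, 0) \<in> fsyms L_U" "(1, 1) \<in> fsyms L_U" "(0, 1) \<in> rsyms L_U" by (auto simp: L_U_def)
  define X where "X = {n. prv (snd S) (P_fm I n)}"
  have in_L: "fm_in (fst S) (idom I)" "fm_in (fst S) (irel I (0, 1))" "fm_in (fst S) (ifun I (0, 0))" "fm_in (fst S) (ifun I (1, 1))"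
    and fv: "fv (idom I) \<subseteq> {0}" "fv (irel I (0, 1)) \<subseteq> {..<1}" "fv (ifun I (0, 0)) \<subseteq> {..0}" "fv (ifun I (1, 1)) \<subseteq> {..1}"
    using I unfolding is_interpretation_def LU by (auto simp: L_U_def)
  have n: "fm_in (fst S) (num_fm I n) \<and> fv (num_fm I n) \<subseteq> {0}" for n
    by (induction n) (use in_L fv in \<open>auto simp: le_Suc_eq subset_iff\<close>)
  have sent: "P_fm I n \<in> sentences (fst S)" for n
    using n[of n] in_L fv by (auto simp: P_fm_def sentences_def)
  have tr: "sat D F R e (P_fm I n) \<longleftrightarrow> sat (int_dom D F R I) (int_fun D F R I) (int_rel D F R I) e' (Rel 0 [num n])"
    if "model D F R (snd S)" for D :: "trm set" and F R e e' n
  proof -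
    interpret interpretation_in D F R I L_U using is_interpretation_in[OF I that] by (simp add: LU)
    show ?thesis by (rule sat_P_fm[OF L])
  qed
  have compl: "prv (snd S) \<phi>" if "\<And>(D :: trm set) F R e. model D F R (snd S) \<Longrightarrow> range e \<subseteq> D \<Longrightarrow> sat D F R e \<phi>" for \<phi>
    using wf that by (intro completeness) (auto simp: wf_thy_def sentences_def)
  have A: "prv (snd S) (P_fm I n)" if "n \<in> A" for n
  proof (rule compl)
    have ax: "Rel 0 [num n] \<in> snd (U_thy A B)" using that by (auto simp: U_thy_def)
    show "sat D F R e (P_fm I n)" if "model D F R (snd S)" for D :: "trm set" and F R e
      using tr[OF that] interpreted_model[OF I that wf_U ax] by blast
  qed
  have B: "prv (snd S) (Neg (P_fm I n))" if "n \<in> B" for n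
  proof (rule compl)
    have ax: "Neg (Rel 0 [num n]) \<in> snd (U_thy A B)" using that by (auto simp: U_thy_def)
    show "sat D F R e (Neg (P_fm I n))" if "model D F R (snd S)" for D :: "trm set" and F R e
      using tr[OF that] interpreted_model[OF I that wf_U ax] unfolding sat_connectives by blast
  qed
  have excl: "\<not> (prv (snd S) \<phi> \<and> prv (snd S) (Neg \<phi>))" for \<phi>
    using con prv_MP unfolding consistent_def Neg_def by blast
  \<comment> \<open>Provability is coded from \<open>Ax\<close>, which is recursive and has the
    theorems of \<open>S\<close>. Completeness and consistency make non-membership in
    \<open>X\<close> provability of the negation, again a Sigma-1 condition.\<close>
  have X: "n \<in> X \<longleftrightarrow> prv_code Ax (enc_fm (P_fm I n))" "n \<notin> X \<longleftrightarrow> prv_code Ax (cNeg (enc_fm (P_fm I n)))" for n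
  proof -
    show "n \<in> X \<longleftrightarrow> prv_code Ax (enc_fm (P_fm I n))"
      by (auto simp: X_def prv_code_iff enc_fm_inj Ax(2))
    have "n \<notin> X \<longleftrightarrow> prv Ax (Neg (P_fm I n))"
      using complete sent[of n] excl unfolding X_def complete_def Ax(2) by blast
    then show "n \<notin> X \<longleftrightarrow> prv_code Ax (cNeg (enc_fm (P_fm I n)))"
      unfolding enc_fm_Neg[symmetric] by (auto simp: prv_code_iff enc_fm_inj simp del: enc_fm_Neg)
  qed
  have "sigma1 (\<lambda>e. e 0 \<in> enc_fm ` Ax)"
  proof -
    obtain f where f: "\<And>n. eval f [n] (if n \<in> enc_fm ` Ax then 1 else 0)"
      using Ax(1) unfolding recursive_set_def by blast
    \<comment> \<open>By determinism of evaluation, membership is the single Sigma-1 statement that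
      the characteristic function takes the value 1.\<close>
    have "n \<in> enc_fm ` Ax \<longleftrightarrow> eval f [n] 1" for n
      using f[of n] eval_det by (metis zero_neq_one)
    moreover have "sigma1 (\<lambda>e. eval f [e 0] 1)"
      using sigma1_eval[of "[\<lambda>e. e 0]" "\<lambda>e. 1" f] sfun_var sfun_const by simp
    ultimately show ?thesis by simp
  qed
  note prv1 = sigma1_prv_code[OF this]
  have "recursive_set X"
  proof (rule sigma1_recursive_set)
    show "sigma1 (\<lambda>e. e 0 \<in> X)" unfolding X(1)
      by (rule prv1) (rule sfun_enc_P_fm)
    show "sigma1 (\<lambda>e. e 0 \<notin> X)" unfolding X(2)
      by (rule prv1) (intro sfun_prod_encode sfun_const sfun_enc_P_fm)
  qed
  moreover have "A \<subseteq> X" using A by (auto simp: X_def)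
  moreover have "X \<inter> B = {}" using B excl by (auto simp: X_def)
  ultimately show False using AB unfolding rec_inseparable_def by blast
qed

theorem mainTheorem6:
  fixes A B :: "nat set"
  assumes "rec_inseparable A B"
  shows "wf_thy (U_thy A B) \<and> re_thy (U_thy A B) \<and> G1_holds (U_thy A B) \<and>
         strictly_below (U_thy A B) R_thy"
  using assms wf_U re_U G1_U[OF assms] U_interpretable_R R_not_interpretable
  unfolding strictly_below_def rec_inseparable_def by blast

end
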